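(* For the finite-horizon linear system with linear Gaussian policy, its REINFORCE estimators $\widehat G_K,\widehat G_\ell$, its objective $J(K,\Sigma)=\mathbb E[R(\tau)]$, and the lifted matrices described in the context, the following hold. **(i) Second moments.** $$\mathbb E\big[\|\widehat G_K\|_{\mathrm F}^2\big]=\sum_{t,p=0}^{T-1}\sum_{i=1}^6E^K_{i,tp},\qquad \mathbb E\big[\|\widehat G_\ell\|_2^2\big]=\sum_{t,p=0}^{T-1}\sum_{i=1}^4E^\ell_{i,tp},$$ where (writing $[X]:=\mathrm{sym}(X)$, and $W=W^K_{tp}$, $G=G_{tp}$, $U=U_{tp}$, $\alpha=\alpha_{tp}$, $\beta=\beta_{tp}$, $\delta=\delta_{tp}$, $\kappa=\kappa_{tp}$) $$E^K_{1,tp}=\mathrm{IS}_{\Sigma_0}([G],\overline M_{ss},\overline M_{ss})\,\mathrm{IS}_{\overline\Sigma}([W])+\mathrm{IS}_{\Sigma_0}(\overline M_{ss},\overline M_{ss})\,\mathrm{IS}_{\overline\Sigma}([W],[U]),$$ $$E^K_{2,tp}=\mathrm{IS}_{\Sigma_0}([G])\,\mathrm{IS}_{\overline\Sigma}([W],\overline M_{ee},\overline M_{ee})+\mathrm{IS}_{\overline\Sigma}([W],[U],\overline M_{ee},\overline M_{ee}),$$ $$E^K_{3,tp}=2\,\mathrm{IS}_{\Sigma_0}([G],\overline M_{ss})\,\mathrm{IS}_{\overline\Sigma}([W],\overline M_{ee})+2\,\mathrm{IS}_{\Sigma_0}(\overline M_{ss})\,\mathrm{IS}_{\overline\Sigma}([W],[U],\overline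 M_{ee}),$$ $$E^K_{4,tp}=4\Big(\alpha\,\mathrm{IS}_{\Sigma_0}([G],V_0)+2\,\mathrm{IS}_{\Sigma_0}([G],V_{tp})+(\alpha\beta+2\delta)\,\mathrm{IS}_{\Sigma_0}(V_0)+2\beta\,\mathrm{IS}_{\Sigma_0}(V_{tp})+2\alpha\,\mathrm{IS}_{\Sigma_0}(\widetilde V_{tp})+8\,\mathrm{IS}_{\Sigma_0}([\widehat V_{tp}])\Big),$$ $$E^K_{5,tp}=4\Big(\alpha\,\mathrm{IS}_{\Sigma_0}(\overline M_{ss},V^{(0)}_{tp})+2\,\mathrm{IS}_{\Sigma_0}(\overline M_{ss},V^{(1)}_{tp})\Big),$$ $$E^K_{6,tp}=4\Big((\alpha\mu+2\kappa)\,\mathrm{IS}_{\Sigma_0}(V^{(0)}_{tp})+2\mu\,\mathrm{IS}_{\Sigma_0}(V^{(1)}_{tp})+2\alpha\,\mathrm{IS}_{\Sigma_0}(V^{(2)}_{tp})+8\,\mathrm{IS}_{\Sigma_0}(V^{(3)}_{tp})\Big),$$ and $$E^\ell_{1,tp}=2m\,\mathbf 1_{\{t=p\}}\,\mathrm{IS}_{\Sigma_0}(\overline M_{ss},\overline M_{ss}),$$ $$E^\ell_{2,tp}=\sum_{i=1}^md_i^2\,\mathrm{IS}_{\overline\Sigma}(Q_{t,i},Q_{p,i},\overline M_{ee},\overline M_{ee})-\mathrm{IS}_{\overline\Sigma}(W^\ell_t,\overline M_{ee},\overline M_{ee})-\mathrm{IS}_{\overline\Sigma}(W^\ell_p,\overline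 M_{ee},\overline M_{ee})+m\,\mathrm{IS}_{\overline\Sigma}(\overline M_{ee},\overline M_{ee}),$$ $$E^\ell_{3,tp}=2\,\mathrm{IS}_{\Sigma_0}(\overline M_{ss})\Big[\sum_{i=1}^md_i^2\,\mathrm{IS}_{\overline\Sigma}(Q_{t,i},Q_{p,i},\overline M_{ee})-\mathrm{IS}_{\overline\Sigma}(W^\ell_t,\overline M_{ee})-\mathrm{IS}_{\overline\Sigma}(W^\ell_p,\overline M_{ee})+m\,\mathrm{IS}_{\overline\Sigma}(\overline M_{ee})\Big],$$ $$E^\ell_{4,tp}=8m\,\mathbf 1_{\{t=p\}}\,\mathrm{IS}_{\Sigma_0}(V_0)+32\sum_{i=1}^md_i^2\,\mathrm{IS}_{\Sigma_0}(V_{tp,i}).$$ **(ii) Mean gradients.** Let $P_t:=\mathrm{Cov}(s_t)$, which satisfies $P_{t+1}=FP_tF^\top+B\Sigma B^\top$, $P_0=\Sigma_0$, and let $\{\Lambda_t\}_{t=1}^T$ satisfy the backward recursion $\Lambda_T=\tfrac1\gamma Q_s$, $\Lambda_t=\tfrac1\gamma Q_s+K^\top Q_aK+\gamma F^\top\Lambda_{t+1}F$ for $1\le t\le T-1$. Then $$\nabla_KJ=-2\sum_{t=0}^{T-1}\gamma^t\big(Q_aKP_t+\gamma B^\top\Lambda_{t+1}FP_t\big),\qquad \nabla_\ell J=-2\,\mathrm{diag}\Big(\Sigma\sum_{t=0}^{T-1}\gamma^t\big(Q_a+\gamma B^\top\Lambda_{t+1}B\big)\Big).$$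
   Context: **System.** $n,m,T\ge1$, $A\in\mathbb R^{n\times n}$, $B\in\mathbb R^{n\times m}$, $K\in\mathbb R^{m\times n}$, $F:=A+BK$; $Q_s\in\mathbb R^{n\times n}$, $Q_a\in\mathbb R^{m\times m}$ symmetric positive semidefinite; $\gamma\in(0,1]$ the discount factor; $\Sigma=\mathrm{diag}(\sigma_1^2,\dots,\sigma_m^2)=\mathrm{diag}(e^{2\ell_1},\dots,e^{2\ell_m})\succ0$ with $\ell\in\mathbb R^m$; $\Sigma_0\succeq0$. $s_0\sim\mathcal N(0,\Sigma_0)$ and $\varepsilon_0,\dots,\varepsilon_{T-1}\sim\mathcal N(0,\Sigma)$ are independent; $a_t=Ks_t+\varepsilon_t$, $s_{t+1}=As_t+Ba_t=Fs_t+B\varepsilon_t$. Reward $r(s,a)=-(s^\top Q_ss+a^\top Q_aa)$, return $R(\tau)=\sum_{t=0}^{T-1}\gamma^tr(s_{t+1},a_t)$, objective $J(K,\Sigma)=\mathbb E[R(\tau)]$, a function of $(K,\ell)$. REINFORCE estimators: $$\widehat G_K=\sum_{t=0}^{T-1}\Sigma^{-1}\varepsilon_ts_t^\top R(\tau),\qquad \widehat G_\ell=\sum_{t=0}^{T-1}\big(\Sigma^{-1}(\varepsilon_t\odot\varepsilon_t)-\mathbf 1\big)R(\tau),$$ with $\odot$ the Hadamard product and $\mathbf 1$ the all-ones vector. **Lifted matrices.** Let $\bar\varepsilon=(\varepsilon_0^\top,\dots,\varepsilon_{T-1}^\top)^\top\in\mathbb R^{mT}$, $\overline\Sigma:=I_T\otimes\Sigma$.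 For $t=0,\dots,T$ let $F_t:=F^t\in\mathbb R^{n\times n}$, and let $E_t\in\mathbb R^{n\times mT}$ be the block row whose block in position $i\in\{0,\dots,T-1\}$ is $F^{t-1-i}B$ if $i\le t-1$ and $0$ otherwise, so that $s_t=F_ts_0+E_t\bar\varepsilon$. Let $\Pi_t\in\mathbb R^{m\times mT}$ be the block selector with $\varepsilon_t=\Pi_t\bar\varepsilon$. Let $\mathcal F_S^+$, $\mathcal F_E^+$ be the vertical stacks of $F_1,\dots,F_T$ and of $E_1,\dots,E_T$; let $\mathcal K_S$, $\mathcal K_E$ be the vertical stacks of $KF_0,\dots,KF_{T-1}$ and of $KE_0+\Pi_0,\dots,KE_{T-1}+\Pi_{T-1}$. With $D_\gamma=\mathrm{diag}(\gamma^0,\dots,\gamma^{T-1})$, $\mathsf Q_{s,\gamma}=D_\gamma\otimes Q_s$, $\mathsf Q_{a,\gamma}=D_\gamma\otimes Q_a$, set $$\overline M_{ss}={\mathcal F_S^+}^\top\mathsf Q_{s,\gamma}\mathcal F_S^++\mathcal K_S^\top\mathsf Q_{a,\gamma}\mathcal K_S,\quad \overline M_{se}={\mathcal F_S^+}^\top\mathsf Q_{s,\gamma}\mathcal F_E^++\mathcal K_S^\top\mathsf Q_{a,\gamma}\mathcal K_E,\quad \overline M_{ee}={\mathcal F_E^+}^\top\mathsf Q_{s,\gamma}\mathcal F_E^++\mathcal K_E^\top\mathsf Q_{a,\gamma}\mathcal K_E,$$ so that $R(\tau)=-(s_0^\top\overline M_{ss}s_0+2s_0^\top\overline M_{se}\bar\varepsilon+\bar\varepsilon^\top\overline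 M_{ee}\bar\varepsilon)$. **Shorthand.** $\mathrm{sym}(X)=\tfrac12(X+X^\top)$. For $\Omega\succeq0$, $x\sim\mathcal N(0,\Omega)$ and symmetric $A_1,\dots,A_k$: $\mathrm{IS}_\Omega(A_1,\dots,A_k):=\mathbb E[\prod_{i=1}^kx^\top A_ix]$. $\mathrm{diag}(M)$ of a square matrix $M$ is the vector of its diagonal entries. For $0\le t,p\le T-1$: - $W^K_{tp}=\Pi_t^\top\Sigma^{-2}\Pi_p$, $G_{tp}=F_t^\top F_p$, $J_{tp}=F_t^\top E_p+F_p^\top E_t$, $U_{tp}=E_t^\top E_p$. - $\alpha_{tp}=\mathrm{tr}(\overline\Sigma\,\mathrm{sym}(W^K_{tp}))$, $\beta_{tp}=\mathrm{tr}(\overline\Sigma\,\mathrm{sym}(U_{tp}))$, $\delta_{tp}=\mathrm{tr}(\overline\Sigma\,\mathrm{sym}(W^K_{tp})\,\overline\Sigma\,\mathrm{sym}(U_{tp}))$, $\mu=\mathrm{tr}(\overline\Sigma\,\overline M_{ee})$, $\kappa_{tp}=\mathrm{tr}(\overline\Sigma\,\mathrm{sym}(W^K_{tp})\,\overline\Sigma\,\overline M_{ee})$. - $V_0=\overline M_{se}\overline\Sigma\,\overline M_{se}^\top$, $V_{tp}=\overline M_{se}\overline\Sigma\,\mathrm{sym}(W^K_{tp})\,\overline\Sigma\,\overline M_{se}^\top$, $\widetilde V_{tp}=\overline M_{se}\overline\Sigma\,\mathrm{sym}(U_{tp})\,\overline\Sigma\,\overline M_{se}^\top$, $\widehat V_{tp}=\overline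 M_{se}\overline\Sigma\,\mathrm{sym}(W^K_{tp})\,\overline\Sigma\,\mathrm{sym}(U_{tp})\,\overline\Sigma\,\overline M_{se}^\top$. - $V^{(j)}_{tp}=\mathrm{sym}(\overline M_{se}A^{(j)}J_{tp}^\top)$ for $j=0,1,2,3$, where $A^{(0)}=\overline\Sigma$, $A^{(1)}=\overline\Sigma\,\mathrm{sym}(W^K_{tp})\,\overline\Sigma$, $A^{(2)}=\overline\Sigma\,\overline M_{ee}\,\overline\Sigma$, $A^{(3)}=\mathrm{sym}(\overline\Sigma\,\mathrm{sym}(W^K_{tp})\,\overline\Sigma\,\overline M_{ee}\,\overline\Sigma)$. - $d_i=\sigma_i^{-2}$ (the diagonal entries of $\Sigma^{-1}$), $Q_{t,i}=\Pi_t^\top e_ie_i^\top\Pi_t$, $W^\ell_t=\Pi_t^\top\Sigma^{-1}\Pi_t$, $V_{tp,i}=\mathrm{sym}(\overline M_{se}\overline\Sigma\,Q_{t,i}\,\overline\Sigma\,Q_{p,i}\,\overline\Sigma\,\overline M_{se}^\top)$. *)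

theory Defs
  imports "HOL-Analysis.Analysis" "HOL-Probability.Probability"
begin

section \<open>Matrices\<close>

text \<open>On \<open>real^'n^'n\<close> the operations \<open>*\<close> and \<open>^\<close> of the library are entrywise
  (so \<open>*\<close> on vectors is the Hadamard product and \<open>1\<close> the all-ones vector);
  matrix products are \<open>**\<close> and matrix powers are \<open>matpow\<close>. The library norm and inner
  product on matrices are the Frobenius ones.\<close>

primrec matpow :: "real^'n^'n \<Rightarrow> nat \<Rightarrow> real^'n^'n" where
  "matpow F 0 = mat 1"
| "matpow F (Suc k) = F ** matpow F k"

definition symp :: "real^'n^'n \<Rightarrow> real^'n^'n" where
  "symp X = (1/2) *\<^sub>R (X + transpose X)"

definition pos_semidef :: "real^'n^'n \<Rightarrow> bool" where
  "pos_semidef X \<longleftrightarrow> transpose X = X \<and> (\<forall>v. 0 \<le> v \<bullet> (X *v v))"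

definition diag_mat :: "('n \<Rightarrow> real) \<Rightarrow> real^'n^'n" where
  "diag_mat d = (\<chi> i j. if i = j then d i else 0)"

definition diag_vec :: "real^'n^'n \<Rightarrow> real^'n" where
  "diag_vec X = (\<chi> i. X $ i $ i)"

definition kron :: "real^'a^'b \<Rightarrow> real^'c^'d \<Rightarrow> real^('a \<times> 'c)^('b \<times> 'd)" where
  "kron X Y = (\<chi> r c. X $ fst r $ fst c * Y $ snd r $ snd c)"

definition outer_prod :: "real^'a \<Rightarrow> real^'b \<Rightarrow> real^'b^'a" where
  "outer_prod v w = (\<chi> i j. v $ i * w $ j)"

definition quad_form :: "real^'n^'n \<Rightarrow> real^'n \<Rightarrow> real" where
  "quad_form X v = v \<bullet> (X *v v)"

section \<open>Time indices\<close>

text \<open>The horizon is \<open>T = CARD('t)\<close> for a finite linearly ordered type \<open>'t\<close>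
  (such types exist in every size \<open>T \<ge> 1\<close>). Times are natural numbers; \<open>'t\<close> only
  indexes the blocks of lifted vectors and matrices, so that \<open>\<real>\<^sup>m\<^sup>T\<close> is
  \<open>real^('t \<times> 'm)\<close>. The element \<open>k\<close> of \<open>'t\<close> stands for the time \<open>step k\<close>.\<close>

definition step :: "'t::{finite,linorder} \<Rightarrow> nat" where
  "step k = card {j. j < k}"

lemma bij_betw_step: "bij_betw step (UNIV :: 't::{finite,linorder} set) {..<CARD('t)}"
proof -
  have mono: "step j < step k" if "j < k" for j k :: 't
    unfolding step_def by (rule psubset_card_mono) (use that in auto)
  have inj: "inj (step :: 't \<Rightarrow> nat)"
    by (rule injI) (metis less_irrefl linorder_neqE mono)
  have "step k < CARD('t)" for k :: 't
    unfolding step_def by (rule psubset_card_mono) auto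
  then have "range (step :: 't \<Rightarrow> nat) \<subseteq> {..<CARD('t)}" by auto
  then have "range (step :: 't \<Rightarrow> nat) = {..<CARD('t)}"
    using inj by (intro card_subset_eq) (auto simp: card_image)
  with inj show ?thesis by (simp add: bij_betw_def)
qed

definition vstack :: "(nat \<Rightarrow> real^'c^'r) \<Rightarrow> real^'c^('t::{finite,linorder} \<times> 'r)" where
  "vstack X = (\<chi> kr. X (step (fst kr)) $ snd kr)"

section \<open>Gaussian laws\<close>

definition centered_normal :: "real \<Rightarrow> real measure" where
  "centered_normal v =
     (if v = 0 then return borel 0
      else density lborel (\<lambda>x. ennreal (normal_density 0 (sqrt v) x)))"

text \<open>\<open>N\<close> is the (possibly degenerate) law \<open>\<N>(0, \<Omega>)\<close>: every linear functional
  \<open>u \<bullet> x\<close> is normal with mean \<open>0\<close> and variance \<open>u \<bullet> \<Omega> u\<close>.\<close>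

definition gaussian :: "real^'k^'k \<Rightarrow> (real^'k) measure \<Rightarrow> bool" where
  "gaussian \<Omega> N \<longleftrightarrow> prob_space N \<and> sets N = sets borel \<and>
     (\<forall>u. distr N borel (\<lambda>x. u \<bullet> x) = centered_normal (quad_form \<Omega> u))"

text \<open>For positive semidefinite \<open>\<Omega>\<close> the law exists and is unique.\<close>

definition gaussian_law :: "real^'k^'k \<Rightarrow> (real^'k) measure" where
  "gaussian_law \<Omega> = (SOME N. gaussian \<Omega> N)"

definition IS :: "real^'k^'k \<Rightarrow> (real^'k^'k) list \<Rightarrow> real" where
  "IS \<Omega> As = (\<integral>x. (\<Prod>X\<leftarrow>As. quad_form X x) \<partial>gaussian_law \<Omega>)"

definition covariance :: "'w measure \<Rightarrow> ('w \<Rightarrow> real^'n) \<Rightarrow> real^'n^'n" where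
  "covariance M X = (\<chi> i j. \<integral>w. (X w $ i - (\<integral>w'. X w' $ i \<partial>M)) *
                               (X w $ j - (\<integral>w'. X w' $ j \<partial>M)) \<partial>M)"

section \<open>The controlled system\<close>

text \<open>The policy parameters \<open>K\<close> and \<open>l\<close> (the vector of log standard deviations) are kept
  separate from the problem data since the objective is differentiated in them.
  The field \<open>horizon\<close> carries no information beyond its type.\<close>

record ('t, 'n, 'm) lq =
  horizon :: "'t itself"
  dynA :: "real^'n^'n"
  dynB :: "real^'m^'n"
  costS :: "real^'n^'n"
  costA :: "real^'m^'m"
  disc :: real
  init_cov :: "real^'n^'n"

definition Fcl :: "('t::{finite,linorder}, 'n::finite, 'm::finite) lq \<Rightarrow> real^'n^'m \<Rightarrow> real^'n^'n" where
  "Fcl P K = dynA P + dynB P ** K"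

definition noise_cov :: "real^'m \<Rightarrow> real^'m^'m" where
  "noise_cov l = diag_mat (\<lambda>i. (exp (l $ i))\<^sup>2)"

definition dinv :: "real^'m \<Rightarrow> 'm \<Rightarrow> real" where
  "dinv l i = 1 / (exp (l $ i))\<^sup>2"

text \<open>The trajectory as a function of the initial state \<open>s\<close> and the noise sequence \<open>e\<close>.\<close>

primrec state ::
  "('t::{finite,linorder}, 'n::finite, 'm::finite) lq \<Rightarrow> real^'n^'m \<Rightarrow> real^'n \<Rightarrow> (nat \<Rightarrow> real^'m) \<Rightarrow> nat \<Rightarrow> real^'n"
  where
  "state P K s e 0 = s"
| "state P K s e (Suc t) =
     dynA P *v state P K s e t + dynB P *v (K *v state P K s e t + e t)"

definition action ::
  "('t::{finite,linorder}, 'n::finite, 'm::finite) lq \<Rightarrow> real^'n^'m \<Rightarrow> real^'n \<Rightarrow> (nat \<Rightarrow> real^'m) \<Rightarrow> nat \<Rightarrow> real^'m"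
  where "action P K s e t = K *v state P K s e t + e t"

definition reward ::
  "('t::{finite,linorder}, 'n::finite, 'm::finite) lq \<Rightarrow> real^'n \<Rightarrow> real^'m \<Rightarrow> real" where
  "reward P x a = - (quad_form (costS P) x + quad_form (costA P) a)"

definition total_return ::
  "('t::{finite,linorder}, 'n::finite, 'm::finite) lq \<Rightarrow> real^'n^'m \<Rightarrow> real^'n \<Rightarrow> (nat \<Rightarrow> real^'m) \<Rightarrow> real"
  where
  "total_return P K s e =
     (\<Sum>t<CARD('t). disc P ^ t * reward P (state P K s e (Suc t)) (action P K s e t))"

definition grad_est_K ::
  "('t::{finite,linorder}, 'n::finite, 'm::finite) lq \<Rightarrow> real^'n^'m \<Rightarrow> real^'m \<Rightarrow> real^'n \<Rightarrow> (nat \<Rightarrow> real^'m) \<Rightarrow> real^'n^'m"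
  where
  "grad_est_K P K l s e =
     (\<Sum>t<CARD('t). total_return P K s e *\<^sub>R
        outer_prod (matrix_inv (noise_cov l) *v e t) (state P K s e t))"

definition grad_est_l ::
  "('t::{finite,linorder}, 'n::finite, 'm::finite) lq \<Rightarrow> real^'n^'m \<Rightarrow> real^'m \<Rightarrow> real^'n \<Rightarrow> (nat \<Rightarrow> real^'m) \<Rightarrow> real^'m"
  where
  "grad_est_l P K l s e =
     (\<Sum>t<CARD('t). total_return P K s e *\<^sub>R
        (matrix_inv (noise_cov l) *v (e t * e t) - 1))"

text \<open>\<open>s0\<close> and \<open>e 0, \<dots>, e (T - 1)\<close> are mutually independent Gaussian vectors on \<open>M\<close>.
  Independence is spelled out with generated sigma-algebras (index \<open>0\<close> for \<open>s0\<close>, index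
  \<open>Suc t\<close> for \<open>e t\<close>) because \<open>indep_vars\<close> requires a common codomain type.\<close>

definition noise_model ::
  "('t::{finite,linorder}, 'n::finite, 'm::finite) lq \<Rightarrow> real^'m \<Rightarrow> 'w measure \<Rightarrow>
     ('w \<Rightarrow> real^'n) \<Rightarrow> (nat \<Rightarrow> 'w \<Rightarrow> real^'m) \<Rightarrow> bool"
  where
  "noise_model P l M s0 e \<longleftrightarrow>
     prob_space M \<and>
     s0 \<in> borel_measurable M \<and> gaussian (init_cov P) (distr M borel s0) \<and>
     (\<forall>t<CARD('t). e t \<in> borel_measurable M \<and> gaussian (noise_cov l) (distr M borel (e t))) \<and>
     prob_space.indep_sets M
       (\<lambda>k. case k of 0 \<Rightarrow> {s0 -` X \<inter> space M | X. X \<in> sets borel}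
                    | Suc t \<Rightarrow> {e t -` X \<inter> space M | X. X \<in> sets borel})
       {..CARD('t)}"

text \<open>The noise law depends on \<open>l\<close>, so the objective is taken over a family of probability
  spaces \<open>M l\<close> carrying \<open>s0 l\<close> and \<open>e l\<close>; by \<open>noise_model\<close> its value depends
  only on the joint law. The family may be constant in \<open>M\<close> or in the random variables.\<close>

definition objective ::
  "('t::{finite,linorder}, 'n::finite, 'm::finite) lq \<Rightarrow> (real^'m \<Rightarrow> 'w measure) \<Rightarrow>
     (real^'m \<Rightarrow> 'w \<Rightarrow> real^'n) \<Rightarrow> (real^'m \<Rightarrow> nat \<Rightarrow> 'w \<Rightarrow> real^'m) \<Rightarrow>
     real^'n^'m \<Rightarrow> real^'m \<Rightarrow> real"
  where
  "objective P M s0 e K l = (\<integral>w. total_return P K (s0 l w) (\<lambda>t. e l t w) \<partial>M l)"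

section \<open>Lifted matrices\<close>

definition Sbar ::
  "('t::{finite,linorder}, 'n::finite, 'm::finite) lq \<Rightarrow> real^'m \<Rightarrow> real^('t \<times> 'm)^('t \<times> 'm)" where
  "Sbar P l = kron (mat 1) (noise_cov l)"

definition Ft ::
  "('t::{finite,linorder}, 'n::finite, 'm::finite) lq \<Rightarrow> real^'n^'m \<Rightarrow> nat \<Rightarrow> real^'n^'n" where
  "Ft P K t = matpow (Fcl P K) t"

definition Et ::
  "('t::{finite,linorder}, 'n::finite, 'm::finite) lq \<Rightarrow> real^'n^'m \<Rightarrow> nat \<Rightarrow> real^('t \<times> 'm)^'n" where
  "Et P K t = (\<chi> r c. if step (fst c) + 1 \<le> t
       then (matpow (Fcl P K) (t - 1 - step (fst c)) ** dynB P) $ r $ snd c else 0)"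

definition Pi_sel :: "nat \<Rightarrow> real^('t::{finite,linorder} \<times> 'm::finite)^'m" where
  "Pi_sel t = (\<chi> r c. if step (fst c) = t \<and> snd c = r then 1 else 0)"

definition FS ::
  "('t::{finite,linorder}, 'n::finite, 'm::finite) lq \<Rightarrow> real^'n^'m \<Rightarrow> real^'n^('t \<times> 'n)" where
  "FS P K = vstack (\<lambda>k. Ft P K (k + 1))"

definition FE ::
  "('t::{finite,linorder}, 'n::finite, 'm::finite) lq \<Rightarrow> real^'n^'m \<Rightarrow> real^('t \<times> 'm)^('t \<times> 'n)" where
  "FE P K = vstack (\<lambda>k. Et P K (k + 1))"

definition KS ::
  "('t::{finite,linorder}, 'n::finite, 'm::finite) lq \<Rightarrow> real^'n^'m \<Rightarrow> real^'n^('t \<times> 'm)" where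
  "KS P K = vstack (\<lambda>k. K ** Ft P K k)"

definition KE ::
  "('t::{finite,linorder}, 'n::finite, 'm::finite) lq \<Rightarrow> real^'n^'m \<Rightarrow> real^('t \<times> 'm)^('t \<times> 'm)" where
  "KE P K = vstack (\<lambda>k. K ** Et P K k + Pi_sel k)"

definition Dgamma ::
  "('t::{finite,linorder}, 'n::finite, 'm::finite) lq \<Rightarrow> ((real, 't) vec, 't) vec" where
  "Dgamma P = diag_mat (\<lambda>k. disc P ^ step k)"

definition QSg ::
  "('t::{finite,linorder}, 'n::finite, 'm::finite) lq \<Rightarrow> real^('t \<times> 'n)^('t \<times> 'n)" where
  "QSg P = kron (Dgamma P) (costS P)"

definition QAg ::
  "('t::{finite,linorder}, 'n::finite, 'm::finite) lq \<Rightarrow> real^('t \<times> 'm)^('t \<times> 'm)" where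
  "QAg P = kron (Dgamma P) (costA P)"

definition Mss ::
  "('t::{finite,linorder}, 'n::finite, 'm::finite) lq \<Rightarrow> real^'n^'m \<Rightarrow> real^'n^'n" where
  "Mss P K = transpose (FS P K) ** QSg P ** FS P K + transpose (KS P K) ** QAg P ** KS P K"

definition Mse ::
  "('t::{finite,linorder}, 'n::finite, 'm::finite) lq \<Rightarrow> real^'n^'m \<Rightarrow> real^('t \<times> 'm)^'n" where
  "Mse P K = transpose (FS P K) ** QSg P ** FE P K + transpose (KS P K) ** QAg P ** KE P K"

definition Mee ::
  "('t::{finite,linorder}, 'n::finite, 'm::finite) lq \<Rightarrow> real^'n^'m \<Rightarrow> real^('t \<times> 'm)^('t \<times> 'm)" where
  "Mee P K = transpose (FE P K) ** QSg P ** FE P K + transpose (KE P K) ** QAg P ** KE P K"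

section \<open>Shorthand matrices and scalars\<close>

text \<open>The argument \<open>P\<close> of \<open>WK\<close> only fixes the horizon type.\<close>

definition WK ::
  "('t::{finite,linorder}, 'n::finite, 'm::finite) lq \<Rightarrow> real^'m \<Rightarrow> nat \<Rightarrow> nat \<Rightarrow> real^('t \<times> 'm)^('t \<times> 'm)" where
  "WK P l t p = transpose (Pi_sel t) **
     (matrix_inv (noise_cov l) ** matrix_inv (noise_cov l)) ** Pi_sel p"

definition Gtp ::
  "('t::{finite,linorder}, 'n::finite, 'm::finite) lq \<Rightarrow> real^'n^'m \<Rightarrow> nat \<Rightarrow> nat \<Rightarrow> real^'n^'n" where
  "Gtp P K t p = transpose (Ft P K t) ** Ft P K p"

definition Jtp ::
  "('t::{finite,linorder}, 'n::finite, 'm::finite) lq \<Rightarrow> real^'n^'m \<Rightarrow> nat \<Rightarrow> nat \<Rightarrow> real^('t \<times> 'm)^'n" where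
  "Jtp P K t p = transpose (Ft P K t) ** Et P K p + transpose (Ft P K p) ** Et P K t"

definition Utp ::
  "('t::{finite,linorder}, 'n::finite, 'm::finite) lq \<Rightarrow> real^'n^'m \<Rightarrow> nat \<Rightarrow> nat \<Rightarrow> real^('t \<times> 'm)^('t \<times> 'm)" where
  "Utp P K t p = transpose (Et P K t) ** Et P K p"

context
  fixes P :: "('t::{finite,linorder}, 'n::finite, 'm::finite) lq"
    and K :: "real^'n^'m" and l :: "real^'m"
begin

definition alpha :: "nat \<Rightarrow> nat \<Rightarrow> real" where
  "alpha t p = trace (Sbar P l ** symp (WK P l t p))"

definition beta :: "nat \<Rightarrow> nat \<Rightarrow> real" where
  "beta t p = trace (Sbar P l ** symp (Utp P K t p))"

definition delta :: "nat \<Rightarrow> nat \<Rightarrow> real" where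
  "delta t p = trace (Sbar P l ** symp (WK P l t p) ** Sbar P l ** symp (Utp P K t p))"

definition mu :: real where
  "mu = trace (Sbar P l ** Mee P K)"

definition kappa :: "nat \<Rightarrow> nat \<Rightarrow> real" where
  "kappa t p = trace (Sbar P l ** symp (WK P l t p) ** Sbar P l ** Mee P K)"

definition V0 :: "real^'n^'n" where
  "V0 = Mse P K ** Sbar P l ** transpose (Mse P K)"

definition Vtp :: "nat \<Rightarrow> nat \<Rightarrow> real^'n^'n" where
  "Vtp t p = Mse P K ** Sbar P l ** symp (WK P l t p) ** Sbar P l ** transpose (Mse P K)"

definition Vtilde :: "nat \<Rightarrow> nat \<Rightarrow> real^'n^'n" where
  "Vtilde t p = Mse P K ** Sbar P l ** symp (Utp P K t p) ** Sbar P l ** transpose (Mse P K)"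

definition Vhat :: "nat \<Rightarrow> nat \<Rightarrow> real^'n^'n" where
  "Vhat t p = Mse P K ** Sbar P l ** symp (WK P l t p) ** Sbar P l ** symp (Utp P K t p)
     ** Sbar P l ** transpose (Mse P K)"

definition A0 :: "real^('t \<times> 'm)^('t \<times> 'm)" where
  "A0 = Sbar P l"

definition A1 :: "nat \<Rightarrow> nat \<Rightarrow> real^('t \<times> 'm)^('t \<times> 'm)" where
  "A1 t p = Sbar P l ** symp (WK P l t p) ** Sbar P l"

definition A2 :: "real^('t \<times> 'm)^('t \<times> 'm)" where
  "A2 = Sbar P l ** Mee P K ** Sbar P l"

definition A3 :: "nat \<Rightarrow> nat \<Rightarrow> real^('t \<times> 'm)^('t \<times> 'm)" where
  "A3 t p = symp (Sbar P l ** symp (WK P l t p) ** Sbar P l ** Mee P K ** Sbar P l)"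

definition Vj :: "real^('t \<times> 'm)^('t \<times> 'm) \<Rightarrow> nat \<Rightarrow> nat \<Rightarrow> real^'n^'n" where
  "Vj X t p = symp (Mse P K ** X ** transpose (Jtp P K t p))"

definition Qti :: "nat \<Rightarrow> 'm \<Rightarrow> real^('t \<times> 'm)^('t \<times> 'm)" where
  "Qti t i = transpose (Pi_sel t) ** outer_prod (axis i 1) (axis i 1) ** Pi_sel t"

definition Wl :: "nat \<Rightarrow> real^('t \<times> 'm)^('t \<times> 'm)" where
  "Wl t = transpose (Pi_sel t) ** matrix_inv (noise_cov l) ** Pi_sel t"

definition Vtpi :: "nat \<Rightarrow> nat \<Rightarrow> 'm \<Rightarrow> real^'n^'n" where
  "Vtpi t p i = symp (Mse P K ** Sbar P l ** Qti t i ** Sbar P l ** Qti p i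
     ** Sbar P l ** transpose (Mse P K))"

section \<open>The terms of the second moments\<close>

definition EK1 :: "nat \<Rightarrow> nat \<Rightarrow> real" where
  "EK1 t p =
     IS (init_cov P) [symp (Gtp P K t p), Mss P K, Mss P K] * IS (Sbar P l) [symp (WK P l t p)]
   + IS (init_cov P) [Mss P K, Mss P K] * IS (Sbar P l) [symp (WK P l t p), symp (Utp P K t p)]"

definition EK2 :: "nat \<Rightarrow> nat \<Rightarrow> real" where
  "EK2 t p =
     IS (init_cov P) [symp (Gtp P K t p)] * IS (Sbar P l) [symp (WK P l t p), Mee P K, Mee P K]
   + IS (Sbar P l) [symp (WK P l t p), symp (Utp P K t p), Mee P K, Mee P K]"

definition EK3 :: "nat \<Rightarrow> nat \<Rightarrow> real" where
  "EK3 t p =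
     2 * IS (init_cov P) [symp (Gtp P K t p), Mss P K] * IS (Sbar P l) [symp (WK P l t p), Mee P K]
   + 2 * IS (init_cov P) [Mss P K]
       * IS (Sbar P l) [symp (WK P l t p), symp (Utp P K t p), Mee P K]"

definition EK4 :: "nat \<Rightarrow> nat \<Rightarrow> real" where
  "EK4 t p = 4 *
     (alpha t p * IS (init_cov P) [symp (Gtp P K t p), V0]
      + 2 * IS (init_cov P) [symp (Gtp P K t p), Vtp t p]
      + (alpha t p * beta t p + 2 * delta t p) * IS (init_cov P) [V0]
      + 2 * beta t p * IS (init_cov P) [Vtp t p]
      + 2 * alpha t p * IS (init_cov P) [Vtilde t p]
      + 8 * IS (init_cov P) [symp (Vhat t p)])"

definition EK5 :: "nat \<Rightarrow> nat \<Rightarrow> real" where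
  "EK5 t p = 4 *
     (alpha t p * IS (init_cov P) [Mss P K, Vj A0 t p]
      + 2 * IS (init_cov P) [Mss P K, Vj (A1 t p) t p])"

definition EK6 :: "nat \<Rightarrow> nat \<Rightarrow> real" where
  "EK6 t p = 4 *
     ((alpha t p * mu + 2 * kappa t p) * IS (init_cov P) [Vj A0 t p]
      + 2 * mu * IS (init_cov P) [Vj (A1 t p) t p]
      + 2 * alpha t p * IS (init_cov P) [Vj A2 t p]
      + 8 * IS (init_cov P) [Vj (A3 t p) t p])"

definition El1 :: "nat \<Rightarrow> nat \<Rightarrow> real" where
  "El1 t p = 2 * real CARD('m) * of_bool (t = p) * IS (init_cov P) [Mss P K, Mss P K]"

definition El2 :: "nat \<Rightarrow> nat \<Rightarrow> real" where
  "El2 t p =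
     (\<Sum>i\<in>UNIV. (dinv l i)\<^sup>2 * IS (Sbar P l) [Qti t i, Qti p i, Mee P K, Mee P K])
     - IS (Sbar P l) [Wl t, Mee P K, Mee P K]
     - IS (Sbar P l) [Wl p, Mee P K, Mee P K]
     + real CARD('m) * IS (Sbar P l) [Mee P K, Mee P K]"

definition El3 :: "nat \<Rightarrow> nat \<Rightarrow> real" where
  "El3 t p = 2 * IS (init_cov P) [Mss P K] *
     ((\<Sum>i\<in>UNIV. (dinv l i)\<^sup>2 * IS (Sbar P l) [Qti t i, Qti p i, Mee P K])
      - IS (Sbar P l) [Wl t, Mee P K]
      - IS (Sbar P l) [Wl p, Mee P K]
      + real CARD('m) * IS (Sbar P l) [Mee P K])"

definition El4 :: "nat \<Rightarrow> nat \<Rightarrow> real" where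
  "El4 t p = 8 * real CARD('m) * of_bool (t = p) * IS (init_cov P) [V0]
     + 32 * (\<Sum>i\<in>UNIV. (dinv l i)\<^sup>2 * IS (init_cov P) [Vtpi t p i])"

end

end

theory Submission
  imports Defs
begin

text \<open>All expectations are of polynomials in a pair of independent Gaussian vectors, the initial
  state \<open>x\<close> and the lifted noise \<open>y\<close>. By polarization every polynomial is a
  combination of powers of linear functionals, so its Gaussian expectation depends only on the
  covariance and satisfies Stein's identity \<open>E[(v \<bullet> y) f(y)] = E[D f(y)(\<Omega> v)]\<close>.
  In both second moments the integrand is a weight in \<open>y\<close> times
  \<open>(x \<bullet> M\<^sub>s\<^sub>s x + 2 x \<bullet> M\<^sub>s\<^sub>e y + y \<bullet> M\<^sub>e\<^sub>e y)\<^sup>2\<close>; integrating first over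
  \<open>y\<close>, the terms odd in \<open>y\<close> vanish, and Stein's identity evaluates those
  containing \<open>(x \<bullet> M\<^sub>s\<^sub>e y)\<^sup>2\<close> or
  \<open>(x \<bullet> M\<^sub>s\<^sub>e y)(x \<bullet> J y)\<close>.
  For the gradients, telescoping \<open>\<gamma>\<^sup>t (\<Lambda>\<^sub>t - Q\<^sub>s/\<gamma>) \<bullet> P\<^sub>t\<close> along the state
  covariances of another gain \<open>K'\<close>, with the cost-to-go matrices of \<open>K\<close>, writes the
  cost of \<open>K'\<close> as a constant plus \<open>\<Sum> \<gamma>\<^sup>t D\<^sub>t(K') \<bullet> P\<^sub>t(K')\<close> with
  \<open>D\<^sub>t(K) = 0\<close>; hence the derivative of \<open>P\<^sub>t\<close> does not enter, and for \<open>K' = K\<close>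
  the cost is affine in the noise covariance.\<close>


section \<open>Gaussian moments\<close>

text \<open>\<open>gaussian\<close> prescribes only one-dimensional marginals, and
  \<open>init_cov P\<close> may be singular, so there is no density against which to integrate by
  parts. What is available are the moments of u \<bullet> x as functions of the variance
  \<open>quad_form \<Omega> u\<close>. This is why powers of linear functionals are the basic
  objects: Stein's identity for a power is the coefficient of t in a moment of (u + t v) \<bullet>
  x, and linearity does the rest. The same reduction gives uniqueness for polynomial integrands,
  which ties the arbitrarily chosen \<open>gaussian_law\<close> to the variables on
  \<open>M\<close>; that a Gaussian law exists at all is read off from \<open>noise_model\<close>.

  In the second moments closed formulas are required only up to degree six in y; products of four
  quadratic forms stay unevaluated as \<open>IS\<close> terms.\<close>

inductive power_sum :: "('a::real_inner \<Rightarrow> real) \<Rightarrow> bool" where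
  power: "power_sum (\<lambda>x. c * (u \<bullet> x) ^ k)"
| add: "power_sum f \<Longrightarrow> power_sum g \<Longrightarrow> power_sum (\<lambda>x. f x + g x)"

lemma power_sum_scale: "power_sum f \<Longrightarrow> power_sum (\<lambda>x. c * f x)"
proof (induction rule: power_sum.induct)
  case (power d u k)
  show ?case using power_sum.power[of "c * d" u k] by (simp add: mult.assoc)
next
  case (add f g)
  then show ?case using power_sum.add[OF add.IH] by (simp add: distrib_left)
qed

lemma power_sum_diff:
  assumes "power_sum f" "power_sum g"
  shows "power_sum (\<lambda>x. f x - g x)"
  using power_sum.add[OF assms(1) power_sum_scale[OF assms(2), of "-1"]] by simp

lemma power_sum_sum:
  "finite A \<Longrightarrow> (\<And>i. i \<in> A \<Longrightarrow> power_sum (f i)) \<Longrightarrow> power_sum (\<lambda>x. \<Sum>i\<in>A. f i x)"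
proof (induction A rule: finite_induct)
  case empty
  show ?case using power_sum.power[of 0 0 0] by simp
next
  case (insert a A)
  then show ?case by (auto intro: power_sum.add)
qed

text \<open>Interpolation in t without derivatives or determinants, because power sums are closed
  only under finite linear combinations: the values at t and 2 t eliminate the top coefficient,
  induction yields the lower ones, and the top one is what remains at t = 1.\<close>

lemma power_sum_coeff:
  assumes "\<And>t::real. power_sum (\<lambda>x. \<Sum>j\<le>n. t ^ j * a j x)" and "j \<le> n"
  shows "power_sum (a j)"
  using assms
proof (induction n arbitrary: a j)
  case 0
  then show ?case using "0.prems"(1)[of 1] by simp
next
  case (Suc n)
  define p where "p t x = (\<Sum>j\<le>Suc n. t ^ j * a j x)" for t :: real and x
  \<comment> \<open>\<open>2\<^bsup>n+1\<^esup> p(t) - p(2t)\<close> has degree at most \<open>n\<close>.\<close>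
  have p: "power_sum (p t)" for t
    using Suc.prems(1)[of t] by (simp add: p_def[abs_def])
  have low: "power_sum (a j)" if "j \<le> n" for j
  proof -
    have "power_sum (\<lambda>x. \<Sum>j\<le>n. t ^ j * ((2 ^ Suc n - 2 ^ j) * a j x))" for t :: real
    proof -
      have "(\<lambda>x. \<Sum>j\<le>n. t ^ j * ((2 ^ Suc n - 2 ^ j) * a j x)) = (\<lambda>x. 2 ^ Suc n * p t x - p (2 * t) x)"
      proof
        fix x
        have "2 ^ Suc n * p t x - p (2 * t) x = (\<Sum>j\<le>Suc n. t ^ j * ((2 ^ Suc n - 2 ^ j) * a j x))"
          unfolding p_def sum_distrib_left sum_subtractf[symmetric]
          by (intro sum.cong refl) (simp only: power_mult_distrib, simp only: algebra_simps)
        also have "\<dots> = (\<Sum>j\<le>n. t ^ j * ((2 ^ Suc n - 2 ^ j) * a j x))"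
          by simp
        finally show "(\<Sum>j\<le>n. t ^ j * ((2 ^ Suc n - 2 ^ j) * a j x)) = 2 ^ Suc n * p t x - p (2 * t) x"
          by simp
      qed
      then show ?thesis using power_sum_diff[OF power_sum_scale[OF p] p] by simp
    qed
    from Suc.IH[OF this that] have "power_sum (\<lambda>x. (2 ^ Suc n - 2 ^ j) * a j x)" .
    from power_sum_scale[OF this, of "inverse (2 ^ Suc n - 2 ^ j)"]
    have "power_sum (\<lambda>x. inverse (2 ^ Suc n - 2 ^ j) * ((2 ^ Suc n - 2 ^ j) * a j x))" .
    moreover have "(2::real) ^ j < 2 ^ Suc n"
      using that by (intro power_strict_increasing) auto
    ultimately show ?thesis by (simp add: mult.assoc[symmetric])
  qed
  show ?case
  proof (cases "j = Suc n")
    case True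
    have "a (Suc n) = (\<lambda>x. p 1 x - (\<Sum>j\<le>n. a j x))" by (auto simp: p_def)
    moreover have "power_sum (\<lambda>x. p 1 x - (\<Sum>j\<le>n. a j x))"
      by (intro power_sum_diff p power_sum_sum) (auto intro: low)
    ultimately show ?thesis using True by simp
  qed (use Suc.prems low in auto)
qed

lemma inner_power_expand:
  fixes u v x :: "'a::real_inner"
  shows "((u + t *\<^sub>R v) \<bullet> x) ^ n = (\<Sum>j\<le>n. t ^ j * (of_nat (n choose j) * (v \<bullet> x) ^ j * (u \<bullet> x) ^ (n - j)))"
proof -
  have "((u + t *\<^sub>R v) \<bullet> x) ^ n = (t * (v \<bullet> x) + u \<bullet> x) ^ n"
    by (simp add: inner_add_left add.commute)
  then show ?thesis
    by (simp add: binomial_ring power_mult_distrib mult_ac)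
qed

text \<open>Polarization: the linear coefficient of \<open>t \<mapsto> ((u + t v) \<bullet> x)\<^bsup>k+1\<^esup>\<close> is a multiple of
  \<open>(v \<bullet> x) (u \<bullet> x)\<^bsup>k\<^esup>\<close>.\<close>

lemma power_sum_inner_mult:
  "power_sum f \<Longrightarrow> power_sum (\<lambda>x. (v \<bullet> x) * f x)"
proof (induction rule: power_sum.induct)
  case (power c u k)
  have "power_sum (\<lambda>x. of_nat (Suc k choose 1) * (v \<bullet> x) ^ 1 * (u \<bullet> x) ^ (Suc k - 1))"
  proof (rule power_sum_coeff[where a = "\<lambda>j x. of_nat (Suc k choose j) * (v \<bullet> x) ^ j * (u \<bullet> x) ^ (Suc k - j)" and j = 1 and n = "Suc k"])
    fix t :: real
    show "power_sum (\<lambda>x. \<Sum>j\<le>Suc k. t ^ j * (of_nat (Suc k choose j) * (v \<bullet> x) ^ j * (u \<bullet> x) ^ (Suc k - j)))"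
      unfolding inner_power_expand[symmetric] using power_sum.power[of 1 "u + t *\<^sub>R v" "Suc k"] by simp
  qed simp
  \<comment> \<open>The scaling removes the binomial coefficient (k + 1 choose 1) = k + 1.\<close>
  from power_sum_scale[OF this, of "c / (real (Suc k))"]
  have "power_sum (\<lambda>x. c / real (Suc k) * (real (Suc k) * (v \<bullet> x) * (u \<bullet> x) ^ k))"
    by simp
  moreover have "c / real (Suc k) * (real (Suc k) * (v \<bullet> x) * (u \<bullet> x) ^ k) = (v \<bullet> x) * (c * (u \<bullet> x) ^ k)" for x
    using of_nat_0_less_iff[of "Suc k", where ?'a = real] by (simp only: field_simps) simp
  ultimately show ?case by (simp only:)
next
  case (add f g)
  then show ?case using power_sum.add[OF add.IH] by (simp add: distrib_left)
qed

lemma linear_eq_inner: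
  fixes f :: "'a::euclidean_space \<Rightarrow> real"
  assumes "linear f"
  obtains v where "\<And>x. f x = v \<bullet> x"
  using adjoint_works[OF assms, of _ "1::real"] by (metis inner_commute inner_real_def mult.right_neutral)

text \<open>The induction is on a stronger claim, that multiplication by f preserves power sums:
  then the product case is associativity, and polarization is used for one linear factor at a time.
  The claim itself is g = 1.\<close>

lemma real_polynomial_function_power_sum:
  fixes f :: "'a::euclidean_space \<Rightarrow> real"
  assumes "real_polynomial_function f"
  shows "power_sum f"
proof -
  have "power_sum g \<Longrightarrow> power_sum (\<lambda>x. f x * g x)" for g
    using assms
  proof (induction arbitrary: g rule: real_polynomial_function.induct)
    case (linear f)
    then obtain v where "\<And>x. f x = v \<bullet> x"
      using linear_eq_inner bounded_linear.linear by blast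
    then show ?case using power_sum_inner_mult[OF linear.prems] by simp
  next
    case (const c)
    then show ?case by (rule power_sum_scale)
  next
    case (add f1 f2)
    then show ?case using power_sum.add[OF add.IH] by (simp add: distrib_right)
  next
    case (mult f1 f2)
    then show ?case by (simp add: mult.assoc)
  qed
  from this[OF power_sum.power[of 1 0 0]] show ?thesis by simp
qed

text \<open>(k - 1)!! v^(k/2) for even k. As a function of the variance it is a polynomial, so it
  can be differentiated in v and includes the point mass v = 0.\<close>

definition normal_moment :: "real \<Rightarrow> nat \<Rightarrow> real" where
  "normal_moment v k =
     (if even k then fact k / (2 ^ (k div 2) * fact (k div 2)) * v ^ (k div 2) else 0)"

lemma centered_normal_moment:
  assumes "0 \<le> v"
  shows "has_bochner_integral (centered_normal v) (\<lambda>x. x ^ k) (normal_moment v k)"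
proof (cases "v = 0")
  case True
  interpret prob_space "return borel (0::real)" by (rule prob_space_return) simp
  have "has_bochner_integral (return borel (0::real)) (\<lambda>x. x ^ k) (0 ^ k)"
    by (subst has_bochner_integral_cong_AE[where g = "\<lambda>_. 0 ^ k"])
       (auto simp: AE_return has_bochner_integral_iff prob_space[simplified])
  \<comment> \<open>For k = 0 both sides are 1, the total mass.\<close>
  moreover have "normal_moment 0 k = 0 ^ k"
    by (cases "k = 0") (auto simp: normal_moment_def power_0_left elim!: evenE)
  ultimately show ?thesis using True by (simp add: centered_normal_def)
next
  case False
  with assms have v: "0 < v" by simp
  have "has_bochner_integral lborel (\<lambda>x. normal_density 0 (sqrt v) x * (x - 0) ^ k) (normal_moment v k)"
  proof (cases "even k")
    case True
    then obtain j where "k = 2 * j" by (elim evenE)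
    with v show ?thesis using normal_moment_even[of "sqrt v" 0 j]
      by (simp add: normal_moment_def power_divide field_simps)
  next
    case False
    then obtain j where "k = 2 * j + 1" by (elim oddE)
    with v show ?thesis using normal_moment_odd[of "sqrt v" 0 j]
      by (simp add: normal_moment_def)
  qed
  with False show ?thesis
    unfolding centered_normal_def
    by (subst if_not_P) (auto intro!: has_bochner_integral_density)
qed

section \<open>Gaussian vectors and Stein's identity\<close>

locale gaussian_vector = prob_space N
  for \<Omega> :: "real^'k^'k" and N :: "(real^'k) measure" +
  assumes psd: "pos_semidef \<Omega>" and gaussian: "gaussian \<Omega> N"
begin

lemma sets_eq [measurable_cong, simp]: "sets N = sets borel"
  using gaussian by (simp add: gaussian_def)

lemma space_eq [simp]: "space N = UNIV"
  using sets_eq_imp_space_eq[OF sets_eq] by simp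

lemma inner_power:
  "has_bochner_integral N (\<lambda>x. (u \<bullet> x) ^ k) (normal_moment (quad_form \<Omega> u) k)"
proof -
  have "distr N borel (\<lambda>x. u \<bullet> x) = centered_normal (quad_form \<Omega> u)"
    using gaussian by (simp add: gaussian_def)
  moreover have "0 \<le> quad_form \<Omega> u"
    using psd by (simp add: pos_semidef_def quad_form_def)
  ultimately have "has_bochner_integral (distr N borel (\<lambda>x. u \<bullet> x)) (\<lambda>x. x ^ k) (normal_moment (quad_form \<Omega> u) k)"
    using centered_normal_moment by simp
  then show ?thesis
    by (simp add: has_bochner_integral_iff integrable_distr_eq integral_distr)
qed

lemma integrable_polynomial:
  assumes "real_polynomial_function f"
  shows "integrable N f"
  using real_polynomial_function_power_sum[OF assms]
proof (induction rule: power_sum.induct)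
  case (power c u k)
  show ?case using inner_power[of u k] by (simp add: has_bochner_integral_iff)
qed simp

text \<open>Replacing x by -x replaces u by -u, which has the same variance. Integrability is
  carried through the induction because the sum case depends on it.\<close>

lemma expectation_uminus:
  assumes "real_polynomial_function f"
  shows "(\<integral>x. f (- x) \<partial>N) = (\<integral>x. f x \<partial>N)"
proof -
  have "integrable N f \<and> integrable N (\<lambda>x. f (- x)) \<and> (\<integral>x. f (- x) \<partial>N) = (\<integral>x. f x \<partial>N)"
    using real_polynomial_function_power_sum[OF assms]
  proof (induction rule: power_sum.induct)
    case (power c u k)
    have "(\<integral>x. (u \<bullet> x) ^ k \<partial>N) = normal_moment (quad_form \<Omega> u) k"
      "(\<integral>x. (- u \<bullet> x) ^ k \<partial>N) = normal_moment (quad_form \<Omega> (- u)) k"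
      "integrable N (\<lambda>x. (u \<bullet> x) ^ k)" "integrable N (\<lambda>x. (- u \<bullet> x) ^ k)"
      using inner_power[of u k] inner_power[of "- u" k] by (auto simp: has_bochner_integral_iff)
    moreover have "quad_form \<Omega> (- u) = quad_form \<Omega> u"
      by (simp add: quad_form_def linear_neg[OF matrix_vector_mul_linear])
    ultimately show ?case by simp
  qed simp
  then show ?thesis by simp
qed

lemma expectation_odd:
  assumes "real_polynomial_function f" and "\<And>x. f (- x) = - f x"
  shows "(\<integral>x. f x \<partial>N) = 0"
  using expectation_uminus[OF assms(1)] by (simp add: assms(2))

text \<open>The covariance of u \<bullet> x and v \<bullet> x is accessible only as the cross term
  of this expansion; symmetry of \<open>\<Omega>\<close> merges its two halves.\<close>

lemma quad_form_shift:
  "quad_form \<Omega> (u + t *\<^sub>R v) = quad_form \<Omega> u + 2 * t * (u \<bullet> (\<Omega> *v v)) + t\<^sup>2 * quad_form \<Omega> v"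
proof -
  have "v \<bullet> (\<Omega> *v u) = u \<bullet> (\<Omega> *v v)"
    using psd by (metis dot_lmul_matrix inner_commute pos_semidef_def transpose_matrix_vector)
  then show ?thesis
    by (simp add: quad_form_def matrix_vector_right_distrib inner_add_left inner_add_right
        matrix_vector_mult_scaleR power2_eq_square algebra_simps)
qed

text \<open>The moment of order n + 1 of (u + t v) \<bullet> x is computed in two ways: by the
  binomial expansion, and as a normal moment whose variance is quadratic in t. Comparing the
  derivatives at t = 0 gives the identity. For n = 0 the truncated exponent n - 1 is harmless
  because of the factor n.\<close>

lemma stein_power:
  "(\<integral>x. (v \<bullet> x) * (u \<bullet> x) ^ n \<partial>N) = real n * (u \<bullet> (\<Omega> *v v)) * (\<integral>x. (u \<bullet> x) ^ (n - 1) \<partial>N)"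
proof -
  let ?m = "\<lambda>j. \<integral>x. (v \<bullet> x) ^ j * (u \<bullet> x) ^ (Suc n - j) \<partial>N"
  let ?b = "u \<bullet> (\<Omega> *v v)" and ?q = "quad_form \<Omega> u"
  have int: "integrable N (\<lambda>x. (v \<bullet> x) ^ j * (u \<bullet> x) ^ i)" for i j
    by (intro integrable_polynomial real_polynomial_function.intros(4) real_polynomial_function_power
        real_polynomial_function.intros(1) bounded_linear_inner_right)
  have lhs: "(\<integral>x. ((u + t *\<^sub>R v) \<bullet> x) ^ Suc n \<partial>N) = (\<Sum>j\<le>Suc n. t ^ j * (real (Suc n choose j) * ?m j))" for t
    unfolding inner_power_expand using int
    by (subst Bochner_Integration.integral_sum) (auto simp: mult.assoc)
  have rhs: "(\<integral>x. ((u + t *\<^sub>R v) \<bullet> x) ^ Suc n \<partial>N) = normal_moment (?q + 2 * t * ?b + t\<^sup>2 * quad_form \<Omega> v) (Suc n)" for t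
    using inner_power[of "u + t *\<^sub>R v" "Suc n"] by (simp only: has_bochner_integral_iff quad_form_shift)
  have eq: "(\<lambda>t. \<Sum>j\<le>Suc n. t ^ j * (real (Suc n choose j) * ?m j)) =
      (\<lambda>t. normal_moment (?q + 2 * t * ?b + t\<^sup>2 * quad_form \<Omega> v) (Suc n))"
    using lhs rhs by (intro ext) (simp only:)
  have "((\<lambda>t. \<Sum>j\<le>Suc n. t ^ j * (real (Suc n choose j) * ?m j)) has_real_derivative
      (\<Sum>j\<le>Suc n. real j * 0 ^ (j - 1) * (real (Suc n choose j) * ?m j))) (at 0)"
    by (auto intro!: derivative_eq_intros simp del: sum.atMost_Suc)
  \<comment> \<open>At t = 0 only j = 1 survives: j = 0 is killed by the factor j, and larger j by
    the power of 0.\<close>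
  moreover have "(\<Sum>j\<le>Suc n. real j * 0 ^ (j - 1) * (real (Suc n choose j) * ?m j)) = real (Suc n) * ?m 1"
  proof -
    have "(\<Sum>j\<le>Suc n. real j * 0 ^ (j - 1) * (real (Suc n choose j) * ?m j)) =
        (\<Sum>j\<in>{1}. real j * 0 ^ (j - 1) * (real (Suc n choose j) * ?m j))"
      by (intro sum.mono_neutral_right) (auto simp: zero_power)
    then show ?thesis by simp
  qed
  ultimately have D1: "((\<lambda>t. \<Sum>j\<le>Suc n. t ^ j * (real (Suc n choose j) * ?m j)) has_real_derivative
      real (Suc n) * ?m 1) (at 0)"
    by simp
  have mom: "(\<integral>x. (u \<bullet> x) ^ (n - 1) \<partial>N) = normal_moment ?q (n - 1)"
    using inner_power[of u "n - 1"] by (simp add: has_bochner_integral_iff)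
  have m1: "?m 1 = (\<integral>x. (v \<bullet> x) * (u \<bullet> x) ^ n \<partial>N)" by simp
  show ?thesis
  proof (cases "odd n")
    case True
    then obtain k where k: "n = 2 * k + 1" by (elim oddE)
    have even_moment: "normal_moment x (Suc n) = fact (Suc n) / (2 ^ Suc k * fact (Suc k)) * x ^ Suc k" for x
      by (simp add: normal_moment_def k)
    \<comment> \<open>The variance has derivative 2 b at t = 0; its quadratic term does not
      contribute.\<close>
    have "((\<lambda>t. normal_moment (?q + 2 * t * ?b + t\<^sup>2 * quad_form \<Omega> v) (Suc n)) has_real_derivative
        fact (Suc n) / (2 ^ Suc k * fact (Suc k)) * (real (Suc k) * ?q ^ k * (2 * ?b))) (at 0)"
      unfolding even_moment by (auto intro!: derivative_eq_intros simp del: fact_Suc power_Suc)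
    from DERIV_unique[OF D1[unfolded eq] this]
    have "real (Suc n) * ?m 1 = fact (Suc n) / (2 ^ Suc k * fact (Suc k)) * (real (Suc k) * ?q ^ k * (2 * ?b))" .
    also have "\<dots> = real (Suc n) * (real n * ?b * normal_moment ?q (n - 1))"
    proof -
      have "fact (Suc n) = real (Suc n) * (real n * fact (2 * k))" by (simp add: k)
      \<comment> \<open>The cancellation is stated for arbitrary reals, with s, g, p in the places
        of k + 1, k! and 2^k, so that field arithmetic does not unfold factorials and
        powers.\<close>
      moreover have "S * (m * f) / (2 * p * (s * g)) * (s * r * (2 * b)) = S * (m * b * (f / (p * g) * r))"
        if "s \<noteq> 0" "g \<noteq> 0" "p \<noteq> 0" for S m f p s g r b :: real
        using that by (simp add: field_simps)
      from this[of "real (Suc k)" "fact k" "2 ^ k"] have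
        "S * (m * f) / (2 ^ Suc k * fact (Suc k)) * (real (Suc k) * r * (2 * b)) = S * (m * b * (f / (2 ^ k * fact k) * r))"
        for S m f r b :: real
        by simp
      ultimately show ?thesis by (simp add: normal_moment_def k del: of_nat_Suc fact_Suc power_Suc)
    qed
    finally show ?thesis using mom m1 by (simp del: of_nat_Suc)
  next
    case False
    have "normal_moment x (Suc n) = 0" for x using False by (simp add: normal_moment_def)
    then have "((\<lambda>t. normal_moment (?q + 2 * t * ?b + t\<^sup>2 * quad_form \<Omega> v) (Suc n)) has_real_derivative 0) (at 0)"
      by simp
    from DERIV_unique[OF D1[unfolded eq] this] have "?m 1 = 0" by simp
    \<comment> \<open>For even n the right-hand side vanishes too: either through the factor n or as
      a moment of odd order n - 1.\<close>
    moreover have "n = 0 \<or> normal_moment ?q (n - 1) = 0" using False by (auto simp: normal_moment_def)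
    ultimately show ?thesis using mom m1 by auto
  qed
qed

text \<open>Linear extension of \<open>stein_power\<close>. A polynomial may be a power sum in many
  ways, so the induction produces some derivative along with the identity, and uniqueness of
  derivatives identifies it with D.\<close>

lemma stein:
  assumes "real_polynomial_function f" and "\<And>x. (f has_derivative D x) (at x)"
  shows "(\<integral>x. (v \<bullet> x) * f x \<partial>N) = (\<integral>x. D x (\<Omega> *v v) \<partial>N)"
proof -
  have "\<exists>D. (\<forall>x. (f has_derivative D x) (at x)) \<and> integrable N (\<lambda>x. D x (\<Omega> *v v))
      \<and> integrable N (\<lambda>x. (v \<bullet> x) * f x)
      \<and> (\<integral>x. (v \<bullet> x) * f x \<partial>N) = (\<integral>x. D x (\<Omega> *v v) \<partial>N)"
    using real_polynomial_function_power_sum[OF assms(1)]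
  proof (induction rule: power_sum.induct)
    case (power c u k)
    have int: "integrable N (\<lambda>x. (u \<bullet> x) ^ k)" for k
      using inner_power[of u] by (simp add: has_bochner_integral_iff)
    have int': "integrable N (\<lambda>x. (v \<bullet> x) * (u \<bullet> x) ^ k)"
      by (intro integrable_polynomial real_polynomial_function.intros(4) real_polynomial_function_power
        real_polynomial_function.intros(1) bounded_linear_inner_right)
    show ?case
    proof (intro exI conjI allI)
      show "((\<lambda>x. c * (u \<bullet> x) ^ k) has_derivative (\<lambda>h. c * (real k * (u \<bullet> h) * (u \<bullet> x) ^ (k - 1)))) (at x)" for x
        by (auto intro!: derivative_eq_intros)
      show "integrable N (\<lambda>x. c * (real k * (u \<bullet> (\<Omega> *v v)) * (u \<bullet> x) ^ (k - 1)))"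
        using int by simp
      show "integrable N (\<lambda>x. (v \<bullet> x) * (c * (u \<bullet> x) ^ k))"
        using integrable_mult_right[OF int', of c] by (simp add: mult_ac)
      have "(\<integral>x. (v \<bullet> x) * (c * (u \<bullet> x) ^ k) \<partial>N) = (\<integral>x. c * ((v \<bullet> x) * (u \<bullet> x) ^ k) \<partial>N)"
        by (simp add: mult_ac)
      also have "\<dots> = c * (real k * (u \<bullet> (\<Omega> *v v)) * (\<integral>x. (u \<bullet> x) ^ (k - 1) \<partial>N))"
        by (simp add: stein_power)
      finally show "(\<integral>x. (v \<bullet> x) * (c * (u \<bullet> x) ^ k) \<partial>N) =
          (\<integral>x. c * (real k * (u \<bullet> (\<Omega> *v v)) * (u \<bullet> x) ^ (k - 1)) \<partial>N)"
        by simp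
    qed
  next
    case (add f g)
    then obtain D E where D: "\<And>x. (f has_derivative D x) (at x)" "integrable N (\<lambda>x. D x (\<Omega> *v v))"
      "integrable N (\<lambda>x. (v \<bullet> x) * f x)" "(\<integral>x. (v \<bullet> x) * f x \<partial>N) = (\<integral>x. D x (\<Omega> *v v) \<partial>N)"
      and E: "\<And>x. (g has_derivative E x) (at x)" "integrable N (\<lambda>x. E x (\<Omega> *v v))"
      "integrable N (\<lambda>x. (v \<bullet> x) * g x)" "(\<integral>x. (v \<bullet> x) * g x \<partial>N) = (\<integral>x. E x (\<Omega> *v v) \<partial>N)"
      by blast
    then show ?case
      by (intro exI[of _ "\<lambda>x h. D x h + E x h"]) (auto simp: distrib_left intro: has_derivative_add)
  qed
  then obtain E where E: "\<And>x. (f has_derivative E x) (at x)"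
    "(\<integral>x. (v \<bullet> x) * f x \<partial>N) = (\<integral>x. E x (\<Omega> *v v) \<partial>N)" by blast
  have "E = D" using has_derivative_unique[OF E(1) assms(2)] by blast
  with E(2) show ?thesis by simp
qed

end

text \<open>Both expectations of a power are the same one-dimensional moment. This allows the actual
  laws on the sample space to be exchanged for \<open>gaussian_law\<close>.\<close>

lemma gaussian_expectation_unique:
  assumes "gaussian_vector \<Omega> N" "gaussian_vector \<Omega> N'" "real_polynomial_function f"
  shows "(\<integral>x. f x \<partial>N) = (\<integral>x. f x \<partial>N')"
proof -
  interpret N: gaussian_vector \<Omega> N by fact
  interpret N': gaussian_vector \<Omega> N' by fact
  have "integrable N f \<and> integrable N' f \<and> (\<integral>x. f x \<partial>N) = (\<integral>x. f x \<partial>N')"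
    using real_polynomial_function_power_sum[OF assms(3)]
  proof (induction rule: power_sum.induct)
    case (power c u k)
    show ?case
      using N.inner_power[of u k] N'.inner_power[of u k] by (simp add: has_bochner_integral_iff)
  qed simp
  then show ?thesis by simp
qed


section \<open>Polynomial integrands and quadratic forms\<close>

lemma real_polynomial_function_inner:
  fixes f g :: "'a::real_normed_vector \<Rightarrow> 'b::euclidean_space"
  assumes "bounded_linear f" "bounded_linear g"
  shows "real_polynomial_function (\<lambda>x. f x \<bullet> g x)"
proof -
  have "real_polynomial_function (\<lambda>x. \<Sum>b\<in>Basis. (f x \<bullet> b) * (g x \<bullet> b))"
    by (intro real_polynomial_function_sum finite_Basis real_polynomial_function.intros(4)
        real_polynomial_function.intros(1) bounded_linear_inner_left_comp assms)
  then show ?thesis by (simp add: euclidean_inner[symmetric])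
qed

lemma real_polynomial_function_quad_form:
  assumes "bounded_linear f"
  shows "real_polynomial_function (\<lambda>x. quad_form A (f x))"
  unfolding quad_form_def
  by (intro real_polynomial_function_inner assms
      bounded_linear_compose[OF matrix_vector_mul_bounded_linear])

lemmas polynomial_intros =
  real_polynomial_function.intros(2,3,4) real_polynomial_function_diff real_polynomial_function_power
  real_polynomial_function_minus
  real_polynomial_function_sum real_polynomial_function_inner real_polynomial_function_quad_form
  bounded_linear_ident bounded_linear_compose[OF matrix_vector_mul_bounded_linear]
  real_polynomial_function.intros(1)[OF bounded_linear_inner_right]
  real_polynomial_function.intros(1)[OF bounded_linear_inner_left]

lemma inner_matrix_vector_swap:
  fixes A :: "real^'a^'b"
  shows "(A *v x) \<bullet> y = x \<bullet> (transpose A *v y)"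
  by (metis dot_lmul_matrix inner_commute transpose_matrix_vector)

lemma symmetric_swap:
  fixes A :: "real^'a^'a"
  assumes "transpose A = A"
  shows "x \<bullet> (A *v y) = (A *v x) \<bullet> y"
  by (simp only: inner_matrix_vector_swap assms)

lemma trace_eq_sum_axis:
  fixes A :: "real^'k^'k"
  shows "trace A = (\<Sum>i\<in>UNIV. axis i 1 \<bullet> (A *v axis i 1))"
  by (simp add: trace_def inner_axis' matrix_vector_mult_basis column_def)

text \<open>Splits off a linear factor to which Stein's identity applies; the sum over i later
  assembles into a trace.\<close>

lemma quad_form_eq_sum_axis:
  fixes A :: "real^'k^'k"
  assumes "transpose A = A"
  shows "quad_form A x = (\<Sum>i\<in>UNIV. (axis i 1 \<bullet> x) * ((A *v axis i 1) \<bullet> x))"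
proof -
  have "(A *v axis i 1) \<bullet> x = (A *v x) $ i" for i
    by (simp add: inner_matrix_vector_swap assms inner_axis')
  then show ?thesis
    by (simp only: inner_axis' mult_1) (simp add: quad_form_def inner_vec_def)
qed

lemma has_derivative_quad_form:
  fixes A :: "real^'k^'k"
  assumes "transpose A = A"
  shows "(quad_form A has_derivative (\<lambda>h. 2 * ((A *v x) \<bullet> h))) (at x)"
proof -
  have "((\<lambda>x. x \<bullet> (A *v x)) has_derivative (\<lambda>h. x \<bullet> (A *v h) + h \<bullet> (A *v x))) (at x)"
    by (intro has_derivative_inner has_derivative_ident
        bounded_linear.has_derivative[OF matrix_vector_mul_bounded_linear])
  moreover have "x \<bullet> (A *v h) + h \<bullet> (A *v x) = 2 * ((A *v x) \<bullet> h)" for h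
    using inner_matrix_vector_swap[of A x h] by (simp add: assms inner_commute)
  ultimately show ?thesis by (simp add: quad_form_def[abs_def])
qed

section \<open>Isserlis formulas with two linear factors and up to two quadratic forms\<close>

context gaussian_vector
begin

lemma cov_swap: "(\<Omega> *v x) \<bullet> y = x \<bullet> (\<Omega> *v y)"
  using psd by (simp add: inner_matrix_vector_swap pos_semidef_def)

lemma expectation_inner2:
  "(\<integral>x. (v \<bullet> x) * (z \<bullet> x) \<partial>N) = v \<bullet> (\<Omega> *v z)"
proof -
  have "(\<integral>x. (v \<bullet> x) * (z \<bullet> x) \<partial>N) = (\<integral>x. z \<bullet> (\<Omega> *v v) \<partial>N)"
    by (rule stein) (auto intro!: polynomial_intros derivative_eq_intros)
  also have "\<dots> = v \<bullet> (\<Omega> *v z)"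
    using cov_swap[of v z] by (simp add: prob_space[simplified] inner_commute)
  finally show ?thesis .
qed

lemma expectation_quad_form:
  assumes "transpose A = A"
  shows "(\<integral>x. quad_form A x \<partial>N) = trace (\<Omega> ** A)"
proof -
  have "(\<integral>x. quad_form A x \<partial>N) = (\<Sum>i\<in>UNIV. \<integral>x. (axis i 1 \<bullet> x) * ((A *v axis i 1) \<bullet> x) \<partial>N)"
    unfolding quad_form_eq_sum_axis[OF assms]
    by (rule Bochner_Integration.integral_sum) (intro integrable_polynomial polynomial_intros)
  also have "\<dots> = trace (\<Omega> ** A)"
    by (simp add: expectation_inner2 trace_eq_sum_axis matrix_vector_mul_assoc[symmetric])
  finally show ?thesis .
qed

text \<open>Stein's identity in v: the derivative hits either the other linear factor, leaving one
  quadratic form, or the quadratic form, leaving two linear factors.\<close>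

lemma expectation_inner2_quad:
  assumes "transpose A = A"
  shows "(\<integral>x. (v \<bullet> x) * ((z \<bullet> x) * quad_form A x) \<partial>N) =
    trace (\<Omega> ** A) * (v \<bullet> (\<Omega> *v z)) + 2 * (v \<bullet> (\<Omega> *v (A *v (\<Omega> *v z))))"
proof -
  have "(\<integral>x. (v \<bullet> x) * ((z \<bullet> x) * quad_form A x) \<partial>N) =
      (\<integral>x. (z \<bullet> x) * (2 * ((A *v x) \<bullet> (\<Omega> *v v))) + (z \<bullet> (\<Omega> *v v)) * quad_form A x \<partial>N)"
  proof (rule stein)
    show "real_polynomial_function (\<lambda>x. (z \<bullet> x) * quad_form A x)" by (intro polynomial_intros)
    show "((\<lambda>x. (z \<bullet> x) * quad_form A x) has_derivative
        (\<lambda>h. (z \<bullet> x) * (2 * ((A *v x) \<bullet> h)) + (z \<bullet> h) * quad_form A x)) (at x)" for x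
      by (rule has_derivative_mult)
        (auto intro!: has_derivative_quad_form assms derivative_eq_intros)
  qed
  also have "\<dots> = (\<integral>x. 2 * ((z \<bullet> x) * ((A *v (\<Omega> *v v)) \<bullet> x)) + (z \<bullet> (\<Omega> *v v)) * quad_form A x \<partial>N)"
    by (simp add: inner_matrix_vector_swap[of A _ "\<Omega> *v v"] assms inner_commute mult_ac)
  also have "\<dots> = 2 * (z \<bullet> (\<Omega> *v (A *v (\<Omega> *v v)))) + (z \<bullet> (\<Omega> *v v)) * trace (\<Omega> ** A)"
    by (subst Bochner_Integration.integral_add)
      (auto intro!: integrable_polynomial polynomial_intros simp: expectation_inner2 expectation_quad_form assms)
  \<comment> \<open>Stein's identity produces the chain read from z to v; symmetry of
    \<open>\<Omega>\<close> and A reverses it.\<close>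
  also have "z \<bullet> (\<Omega> *v (A *v (\<Omega> *v v))) = v \<bullet> (\<Omega> *v (A *v (\<Omega> *v z)))"
    by (rule trans[OF _ inner_commute]) (simp only: cov_swap[symmetric] symmetric_swap[OF assms])
  also have "z \<bullet> (\<Omega> *v v) = v \<bullet> (\<Omega> *v z)"
    by (rule trans[OF _ inner_commute]) (simp only: cov_swap[symmetric])
  finally show ?thesis by simp
qed

text \<open>\<open>expectation_inner2_quad\<close> for v = e_i and z = A e_i, summed over i; the
  chains become traces, put into the desired order by cyclicity.\<close>

lemma expectation_quad_form2:
  assumes A: "transpose A = A" and B: "transpose B = B"
  shows "(\<integral>x. quad_form A x * quad_form B x \<partial>N) =
    trace (\<Omega> ** A) * trace (\<Omega> ** B) + 2 * trace (\<Omega> ** A ** \<Omega> ** B)"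
proof -
  have "(\<integral>x. quad_form A x * quad_form B x \<partial>N) =
      (\<integral>x. (\<Sum>i\<in>UNIV. (axis i 1 \<bullet> x) * (((A *v axis i 1) \<bullet> x) * quad_form B x)) \<partial>N)"
    by (simp add: quad_form_eq_sum_axis[OF A] sum_distrib_right mult.assoc)
  also have "\<dots> = (\<Sum>i\<in>UNIV. \<integral>x. (axis i 1 \<bullet> x) * (((A *v axis i 1) \<bullet> x) * quad_form B x) \<partial>N)"
    by (rule Bochner_Integration.integral_sum) (intro integrable_polynomial polynomial_intros)
  also have "\<dots> = trace (\<Omega> ** B) * trace (\<Omega> ** A) + 2 * trace ((\<Omega> ** B) ** (\<Omega> ** A))"
    by (simp add: expectation_inner2_quad[OF B] trace_eq_sum_axis[of "\<Omega> ** A"]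
        trace_eq_sum_axis[of "(\<Omega> ** B) ** (\<Omega> ** A)"] sum.distrib sum_distrib_left
        matrix_vector_mul_assoc[symmetric])
  also have "trace ((\<Omega> ** B) ** (\<Omega> ** A)) = trace (\<Omega> ** A ** \<Omega> ** B)"
    by (subst trace_mul_sym) (simp add: matrix_mul_assoc)
  finally show ?thesis by simp
qed

text \<open>The derivative in Stein's identity hits each of the three remaining factors once, which
  leaves the formulas of degree four. The last two chains pass through A and B in opposite orders
  and are reversals of each other, so they agree for z = v; this is the origin of the 8 in front of
  \<open>Vhat\<close>.\<close>

lemma expectation_inner2_quad2:
  assumes A: "transpose A = A" and B: "transpose B = B"
  shows "(\<integral>x. (v \<bullet> x) * ((z \<bullet> x) * (quad_form A x * quad_form B x)) \<partial>N) =
    (trace (\<Omega> ** A) * trace (\<Omega> ** B) + 2 * trace (\<Omega> ** A ** \<Omega> ** B)) * (v \<bullet> (\<Omega> *v z))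
    + 2 * trace (\<Omega> ** B) * (v \<bullet> (\<Omega> *v (A *v (\<Omega> *v z))))
    + 2 * trace (\<Omega> ** A) * (v \<bullet> (\<Omega> *v (B *v (\<Omega> *v z))))
    + 4 * (v \<bullet> (\<Omega> *v (A *v (\<Omega> *v (B *v (\<Omega> *v z))))))
    + 4 * (v \<bullet> (\<Omega> *v (B *v (\<Omega> *v (A *v (\<Omega> *v z))))))"
proof -
  let ?w = "\<Omega> *v v"
  have "(\<integral>x. (v \<bullet> x) * ((z \<bullet> x) * (quad_form A x * quad_form B x)) \<partial>N) =
      (\<integral>x. (z \<bullet> x) * (quad_form A x * (2 * ((B *v x) \<bullet> ?w)) + (2 * ((A *v x) \<bullet> ?w)) * quad_form B x)
        + (z \<bullet> ?w) * (quad_form A x * quad_form B x) \<partial>N)"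
  proof (rule stein)
    show "real_polynomial_function (\<lambda>x. (z \<bullet> x) * (quad_form A x * quad_form B x))"
      by (intro polynomial_intros)
    show "((\<lambda>x. (z \<bullet> x) * (quad_form A x * quad_form B x)) has_derivative
        (\<lambda>h. (z \<bullet> x) * (quad_form A x * (2 * ((B *v x) \<bullet> h)) + (2 * ((A *v x) \<bullet> h)) * quad_form B x)
          + (z \<bullet> h) * (quad_form A x * quad_form B x))) (at x)" for x
      by (intro has_derivative_mult has_derivative_quad_form A B)
        (auto intro!: derivative_eq_intros)
  qed
  also have "\<dots> = (\<integral>x. 2 * ((z \<bullet> x) * (((B *v ?w) \<bullet> x) * quad_form A x))
        + 2 * ((z \<bullet> x) * (((A *v ?w) \<bullet> x) * quad_form B x))
        + (z \<bullet> ?w) * (quad_form A x * quad_form B x) \<partial>N)"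
    by (simp add: inner_matrix_vector_swap[of A _ ?w] inner_matrix_vector_swap[of B _ ?w] A B
        inner_commute algebra_simps)
  also have "\<dots> = 2 * (trace (\<Omega> ** A) * (z \<bullet> (\<Omega> *v (B *v ?w))) + 2 * (z \<bullet> (\<Omega> *v (A *v (\<Omega> *v (B *v ?w))))))
      + 2 * (trace (\<Omega> ** B) * (z \<bullet> (\<Omega> *v (A *v ?w))) + 2 * (z \<bullet> (\<Omega> *v (B *v (\<Omega> *v (A *v ?w))))))
      + (z \<bullet> ?w) * (trace (\<Omega> ** A) * trace (\<Omega> ** B) + 2 * trace (\<Omega> ** A ** \<Omega> ** B))"
  proof -
    have "integrable N (\<lambda>x. 2 * ((z \<bullet> x) * (((B *v ?w) \<bullet> x) * quad_form A x)))"
      "integrable N (\<lambda>x. 2 * ((z \<bullet> x) * (((A *v ?w) \<bullet> x) * quad_form B x)))"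
      "integrable N (\<lambda>x. (z \<bullet> ?w) * (quad_form A x * quad_form B x))"
      by (intro integrable_polynomial polynomial_intros)+
    then show ?thesis
      by (simp only: Bochner_Integration.integral_add Bochner_Integration.integrable_add
          integral_mult_right_zero expectation_inner2_quad[OF A]
          expectation_inner2_quad[OF B] expectation_quad_form2[OF A B])
  qed
  also have "z \<bullet> ?w = v \<bullet> (\<Omega> *v z)"
    by (rule trans[OF _ inner_commute]) (simp only: cov_swap[symmetric])
  also have "z \<bullet> (\<Omega> *v (A *v ?w)) = v \<bullet> (\<Omega> *v (A *v (\<Omega> *v z)))"
    by (rule trans[OF _ inner_commute]) (simp only: cov_swap[symmetric] symmetric_swap[OF A] symmetric_swap[OF B])
  also have "z \<bullet> (\<Omega> *v (B *v ?w)) = v \<bullet> (\<Omega> *v (B *v (\<Omega> *v z)))"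
    by (rule trans[OF _ inner_commute]) (simp only: cov_swap[symmetric] symmetric_swap[OF A] symmetric_swap[OF B])
  also have "z \<bullet> (\<Omega> *v (A *v (\<Omega> *v (B *v ?w)))) = v \<bullet> (\<Omega> *v (B *v (\<Omega> *v (A *v (\<Omega> *v z)))))"
    by (rule trans[OF _ inner_commute]) (simp only: cov_swap[symmetric] symmetric_swap[OF A] symmetric_swap[OF B])
  also have "z \<bullet> (\<Omega> *v (B *v (\<Omega> *v (A *v ?w)))) = v \<bullet> (\<Omega> *v (A *v (\<Omega> *v (B *v (\<Omega> *v z)))))"
    by (rule trans[OF _ inner_commute]) (simp only: cov_swap[symmetric] symmetric_swap[OF A] symmetric_swap[OF B])
  finally show ?thesis by (simp add: algebra_simps)
qed

end

section \<open>Expectations of polynomials in two independent Gaussian vectors\<close>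

text \<open>Independence factorizes only products f(X) g(Y), so polynomials in the pair are brought
  to this form.\<close>

inductive product_sum :: "('a::real_normed_vector \<times> 'b::real_normed_vector \<Rightarrow> real) \<Rightarrow> bool" where
  prod: "real_polynomial_function f \<Longrightarrow> real_polynomial_function g \<Longrightarrow>
    product_sum (\<lambda>z. f (fst z) * g (snd z))"
| add: "product_sum f \<Longrightarrow> product_sum g \<Longrightarrow> product_sum (\<lambda>z. f z + g z)"

lemma product_sum_mult:
  assumes "product_sum f" "product_sum g"
  shows "product_sum (\<lambda>z. f z * g z)"
  using assms
proof (induction arbitrary: g rule: product_sum.induct)
  case (prod f1 f2)
  from prod(3) show ?case
  proof (induction rule: product_sum.induct)
    case (prod g1 g2)
    have "product_sum (\<lambda>z. (f1 (fst z) * g1 (fst z)) * (f2 (snd z) * g2 (snd z)))"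
      using product_sum.prod[OF real_polynomial_function.intros(4)[of f1 g1]
          real_polynomial_function.intros(4)[of f2 g2]] prod \<open>real_polynomial_function f1\<close>
        \<open>real_polynomial_function f2\<close> by simp
    then show ?case by (simp add: mult_ac)
  next
    case (add g h)
    then show ?case using product_sum.add[OF add.IH] by (simp add: distrib_left)
  qed
next
  case (add f h)
  then show ?case using product_sum.add[OF add.IH] by (simp add: distrib_right)
qed

lemma real_polynomial_function_product_sum:
  assumes "real_polynomial_function h"
  shows "product_sum h"
  using assms
proof (induction rule: real_polynomial_function.induct)
  case (linear f)
  have lin: "bounded_linear f" by fact
  have "real_polynomial_function (\<lambda>x. f (x, 0))"
    by (rule real_polynomial_function.intros(1), rule bounded_linear_compose[OF lin],
        rule bounded_linear_Pair[OF bounded_linear_ident bounded_linear_zero])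
  moreover have "real_polynomial_function (\<lambda>y. f (0, y))"
    by (rule real_polynomial_function.intros(1), rule bounded_linear_compose[OF lin],
        rule bounded_linear_Pair[OF bounded_linear_zero bounded_linear_ident])
  ultimately have "product_sum (\<lambda>z. f (fst z, 0) * 1 + 1 * f (0, snd z))"
    by (intro product_sum.add[OF product_sum.prod[of "\<lambda>x. f (x, 0)" "\<lambda>_. 1"]
        product_sum.prod[of "\<lambda>_. 1" "\<lambda>y. f (0, y)"]] real_polynomial_function.intros(2))
  moreover have "(\<lambda>z. f (fst z, 0) * 1 + 1 * f (0, snd z)) = f"
  proof
    fix z
    have "f ((fst z, 0) + (0, snd z)) = f (fst z, 0) + f (0, snd z)"
      by (rule linear_add[OF bounded_linear.linear[OF lin]])
    then show "f (fst z, 0) * 1 + 1 * f (0, snd z) = f z" by simp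
  qed
  ultimately show ?case by (simp only:)
next
  case (const c)
  show ?case using product_sum.prod[of "\<lambda>_. c" "\<lambda>_. 1"] by (simp add: real_polynomial_function.intros(2))
next
  case (add f g)
  show ?case by (rule product_sum.add) (fact add.IH)+
next
  case (mult f g)
  show ?case by (rule product_sum_mult) (fact mult.IH)+
qed

lemma real_polynomial_function_measurable:
  assumes "real_polynomial_function f"
  shows "f \<in> borel_measurable borel"
  using assms by (intro borel_measurable_continuous_onI continuous_at_imp_continuous_on)
    (auto simp: real_polynomial_function_eq intro: continuous_polymonial_function)

text \<open>A function of X generates a smaller sigma-algebra, so it inherits the independence of
  X.\<close>

lemma vimage_sets_compose_subset:
  fixes f :: "'a::topological_space \<Rightarrow> 'b::topological_space"
  assumes "f \<in> borel_measurable borel"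
  shows "{(\<lambda>w. f (X w)) -` A \<inter> S |A. A \<in> sets borel} \<subseteq> {X -` A \<inter> S |A. A \<in> sets borel}"
proof clarify
  fix A :: "'b set"
  assume "A \<in> sets borel"
  then have "f -` A \<in> sets borel" by (rule measurable_sets_borel[OF assms])
  then show "\<exists>B. (\<lambda>w. f (X w)) -` A \<inter> S = X -` B \<inter> S \<and> B \<in> sets borel"
    by (intro exI[of _ "f -` A"]) auto
qed

text \<open>X and Y have different codomains, while f(X) and g(Y) are both real, so
  \<open>indep_var\<close> applies to them once their sigma-algebras are seen to be smaller. The
  integrability claims for the iterated integral are part of the induction because its sum case
  needs them.\<close>

lemma (in prob_space) expectation_polynomial_indep:
  fixes X :: "'a \<Rightarrow> real^'n" and Y :: "'a \<Rightarrow> real^'k"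
  assumes X_measurable [measurable]: "X \<in> borel_measurable M"
    and Y_measurable [measurable]: "Y \<in> borel_measurable M"
    and indep: "indep_set (sigma_sets (space M) {X -` A \<inter> space M | A. A \<in> sets borel})
      (sigma_sets (space M) {Y -` A \<inter> space M | A. A \<in> sets borel})"
    and X: "gaussian_vector \<Omega>1 (distr M borel X)" and Y: "gaussian_vector \<Omega>2 (distr M borel Y)"
    and N1: "gaussian_vector \<Omega>1 N1" and N2: "gaussian_vector \<Omega>2 N2"
    and h: "real_polynomial_function h"
  shows "integrable M (\<lambda>w. h (X w, Y w))"
    and "(\<integral>w. h (X w, Y w) \<partial>M) = (\<integral>x. \<integral>y. h (x, y) \<partial>N2 \<partial>N1)"
proof -
  interpret N1: gaussian_vector \<Omega>1 N1 by fact
  interpret N2: gaussian_vector \<Omega>2 N2 by fact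
  have "integrable M (\<lambda>w. h (X w, Y w)) \<and> (\<forall>x. integrable N2 (\<lambda>y. h (x, y)))
    \<and> integrable N1 (\<lambda>x. \<integral>y. h (x, y) \<partial>N2)
    \<and> (\<integral>w. h (X w, Y w) \<partial>M) = (\<integral>x. \<integral>y. h (x, y) \<partial>N2 \<partial>N1)"
    using real_polynomial_function_product_sum[OF h]
  proof (induction rule: product_sum.induct)
    case (prod f g)
    have fm [measurable]: "f \<in> borel_measurable borel" "g \<in> borel_measurable borel"
      using prod by (auto intro: real_polynomial_function_measurable)
    have ind: "indep_var borel (\<lambda>w. f (X w)) borel (\<lambda>w. g (Y w))"
      unfolding indep_var_eq
    proof (intro conjI indep_setI)
      fix a b
      assume a: "a \<in> sigma_sets (space M) {(\<lambda>w. f (X w)) -` A \<inter> space M |A. A \<in> sets borel}"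
        and b: "b \<in> sigma_sets (space M) {(\<lambda>w. g (Y w)) -` A \<inter> space M |A. A \<in> sets borel}"
      have "a \<in> sigma_sets (space M) {X -` A \<inter> space M |A. A \<in> sets borel}"
        by (rule subsetD[OF sigma_sets_mono'[OF vimage_sets_compose_subset[OF fm(1)]] a])
      moreover have "b \<in> sigma_sets (space M) {Y -` A \<inter> space M |A. A \<in> sets borel}"
        by (rule subsetD[OF sigma_sets_mono'[OF vimage_sets_compose_subset[OF fm(2)]] b])
      ultimately show "prob (a \<inter> b) = prob a * prob b" by (rule indep_setD[OF indep])
    next
      show "sigma_sets (space M) {(\<lambda>w. f (X w)) -` A \<inter> space M |A. A \<in> sets borel} \<subseteq> events"
        by (rule sets.sigma_sets_subset) auto
      show "sigma_sets (space M) {(\<lambda>w. g (Y w)) -` A \<inter> space M |A. A \<in> sets borel} \<subseteq> events"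
        by (rule sets.sigma_sets_subset) auto
    qed auto
    have iX: "integrable M (\<lambda>w. f (X w))"
      using gaussian_vector.integrable_polynomial[OF X prod(1)] by (simp add: integrable_distr_eq)
    have iY: "integrable M (\<lambda>w. g (Y w))"
      using gaussian_vector.integrable_polynomial[OF Y prod(2)] by (simp add: integrable_distr_eq)
    have "(\<integral>w. f (X w) \<partial>M) = (\<integral>x. f x \<partial>N1)" "(\<integral>w. g (Y w) \<partial>M) = (\<integral>y. g y \<partial>N2)"
      using gaussian_expectation_unique[OF X N1 prod(1)] gaussian_expectation_unique[OF Y N2 prod(2)]
      by (simp_all add: integral_distr)
    then have "(\<integral>w. f (X w) * g (Y w) \<partial>M) = (\<integral>x. f x \<partial>N1) * (\<integral>y. g y \<partial>N2)"
      using indep_var_lebesgue_integral[OF ind iX iY] by simp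
    then show ?case
      using indep_var_integrable[OF ind iX iY] N1.integrable_polynomial[OF prod(1)]
        N2.integrable_polynomial[OF prod(2)] by simp
  qed simp
  then show "integrable M (\<lambda>w. h (X w, Y w))"
    and "(\<integral>w. h (X w, Y w) \<partial>M) = (\<integral>x. \<integral>y. h (x, y) \<partial>N2 \<partial>N1)" by auto
qed


section \<open>Lifted vectors\<close>

lemma step_eq_iff [simp]: "step j = step k \<longleftrightarrow> j = (k :: 't::{finite,linorder})"
  using bij_betw_step[where 't = 't] by (auto simp: bij_betw_def inj_on_def)

lemma step_less [simp]: "step (k :: 't::{finite,linorder}) < CARD('t)"
  using bij_betw_step[where 't = 't] by (auto simp: bij_betw_def)

lemma step_cases:
  assumes "t < CARD('t)"
  obtains k :: "'t::{finite,linorder}" where "t = step k"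
proof -
  have "t \<in> range (step :: 't \<Rightarrow> nat)"
    using assms bij_betw_step[where 't = 't] by (simp add: bij_betw_def)
  then show thesis using that by auto
qed

lemma sum_step: "(\<Sum>t<CARD('t::{finite,linorder}). f t) = (\<Sum>k\<in>UNIV. f (step (k :: 't)))"
  by (rule sum.reindex_bij_betw[OF bij_betw_step, symmetric])

lemma sum_UNIV_prod: "(\<Sum>c\<in>UNIV. f c) = (\<Sum>j\<in>UNIV. \<Sum>s\<in>UNIV. f (j, s))"
  unfolding UNIV_Times_UNIV[symmetric] by (simp add: sum.cartesian_product)

lemma sum_delta_mult [simp]:
  fixes f :: "'a::finite \<Rightarrow> real"
  shows "(\<Sum>j\<in>UNIV. (if i = j then 1 else 0) * f j) = f i"
    "(\<Sum>j\<in>UNIV. (if j = i then 1 else 0) * f j) = f i"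
  by (simp_all add: if_distrib[of "\<lambda>c. c * _"] cong: if_cong)

lemma Pi_sel_mult_nth [simp]:
  fixes k :: "'t::{finite,linorder}" and y :: "real^('t \<times> 'm::finite)"
  shows "(Pi_sel (step k) *v y) $ r = y $ (k, r)"
proof -
  have "(Pi_sel (step k) *v y) $ r =
      (\<Sum>j\<in>UNIV. \<Sum>s\<in>UNIV. (if j = k \<and> s = r then 1 else 0) * y $ (j, s))"
    by (simp add: matrix_vector_mult_def Pi_sel_def sum_UNIV_prod)
  also have "\<dots> = (\<Sum>j\<in>UNIV. (if j = k then 1 else 0) * (\<Sum>s\<in>UNIV. (if s = r then 1 else 0) * y $ (j, s)))"
    unfolding sum_distrib_left by (intro sum.cong refl) simp
  finally show ?thesis by simp
qed

definition lifted_noise :: "(nat \<Rightarrow> real^'m) \<Rightarrow> real^('t::{finite,linorder} \<times> 'm)" where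
  "lifted_noise e = (\<chi> c. e (step (fst c)) $ snd c)"

lemma Pi_sel_lifted_noise:
  assumes "t < CARD('t::{finite,linorder})"
  shows "Pi_sel t *v (lifted_noise e :: real^('t \<times> 'm::finite)) = e t"
proof -
  obtain k :: 't where "t = step k" using step_cases assms by blast
  then show ?thesis by (simp add: vec_eq_iff lifted_noise_def)
qed

lemma inner_eq_sum_Pi_sel:
  fixes y z :: "real^('t::{finite,linorder} \<times> 'm::finite)"
  shows "y \<bullet> z = (\<Sum>t<CARD('t). (Pi_sel t *v y) \<bullet> (Pi_sel t *v z))"
  unfolding sum_step by (simp add: inner_vec_def sum_UNIV_prod)

text \<open>Block decomposition of the identity. It exhibits the lifted noise as a linear image of
  the individual noise vectors.\<close>

lemma eq_sum_Pi_sel: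
  fixes y :: "real^('t::{finite,linorder} \<times> 'm::finite)"
  shows "y = (\<Sum>t<CARD('t). transpose (Pi_sel t) *v (Pi_sel t *v y))"
proof -
  have "x \<bullet> y = x \<bullet> (\<Sum>t<CARD('t). transpose (Pi_sel t) *v (Pi_sel t *v y))" for x
    unfolding inner_sum_right by (subst inner_eq_sum_Pi_sel) (simp add: inner_matrix_vector_swap)
  then show ?thesis using vector_eq_ldot by blast
qed

lemma kron_mult_nth:
  fixes y :: "real^('a::finite \<times> 'c::finite)"
  shows "(kron X Y *v y) $ (i, r) = (\<Sum>j\<in>UNIV. X $ i $ j * (Y *v (\<chi> s. y $ (j, s))) $ r)"
  by (simp add: matrix_vector_mult_def kron_def sum_UNIV_prod sum_distrib_left mult.assoc)

lemma Pi_sel_Sbar_mult: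
  fixes P :: "('t::{finite,linorder}, 'n::finite, 'm::finite) lq"
  assumes "t < CARD('t)"
  shows "Pi_sel t *v (Sbar P l *v y) = noise_cov l *v (Pi_sel t *v y)"
proof -
  obtain k :: 't where k: "t = step k" using step_cases assms by blast
  have "Pi_sel t *v y = (\<chi> s. y $ (k, s))" by (simp add: vec_eq_iff k)
  then have eq: "noise_cov l *v (Pi_sel t *v y) = noise_cov l *v (\<chi> s. y $ (k, s))" by simp
  show ?thesis unfolding eq vec_eq_iff by (simp add: k Sbar_def kron_mult_nth mat_def)
qed

lemma quad_form_Sbar:
  fixes P :: "('t::{finite,linorder}, 'n::finite, 'm::finite) lq"
  shows "quad_form (Sbar P l) y = (\<Sum>t<CARD('t). quad_form (noise_cov l) (Pi_sel t *v y))"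
  unfolding quad_form_def by (subst inner_eq_sum_Pi_sel) (simp add: Pi_sel_Sbar_mult)

lemma noise_cov_mult_nth: "(noise_cov l *v v) $ i = (exp (l $ i))\<^sup>2 * v $ i"
  by (simp add: matrix_vector_mult_def noise_cov_def diag_mat_def if_distrib[of "\<lambda>c. c * _"]
      cong: if_cong)

lemma quad_form_noise_cov: "quad_form (noise_cov l) v = (\<Sum>i\<in>UNIV. (exp (l $ i) * v $ i)\<^sup>2)"
  by (simp add: quad_form_def inner_vec_def noise_cov_mult_nth power2_eq_square mult_ac)

lemma transpose_noise_cov: "transpose (noise_cov l) = noise_cov l"
  by (simp add: vec_eq_iff transpose_def noise_cov_def diag_mat_def)

lemma pos_semidef_noise_cov: "pos_semidef (noise_cov l)"
  unfolding pos_semidef_def quad_form_def[symmetric] quad_form_noise_cov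
  by (simp add: transpose_noise_cov sum_nonneg)

lemma quad_form_noise_cov_pos: "v \<noteq> 0 \<Longrightarrow> 0 < quad_form (noise_cov l) v"
  unfolding quad_form_noise_cov
  by (rule sum_pos2[where i = "SOME i. v $ i \<noteq> 0"])
    (auto simp: vec_eq_iff intro!: someI_ex[of "\<lambda>i. v $ i \<noteq> 0"])

lemma transpose_Sbar: "transpose (Sbar P l) = Sbar P l"
  by (auto simp: vec_eq_iff transpose_def Sbar_def kron_def mat_def noise_cov_def diag_mat_def)

lemma pos_semidef_Sbar: "pos_semidef (Sbar P l)"
  unfolding pos_semidef_def quad_form_def[symmetric] quad_form_Sbar
  using pos_semidef_noise_cov[of l]
  by (simp add: transpose_Sbar sum_nonneg pos_semidef_def quad_form_def)

section \<open>The joint law of the initial state and the lifted noise\<close>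

text \<open>Stability under intersections is what allows independent generators to be grouped into
  independent sigma-algebras.\<close>

lemma Int_stable_vimage: "Int_stable {X -` A \<inter> S |A. A \<in> sets N}"
proof (rule Int_stableI, clarify)
  fix A B assume "A \<in> sets N" "B \<in> sets N"
  then show "\<exists>C. (X -` A \<inter> S) \<inter> (X -` B \<inter> S) = X -` C \<inter> S \<and> C \<in> sets N"
    by (intro exI[of _ "A \<inter> B"]) auto
qed

lemma borel_measurable_matrix_vector_mult:
  fixes A :: "real^'a^'b"
  assumes "f \<in> borel_measurable M"
  shows "(\<lambda>x. A *v f x) \<in> borel_measurable M"
  by (rule measurable_compose[OF assms borel_measurable_continuous_onI])
    (intro linear_continuous_on matrix_vector_mul_bounded_linear)

text \<open>The lifted noise is a linear function of the vectors \<open>e t\<close>. Hence it is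
  measurable for the sigma-algebra they generate jointly, and its linear functionals are sums of
  independent centred normals whose variances add up to
  \<open>quad_form (Sbar P l) u\<close>.\<close>

lemma gaussian_lifted_noise:
  fixes P :: "('t::{finite,linorder}, 'n::finite, 'm::finite) lq"
  assumes model: "noise_model P l M s0 e"
  shows "(\<lambda>w. lifted_noise (\<lambda>k. e k w) :: real^('t \<times> 'm)) \<in> borel_measurable M"
    and "prob_space.indep_set M (sigma_sets (space M) {s0 -` A \<inter> space M | A. A \<in> sets borel})
      (sigma_sets (space M) {(\<lambda>w. lifted_noise (\<lambda>k. e k w) :: real^('t \<times> 'm)) -` A \<inter> space M | A. A \<in> sets borel})"
    and "gaussian (Sbar P l) (distr M borel (\<lambda>w. lifted_noise (\<lambda>k. e k w)))"
proof -
  interpret prob_space M using model by (simp add: noise_model_def)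
  let ?T = "CARD('t)"
  let ?y = "\<lambda>w. lifted_noise (\<lambda>k. e k w) :: real^('t \<times> 'm)"
  define E where "E k = (case k of 0 \<Rightarrow> {s0 -` X \<inter> space M | X. X \<in> sets borel}
                    | Suc t \<Rightarrow> {e t -` X \<inter> space M | X. X \<in> sets borel})" for k
  have em [measurable]: "t < ?T \<Longrightarrow> e t \<in> borel_measurable M" and s0m [measurable]: "s0 \<in> borel_measurable M" for t
    using model by (auto simp: noise_model_def)
  have indep: "indep_sets E {..?T}"
    using model unfolding noise_model_def E_def by blast
  have E_Suc: "E (Suc t) = {e t -` X \<inter> space M | X. X \<in> sets borel}" for t by (simp add: E_def)
  have y_sum: "?y w = (\<Sum>t<?T. transpose (Pi_sel t) *v e t w)" for w
    by (subst eq_sum_Pi_sel) (simp add: Pi_sel_lifted_noise)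
  show ym [measurable]: "?y \<in> borel_measurable M"
    unfolding y_sum by (intro borel_measurable_sum borel_measurable_matrix_vector_mult em) auto
  show "indep_set (sigma_sets (space M) {s0 -` A \<inter> space M | A. A \<in> sets borel})
      (sigma_sets (space M) {?y -` A \<inter> space M | A. A \<in> sets borel})"
  proof -
    \<comment> \<open>The indices are grouped into {0}, the initial state, and {1..T}, the
      noise.\<close>
    let ?I = "\<lambda>b. if b then {0} else {1..?T}"
    let ?S = "\<lambda>b. sigma_sets (space M) (\<Union>i\<in>?I b. E i)"
    have "(\<Union>b\<in>UNIV. ?I b) = {..?T}" by (auto simp: UNIV_bool)
    with indep have "indep_sets E (\<Union>b\<in>UNIV. ?I b)" by simp
    then have "indep_sets ?S UNIV"
    proof (rule indep_sets_collect_sigma)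
      show "Int_stable (E i)" for i
        by (cases i) (auto simp: E_def intro: Int_stable_vimage)
      show "disjoint_family_on ?I UNIV" by (auto simp: disjoint_family_on_def)
    qed
    moreover have "case_bool (sigma_sets (space M) {s0 -` A \<inter> space M | A. A \<in> sets borel})
      (sigma_sets (space M) {?y -` A \<inter> space M | A. A \<in> sets borel}) b \<subseteq> ?S b" for b
    proof (cases b)
      case True
      then show ?thesis by (simp add: E_def)
    next
      case False
      \<comment> \<open>The same sample space with only the events generated by the noise:
        measurability with respect to it is the required inclusion of sigma-algebras.\<close>
      let ?N = "sigma (space M) (\<Union>i\<in>{1..?T}. E i)"
      have sub: "(\<Union>i\<in>{1..?T}. E i) \<subseteq> Pow (space M)"
        by (auto simp: E_def split: nat.splits)
      have "e t \<in> borel_measurable ?N" if "t < ?T" for t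
      proof (rule measurableI)
        fix A :: "(real^'m) set" assume "A \<in> sets borel"
        then have "e t -` A \<inter> space M \<in> E (Suc t)" by (auto simp: E_Suc)
        then have "e t -` A \<inter> space M \<in> (\<Union>i\<in>{1..?T}. E i)" using that by (intro UN_I[of "Suc t"]) auto
        then show "e t -` A \<inter> space ?N \<in> sets ?N"
          by (simp only: space_measure_of[OF sub] sets_measure_of[OF sub]) (rule sigma_sets.Basic)
      qed simp
      then have "?y \<in> borel_measurable ?N"
        unfolding y_sum by (intro borel_measurable_sum borel_measurable_matrix_vector_mult) auto
      then have "?y -` A \<inter> space M \<in> sigma_sets (space M) (\<Union>i\<in>{1..?T}. E i)" if "A \<in> sets borel" for A
        using measurable_sets[of ?y ?N borel A] that
        by (simp only: space_measure_of[OF sub] sets_measure_of[OF sub])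
      then have "sigma_sets (space M) {?y -` A \<inter> space M | A. A \<in> sets borel} \<subseteq> sigma_sets (space M) (\<Union>i\<in>{1..?T}. E i)"
        by (intro sigma_sets_mono) auto
      with False show ?thesis by simp
    qed
    ultimately show ?thesis
      unfolding indep_set_def by (rule indep_sets_mono_sets)
  qed
  show "gaussian (Sbar P l) (distr M borel ?y)"
    unfolding gaussian_def
  proof (intro conjI allI)
    show "prob_space (distr M borel ?y)" by (rule prob_space_distr) measurable
    fix u :: "real^('t \<times> 'm)"
    define v where "v t = Pi_sel t *v u" for t
    define X where "X t w = v t \<bullet> e t w" for t w
    \<comment> \<open>Degenerate summands are dropped: the library's sum of independent normals needs positive variances.\<close>
    define I where "I = {t. t < ?T \<and> v t \<noteq> 0}"
    have finI: "finite I" by (simp add: I_def)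
    have "u \<bullet> ?y w = (\<Sum>t<?T. X t w)" for w
      by (subst inner_eq_sum_Pi_sel) (simp add: X_def v_def Pi_sel_lifted_noise)
    also have "(\<Sum>t<?T. X t w) = (\<Sum>t\<in>I. X t w)" for w
      by (rule sum.mono_neutral_right) (auto simp: I_def X_def)
    finally have uy: "u \<bullet> ?y w = (\<Sum>t\<in>I. X t w)" for w .
    have quad: "quad_form (Sbar P l) u = (\<Sum>t\<in>I. quad_form (noise_cov l) (v t))"
      unfolding quad_form_Sbar v_def[symmetric]
      by (rule sum.mono_neutral_right) (auto simp: I_def quad_form_def)
    have "distr (distr M borel ?y) borel ((\<bullet>) u) = distr M borel (\<lambda>w. \<Sum>t\<in>I. X t w)"
      by (subst distr_distr) (auto simp: comp_def uy)
    also have "\<dots> = centered_normal (quad_form (Sbar P l) u)"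
    proof (cases "I = {}")
      case True
      \<comment> \<open>All blocks of u vanish: the sum is constantly 0, and its law is the point
        mass that \<open>centered_normal\<close> assigns to variance 0.\<close>
      then show ?thesis by (simp add: quad centered_normal_def distr_const)
    next
      case False
      let ?\<sigma> = "\<lambda>t. sqrt (quad_form (noise_cov l) (v t))"
      have pos: "0 < quad_form (noise_cov l) (v t)" if "t \<in> I" for t
        using that by (auto simp: I_def intro: quad_form_noise_cov_pos)
      have Xm: "X t \<in> borel_measurable M" if "t \<in> I" for t
        using em[of t] that unfolding X_def I_def by simp
      have "indep_vars (\<lambda>_. borel) X I"
        unfolding indep_vars_def2
      proof (intro conjI ballI Xm indep_setsI)
        fix t assume "t \<in> I"
        then show "{X t -` A \<inter> space M |A. A \<in> sets borel} \<subseteq> events" using Xm by auto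
      next
        fix A J
        assume J: "J \<noteq> {}" "J \<subseteq> I" "finite J" and A: "\<forall>j\<in>J. A j \<in> {X j -` A \<inter> space M |A. A \<in> sets borel}"
        \<comment> \<open>Noise at time t has index \<open>Suc t\<close> in \<open>E\<close>, since
          index 0 belongs to the initial state.\<close>
        have "prob (\<Inter>j\<in>Suc ` J. A (j - 1)) = (\<Prod>j\<in>Suc ` J. prob (A (j - 1)))"
        proof (rule indep_setsD[OF indep])
          show "\<forall>j\<in>Suc ` J. A (j - 1) \<in> E j"
          proof
            fix j assume "j \<in> Suc ` J"
            then obtain t where t: "j = Suc t" "t \<in> J" by auto
            have "{X t -` A \<inter> space M |A. A \<in> sets borel} \<subseteq> E (Suc t)"
              unfolding X_def E_Suc by (rule vimage_sets_compose_subset) simp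
            with A t show "A (j - 1) \<in> E j" by auto
          qed
        qed (use J in \<open>auto simp: I_def\<close>)
        then show "prob (\<Inter>j\<in>J. A j) = (\<Prod>j\<in>J. prob (A j))"
          by (simp add: prod.reindex)
      qed auto
      moreover have "distributed M lborel (X t) (normal_density 0 (?\<sigma> t))" if "t \<in> I" for t
      proof -
        have "distr M borel (X t) = distr (distr M borel (e t)) borel ((\<bullet>) (v t))"
          using that by (subst distr_distr) (auto simp: I_def X_def[abs_def] comp_def)
        also have "\<dots> = centered_normal (quad_form (noise_cov l) (v t))"
          using model that by (auto simp: noise_model_def gaussian_def I_def)
        finally have "distr M lborel (X t) = density lborel (\<lambda>x. ennreal (normal_density 0 (?\<sigma> t) x))"
          using pos[OF that] by (simp add: centered_normal_def cong: distr_cong)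
        then show ?thesis using Xm[OF that] by (simp add: distributed_def)
      qed
      ultimately have "distributed M lborel (\<lambda>w. \<Sum>t\<in>I. X t w)
          (normal_density (\<Sum>t\<in>I. 0) (sqrt (\<Sum>t\<in>I. (?\<sigma> t)\<^sup>2)))"
        using pos by (intro sum_indep_normal finI False) auto
      then have "distr M lborel (\<lambda>w. \<Sum>t\<in>I. X t w) =
          density lborel (\<lambda>x. ennreal (normal_density 0 (sqrt (\<Sum>t\<in>I. (?\<sigma> t)\<^sup>2)) x))"
        by (simp add: distributed_def)
      moreover have "(\<Sum>t\<in>I. (?\<sigma> t)\<^sup>2) = quad_form (Sbar P l) u"
        unfolding quad using pos by (intro sum.cong refl) (simp add: less_imp_le)
      moreover have "quad_form (Sbar P l) u \<noteq> 0"
        unfolding quad using sum_pos[OF finI False, of "\<lambda>t. quad_form (noise_cov l) (v t)"] pos by simp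
      moreover have "distr M borel (\<lambda>w. \<Sum>t\<in>I. X t w) = distr M lborel (\<lambda>w. \<Sum>t\<in>I. X t w)"
        by (rule distr_cong) auto
      ultimately show ?thesis by (simp add: centered_normal_def)
    qed
    finally show "distr (distr M borel ?y) borel ((\<bullet>) u) = centered_normal (quad_form (Sbar P l) u)" .
  qed simp
qed

text \<open>The choice in \<open>gaussian_law\<close> is meaningful once some Gaussian measure for
  \<open>\<Omega>\<close> is at hand. Here N is the witness: the law of the initial state or of the
  lifted noise.\<close>

lemma gaussian_vector_law:
  assumes "pos_semidef \<Omega>" "gaussian \<Omega> N"
  shows "gaussian_vector \<Omega> N" "gaussian_vector \<Omega> (gaussian_law \<Omega>)"
proof -
  have "gaussian \<Omega> (gaussian_law \<Omega>)"
    unfolding gaussian_law_def by (rule someI, fact assms(2))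
  with assms show "gaussian_vector \<Omega> N" "gaussian_vector \<Omega> (gaussian_law \<Omega>)"
    by (auto simp: gaussian_vector_def gaussian_vector_axioms_def gaussian_def)
qed

lemma noise_model_gaussian_vector:
  fixes P :: "('t::{finite,linorder}, 'n::finite, 'm::finite) lq"
  assumes model: "noise_model P l M s0 e" and psd: "pos_semidef (init_cov P)"
  shows "gaussian_vector (init_cov P) (gaussian_law (init_cov P))"
    and "gaussian_vector (Sbar P l) (gaussian_law (Sbar P l))"
  using gaussian_vector_law[OF psd] gaussian_vector_law[OF pos_semidef_Sbar gaussian_lifted_noise(3)[OF model]]
    model by (auto simp: noise_model_def)

text \<open>Removes the sample space: expectations of polynomials become iterated Gaussian integrals
  determined by the two covariances.\<close>

lemma noise_model_expectation:
  fixes P :: "('t::{finite,linorder}, 'n::finite, 'm::finite) lq"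
  assumes model: "noise_model P l M s0 e" and psd: "pos_semidef (init_cov P)"
    and h: "real_polynomial_function h"
  shows "integrable M (\<lambda>w. h (s0 w, lifted_noise (\<lambda>k. e k w)))"
    and "(\<integral>w. h (s0 w, lifted_noise (\<lambda>k. e k w)) \<partial>M) =
      (\<integral>x. \<integral>y. h (x, y) \<partial>gaussian_law (Sbar P l) \<partial>gaussian_law (init_cov P))"
proof -
  interpret prob_space M using model by (simp add: noise_model_def)
  have s0: "s0 \<in> borel_measurable M" "gaussian (init_cov P) (distr M borel s0)"
    using model by (auto simp: noise_model_def)
  note y = gaussian_lifted_noise[OF model]
  note E = expectation_polynomial_indep[OF s0(1) y(1,2) gaussian_vector_law(1)[OF psd s0(2)]
    gaussian_vector_law(1)[OF pos_semidef_Sbar y(3)] noise_model_gaussian_vector[OF model psd] h]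
  show "integrable M (\<lambda>w. h (s0 w, lifted_noise (\<lambda>k. e k w)))"
    and "(\<integral>w. h (s0 w, lifted_noise (\<lambda>k. e k w)) \<partial>M) =
      (\<integral>x. \<integral>y. h (x, y) \<partial>gaussian_law (Sbar P l) \<partial>gaussian_law (init_cov P))"
    by (fact E)+
qed


section \<open>The lifted system\<close>

lemma quad_form_add: "quad_form (A + B) x = quad_form A x + quad_form B x"
  by (simp add: quad_form_def matrix_vector_mult_add_rdistrib inner_add_right)

lemma transpose_add: "transpose (A + B) = transpose A + transpose (B :: real^'a^'b)"
  by (simp add: vec_eq_iff transpose_def)

lemma transpose_symp: "transpose (symp X) = symp X"
  by (simp add: symp_def vec_eq_iff transpose_def add.commute)

lemma inner_transpose_mult: "x \<bullet> (y v* A) = (A *v x) \<bullet> y"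
  for A :: "real^'a^'b"
  using inner_matrix_vector_swap[of A x y] by simp

text \<open>Quadratic forms do not see antisymmetric parts. Hence all symmetrizations in the second
  moments are free, while Stein's identity for quadratic forms is available only for symmetric
  matrices.\<close>

lemma quad_form_symp: "quad_form (symp X) x = quad_form X x"
proof -
  have "x \<bullet> (transpose X *v x) = x \<bullet> (X *v x)"
    by (simp add: inner_transpose_mult inner_commute)
  then show ?thesis
    by (simp add: symp_def quad_form_def matrix_vector_mult_add_rdistrib inner_add_right
        scaleR_matrix_vector_assoc[symmetric])
qed

lemma transpose_kron_diag_mat:
  assumes "transpose Q = Q"
  shows "transpose (kron (diag_mat d) Q) = kron (diag_mat d) Q"
proof -
  have "Q $ i $ j = Q $ j $ i" for i j
    using assms by (metis transpose_def vec_lambda_beta)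
  then show ?thesis by (auto simp: vec_eq_iff transpose_def kron_def diag_mat_def)
qed

text \<open>The recursion s_{t+1} = F s_t + B \<epsilon>_t at the level of coefficients. Blocks
  before t gain a factor F, and block t has exponent 0, giving B; truncated subtraction never acts
  on a nonzero block.\<close>

lemma Et_Suc:
  fixes P :: "('t::{finite,linorder}, 'n::finite, 'm::finite) lq"
  shows "Et P K (Suc t) = Fcl P K ** Et P K t + dynB P ** Pi_sel t"
proof -
  have "Et P K (Suc t) $ r $ (k, i) = (Fcl P K ** Et P K t + dynB P ** Pi_sel t) $ r $ (k, i)" for r k i
  proof -
    have "(Fcl P K ** Et P K t) $ r $ (k, i) =
        (if step k + 1 \<le> t then (Fcl P K ** (matpow (Fcl P K) (t - 1 - step k) ** dynB P)) $ r $ i else 0)"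
      by (simp add: matrix_matrix_mult_def Et_def)
    moreover have "(dynB P ** Pi_sel t) $ r $ (k, i) = (if step k = t then dynB P $ r $ i else 0)"
      by (simp add: matrix_matrix_mult_def Pi_sel_def if_distrib[of "\<lambda>c. _ * c"] cong: if_cong)
    moreover have "matpow (Fcl P K) (t - step k) = Fcl P K ** matpow (Fcl P K) (t - 1 - step k)"
      if "step k + 1 \<le> t"
    proof -
      have "t - step k = Suc (t - 1 - step k)" using that by simp
      then show ?thesis by simp
    qed
    ultimately show ?thesis
      by (auto simp: Et_def matrix_mul_assoc)
  qed
  then show ?thesis by (simp add: vec_eq_iff)
qed

lemma state_eq:
  fixes P :: "('t::{finite,linorder}, 'n::finite, 'm::finite) lq"
  assumes "t \<le> CARD('t)"
  shows "state P K s e t = Ft P K t *v s + Et P K t *v lifted_noise e"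
  using assms
proof (induction t)
  case 0
  have "Et P K 0 = 0" by (simp add: Et_def vec_eq_iff)
  then show ?case by (simp add: Ft_def)
next
  case (Suc t)
  then have x: "state P K s e t = Ft P K t *v s + Et P K t *v lifted_noise e" by simp
  have "state P K s e (Suc t) = Fcl P K *v state P K s e t + dynB P *v e t"
    by (simp add: Fcl_def matrix_vector_mult_add_rdistrib matrix_vector_right_distrib
        matrix_vector_mul_assoc[symmetric])
  also have "e t = Pi_sel t *v (lifted_noise e :: real^('t \<times> 'm))"
    using Suc.prems by (simp add: Pi_sel_lifted_noise)
  finally show ?case
    by (simp add: x Et_Suc Ft_def matrix_vector_mult_add_rdistrib matrix_vector_right_distrib
        matrix_vector_mul_assoc[symmetric])
qed

lemma action_eq:
  fixes P :: "('t::{finite,linorder}, 'n::finite, 'm::finite) lq"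
  assumes "t < CARD('t)"
  shows "action P K s e t = (K ** Ft P K t) *v s + (K ** Et P K t + Pi_sel t) *v lifted_noise e"
  using assms
  by (simp add: action_def state_eq Pi_sel_lifted_noise matrix_vector_mult_add_rdistrib
      matrix_vector_right_distrib matrix_vector_mul_assoc[symmetric])

lemma quad_form_affine:
  fixes X :: "real^'a^'c" and Y :: "real^'b^'c"
  assumes "transpose Q = Q"
  shows "quad_form Q (X *v s + Y *v y) = quad_form (transpose X ** Q ** X) s
    + 2 * (s \<bullet> ((transpose X ** Q ** Y) *v y)) + quad_form (transpose Y ** Q ** Y) y"
proof -
  have "(Y *v y) \<bullet> (Q *v (X *v s)) = (X *v s) \<bullet> (Q *v (Y *v y))"
    by (rule trans[OF symmetric_swap[OF assms] inner_commute])
  then show ?thesis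
    by (simp add: quad_form_def matrix_vector_right_distrib inner_add_left inner_add_right
        matrix_vector_mul_assoc[symmetric] inner_transpose_mult)
qed

text \<open>A Kronecker product with a diagonal matrix is block diagonal, so the stacked form falls
  apart into one form per time. It serves states and actions alike.\<close>

lemma quad_form_kron_vstack:
  fixes X :: "nat \<Rightarrow> real^'a^'c" and Y :: "nat \<Rightarrow> real^'b^'c"
  shows "quad_form (kron (diag_mat (\<lambda>k :: 't::{finite,linorder}. g (step k))) Q) (vstack X *v s + vstack Y *v y)
    = (\<Sum>t<CARD('t). g t * quad_form Q (X t *v s + Y t *v y))"
proof -
  let ?z = "vstack X *v s + vstack Y *v y :: real^('t \<times> 'c)"
  have z: "(\<chi> r. ?z $ (k, r)) = X (step k) *v s + Y (step k) *v y" for k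
    by (simp add: vec_eq_iff matrix_vector_mult_def vstack_def)
  have "(kron (diag_mat (\<lambda>k :: 't. g (step k))) Q *v ?z) $ (k, r) =
      g (step k) * (Q *v (X (step k) *v s + Y (step k) *v y)) $ r" for k r
    unfolding kron_mult_nth z diag_mat_def
    by (simp add: if_distrib[of "\<lambda>c. c * _"] cong: if_cong)
  moreover have "?z $ (k, r) = (X (step k) *v s + Y (step k) *v y) $ r" for k r
    using z[of k] by (simp add: vec_eq_iff)
  ultimately show ?thesis
    unfolding sum_step quad_form_def
    by (simp add: inner_vec_def sum_UNIV_prod sum_distrib_left mult_ac del: vector_add_component)
qed

lemma total_return_eq:
  fixes P :: "('t::{finite,linorder}, 'n::finite, 'm::finite) lq"
  assumes "transpose (costS P) = costS P" "transpose (costA P) = costA P"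
  shows "total_return P K s e = - (quad_form (Mss P K) s + 2 * (s \<bullet> (Mse P K *v lifted_noise e))
    + quad_form (Mee P K) (lifted_noise e))"
proof -
  let ?y = "lifted_noise e :: real^('t \<times> 'm)"
  \<comment> \<open>Block k of \<open>FS\<close> and \<open>FE\<close> belongs to time k + 1,
    because the reward pairs s_{t+1} with a_t.\<close>
  have S: "quad_form (QSg P) (FS P K *v s + FE P K *v ?y) =
      (\<Sum>t<CARD('t). disc P ^ t * quad_form (costS P) (state P K s e (Suc t)))"
    unfolding QSg_def FS_def FE_def Dgamma_def quad_form_kron_vstack
    by (intro sum.cong refl) (simp add: state_eq del: state.simps)
  have A: "quad_form (QAg P) (KS P K *v s + KE P K *v ?y) =
      (\<Sum>t<CARD('t). disc P ^ t * quad_form (costA P) (action P K s e t))"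
    unfolding QAg_def KS_def KE_def Dgamma_def quad_form_kron_vstack
    by (intro sum.cong refl) (simp add: action_eq)
  have "total_return P K s e = - (quad_form (QSg P) (FS P K *v s + FE P K *v ?y)
      + quad_form (QAg P) (KS P K *v s + KE P K *v ?y))"
    unfolding S A total_return_def reward_def sum.distrib[symmetric] sum_negf[symmetric]
    by (intro sum.cong refl) (simp add: algebra_simps del: state.simps)
  moreover have "transpose (QSg P) = QSg P" "transpose (QAg P) = QAg P"
    unfolding QSg_def QAg_def Dgamma_def using assms by (simp_all add: transpose_kron_diag_mat)
  ultimately show ?thesis
    unfolding Mss_def Mse_def Mee_def
    by (simp add: quad_form_affine quad_form_add matrix_vector_mult_add_rdistrib inner_add_right)
qed

lemma transpose_Mee:
  assumes "transpose (costS P) = costS P" "transpose (costA P) = costA P"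
  shows "transpose (Mee P K) = Mee P K"
  by (simp add: Mee_def QSg_def QAg_def Dgamma_def transpose_add matrix_transpose_mul matrix_mul_assoc
      transpose_kron_diag_mat[OF assms(1)] transpose_kron_diag_mat[OF assms(2)])

lemma state_inner_eq:
  fixes P :: "('t::{finite,linorder}, 'n::finite, 'm::finite) lq"
  assumes "t < CARD('t)" "p < CARD('t)"
  shows "state P K s e t \<bullet> state P K s e p = quad_form (Gtp P K t p) s
    + s \<bullet> (Jtp P K t p *v lifted_noise e) + quad_form (Utp P K t p) (lifted_noise e)"
  using assms
  by (simp add: state_eq quad_form_def Gtp_def Jtp_def Utp_def inner_add_left inner_add_right
      matrix_vector_mult_add_rdistrib matrix_vector_mul_assoc[symmetric] inner_transpose_mult inner_commute)

section \<open>Squared norms of the estimators as polynomials\<close>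

lemma diag_mat_mult_nth: "(diag_mat d *v v) $ i = d i * v $ i"
  by (simp add: matrix_vector_mult_def diag_mat_def if_distrib[of "\<lambda>c. c * _"] cong: if_cong)

lemma diag_mat_mult: "diag_mat d ** diag_mat d' = diag_mat (\<lambda>i. d i * d' i)"
  by (simp add: matrix_matrix_mult_def diag_mat_def vec_eq_iff if_distrib[of "\<lambda>c. c * _"] cong: if_cong)

lemma matrix_inv_noise_cov: "matrix_inv (noise_cov l) = diag_mat (dinv l)"
proof -
  have "noise_cov l ** diag_mat (dinv l) = mat 1"
    by (simp add: noise_cov_def diag_mat_mult dinv_def) (simp add: diag_mat_def mat_def)
  moreover have "diag_mat (dinv l) ** noise_cov l = mat 1"
    by (simp add: noise_cov_def diag_mat_mult dinv_def) (simp add: diag_mat_def mat_def)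
  ultimately have inv: "noise_cov l ** diag_mat (dinv l) = mat 1" "diag_mat (dinv l) ** noise_cov l = mat 1" .
  then have "matrix_inv (noise_cov l) ** noise_cov l = mat 1"
    unfolding matrix_inv_def by (metis (mono_tags, lifting) someI_ex)
  then show ?thesis
    by (metis inv(1) matrix_mul_assoc matrix_mul_lid matrix_mul_rid)
qed

lemma quad_form_WK:
  fixes P :: "('t::{finite,linorder}, 'n::finite, 'm::finite) lq"
  shows "quad_form (WK P l t p) y =
    (matrix_inv (noise_cov l) *v (Pi_sel t *v y)) \<bullet> (matrix_inv (noise_cov l) *v (Pi_sel p *v y))"
proof -
  have sym: "transpose (diag_mat (dinv l)) = diag_mat (dinv l)"
    by (auto simp: vec_eq_iff transpose_def diag_mat_def)
  show ?thesis
    unfolding matrix_inv_noise_cov WK_def quad_form_def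
    by (simp add: matrix_vector_mul_assoc[symmetric] inner_transpose_mult symmetric_swap[OF sym])
qed

lemma inner_outer_prod: "outer_prod a b \<bullet> outer_prod c d = (a \<bullet> c) * (b \<bullet> d)"
  by (simp only: inner_vec_def outer_prod_def vec_lambda_beta inner_real_def sum_product)
    (simp add: mult_ac)

text \<open>The Frobenius product of two rank-one matrices factorizes, so each pair (t, p) separates
  into a noise weight, a state product and the squared return, in which the sign of the reward
  disappears.\<close>

lemma norm_grad_est_K:
  fixes P :: "('t::{finite,linorder}, 'n::finite, 'm::finite) lq"
  assumes "transpose (costS P) = costS P" "transpose (costA P) = costA P"
  shows "(norm (grad_est_K P K l s e))\<^sup>2 = (\<Sum>t<CARD('t). \<Sum>p<CARD('t).
    quad_form (WK P l t p) (lifted_noise e)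
    * (quad_form (Gtp P K t p) s + s \<bullet> (Jtp P K t p *v lifted_noise e) + quad_form (Utp P K t p) (lifted_noise e))
    * (quad_form (Mss P K) s + 2 * (s \<bullet> (Mse P K *v lifted_noise e)) + quad_form (Mee P K) (lifted_noise e))\<^sup>2)"
proof -
  have "(norm (grad_est_K P K l s e))\<^sup>2 = (\<Sum>t<CARD('t). \<Sum>p<CARD('t).
      ((matrix_inv (noise_cov l) *v e t) \<bullet> (matrix_inv (noise_cov l) *v e p))
      * (state P K s e t \<bullet> state P K s e p) * (total_return P K s e)\<^sup>2)"
    unfolding power2_norm_eq_inner grad_est_K_def inner_sum_left inner_sum_right
    by (intro sum.cong refl) (simp add: inner_outer_prod power2_eq_square inner_commute mult_ac)
  also have "\<dots> = (\<Sum>t<CARD('t). \<Sum>p<CARD('t).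
    quad_form (WK P l t p) (lifted_noise e)
    * (quad_form (Gtp P K t p) s + s \<bullet> (Jtp P K t p *v lifted_noise e) + quad_form (Utp P K t p) (lifted_noise e))
    * (quad_form (Mss P K) s + 2 * (s \<bullet> (Mse P K *v lifted_noise e)) + quad_form (Mee P K) (lifted_noise e))\<^sup>2)"
    by (intro sum.cong refl)
      (simp add: quad_form_WK Pi_sel_lifted_noise state_inner_eq total_return_eq[OF assms] power2_minus
        del: minus_add_distrib)
  finally show ?thesis .
qed

lemma quad_form_Qti:
  fixes y :: "real^('t::{finite,linorder} \<times> 'm::finite)"
  shows "quad_form (Qti t i) y = ((Pi_sel t *v y) $ i)\<^sup>2"
proof -
  have "outer_prod (axis i 1) (axis i 1) *v z = z $ i *\<^sub>R axis i 1" for z :: "real^'m"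
    by (simp add: vec_eq_iff matrix_vector_mult_def outer_prod_def axis_def
        if_distrib[of "\<lambda>c. c * _"] cong: if_cong)
  then show ?thesis
    by (simp add: quad_form_def Qti_def matrix_vector_mul_assoc[symmetric] inner_transpose_mult
        inner_axis power2_eq_square)
qed

lemma transpose_Qti:
  fixes i :: "'m::finite"
  shows "transpose (Qti t i :: real^('t::{finite,linorder} \<times> 'm)^('t \<times> 'm)) = Qti t i"
proof -
  have "transpose (outer_prod (axis i 1) (axis i 1)) = (outer_prod (axis i 1) (axis i 1) :: real^'m^'m)"
    by (simp add: vec_eq_iff transpose_def outer_prod_def mult.commute)
  then show ?thesis
    by (simp add: Qti_def matrix_transpose_mul matrix_mul_assoc)
qed

lemma quad_form_Wl: "quad_form (Wl l t) y = (\<Sum>i\<in>UNIV. dinv l i * quad_form (Qti t i) y)"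
proof -
  have "quad_form (Wl l t) y = (Pi_sel t *v y) \<bullet> (diag_mat (dinv l) *v (Pi_sel t *v y))"
    by (simp add: quad_form_def Wl_def matrix_inv_noise_cov matrix_vector_mul_assoc[symmetric]
        inner_transpose_mult)
  then show ?thesis
    by (simp add: quad_form_Qti inner_vec_def diag_mat_mult_nth power2_eq_square mult_ac)
qed

text \<open>Coordinatewise, because \<Sigma> is diagonal: \<open>Qti t i\<close> is the form that
  squares coordinate i of the noise at time t.\<close>

lemma norm_grad_est_l:
  fixes P :: "('t::{finite,linorder}, 'n::finite, 'm::finite) lq"
  assumes "transpose (costS P) = costS P" "transpose (costA P) = costA P"
  shows "(norm (grad_est_l P K l s e))\<^sup>2 = (\<Sum>t<CARD('t). \<Sum>p<CARD('t). \<Sum>i\<in>UNIV.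
    (dinv l i * quad_form (Qti t i) (lifted_noise e :: real^('t \<times> 'm)) - 1)
    * (dinv l i * quad_form (Qti p i) (lifted_noise e :: real^('t \<times> 'm)) - 1)
    * (quad_form (Mss P K) s + 2 * (s \<bullet> (Mse P K *v lifted_noise e)) + quad_form (Mee P K) (lifted_noise e))\<^sup>2)"
proof -
  have "(norm (grad_est_l P K l s e))\<^sup>2 = (\<Sum>t<CARD('t). \<Sum>p<CARD('t). \<Sum>i\<in>UNIV.
      (dinv l i * (e t $ i)\<^sup>2 - 1) * (dinv l i * (e p $ i)\<^sup>2 - 1) * (total_return P K s e)\<^sup>2)"
    unfolding power2_norm_eq_inner grad_est_l_def inner_sum_left inner_sum_right
    by (intro sum.cong refl)
      (simp add: inner_vec_def matrix_inv_noise_cov diag_mat_mult_nth power2_eq_square mult_ac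
        sum_distrib_left)
  also have "\<dots> = (\<Sum>t<CARD('t). \<Sum>p<CARD('t). \<Sum>i\<in>UNIV.
    (dinv l i * quad_form (Qti t i) (lifted_noise e :: real^('t \<times> 'm)) - 1)
    * (dinv l i * quad_form (Qti p i) (lifted_noise e :: real^('t \<times> 'm)) - 1)
    * (quad_form (Mss P K) s + 2 * (s \<bullet> (Mse P K *v lifted_noise e)) + quad_form (Mee P K) (lifted_noise e))\<^sup>2)"
    by (intro sum.cong refl)
      (simp add: quad_form_Qti Pi_sel_lifted_noise total_return_eq[OF assms] power2_minus
        del: minus_add_distrib)
  finally show ?thesis .
qed


section \<open>Second moments\<close>

context gaussian_vector
begin

text \<open>The integrand at a fixed initial state x: g, z, U are the parts of s_t \<bullet> s_p of
  degree 0, 1, 2 in y, and a, v, C those of the negated return. The even terms are ordered so that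
  they match \<open>EK1\<close> to \<open>EK6\<close>.\<close>

lemma expectation_K_term:
  assumes sym: "transpose W = W" "transpose U = U" "transpose C = C"
  shows "(\<integral>y. quad_form W y * (g + z \<bullet> y + quad_form U y) * (a + 2 * (v \<bullet> y) + quad_form C y)\<^sup>2 \<partial>N) =
      g * a\<^sup>2 * (\<integral>y. quad_form W y \<partial>N)
    + a\<^sup>2 * (\<integral>y. quad_form W y * quad_form U y \<partial>N)
    + g * (\<integral>y. quad_form W y * (quad_form C y * quad_form C y) \<partial>N)
    + (\<integral>y. quad_form W y * (quad_form U y * (quad_form C y * quad_form C y)) \<partial>N)
    + 2 * a * g * (\<integral>y. quad_form W y * quad_form C y \<partial>N)
    + 2 * a * (\<integral>y. quad_form W y * (quad_form U y * quad_form C y) \<partial>N)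
    + 4 * g * (trace (\<Omega> ** W) * (v \<bullet> (\<Omega> *v v)) + 2 * (v \<bullet> (\<Omega> *v (W *v (\<Omega> *v v)))))
    + 4 * ((trace (\<Omega> ** W) * trace (\<Omega> ** U) + 2 * trace (\<Omega> ** W ** \<Omega> ** U)) * (v \<bullet> (\<Omega> *v v))
      + 2 * trace (\<Omega> ** U) * (v \<bullet> (\<Omega> *v (W *v (\<Omega> *v v))))
      + 2 * trace (\<Omega> ** W) * (v \<bullet> (\<Omega> *v (U *v (\<Omega> *v v))))
      + 4 * (v \<bullet> (\<Omega> *v (W *v (\<Omega> *v (U *v (\<Omega> *v v))))))
      + 4 * (v \<bullet> (\<Omega> *v (U *v (\<Omega> *v (W *v (\<Omega> *v v)))))))
    + 4 * a * (trace (\<Omega> ** W) * (v \<bullet> (\<Omega> *v z)) + 2 * (v \<bullet> (\<Omega> *v (W *v (\<Omega> *v z)))))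
    + 4 * ((trace (\<Omega> ** W) * trace (\<Omega> ** C) + 2 * trace (\<Omega> ** W ** \<Omega> ** C)) * (v \<bullet> (\<Omega> *v z))
      + 2 * trace (\<Omega> ** C) * (v \<bullet> (\<Omega> *v (W *v (\<Omega> *v z))))
      + 2 * trace (\<Omega> ** W) * (v \<bullet> (\<Omega> *v (C *v (\<Omega> *v z))))
      + 4 * (v \<bullet> (\<Omega> *v (W *v (\<Omega> *v (C *v (\<Omega> *v z))))))
      + 4 * (v \<bullet> (\<Omega> *v (C *v (\<Omega> *v (W *v (\<Omega> *v z)))))))"
proof -
  \<comment> \<open>The terms with an odd number of the linear factors v \<bullet> y and z \<bullet>
    y.\<close>
  let ?odd = "\<lambda>y. quad_form W y * ((g + quad_form U y) * (4 * (v \<bullet> y) * (a + quad_form C y))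
    + (z \<bullet> y) * ((a + quad_form C y)\<^sup>2 + 4 * (v \<bullet> y)\<^sup>2))"
  have "(\<integral>y. quad_form W y * (g + z \<bullet> y + quad_form U y) * (a + 2 * (v \<bullet> y) + quad_form C y)\<^sup>2 \<partial>N) =
    (\<integral>y. g * a\<^sup>2 * quad_form W y
    + a\<^sup>2 * (quad_form W y * quad_form U y)
    + g * (quad_form W y * (quad_form C y * quad_form C y))
    + quad_form W y * (quad_form U y * (quad_form C y * quad_form C y))
    + 2 * a * g * (quad_form W y * quad_form C y)
    + 2 * a * (quad_form W y * (quad_form U y * quad_form C y))
    + 4 * g * ((v \<bullet> y) * ((v \<bullet> y) * quad_form W y))
    + 4 * ((v \<bullet> y) * ((v \<bullet> y) * (quad_form W y * quad_form U y)))
    + 4 * a * ((v \<bullet> y) * ((z \<bullet> y) * quad_form W y))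
    + 4 * ((v \<bullet> y) * ((z \<bullet> y) * (quad_form W y * quad_form C y)))
    + ?odd y \<partial>N)"
    by (intro Bochner_Integration.integral_cong refl) algebra
  moreover have "(\<integral>y. ?odd y \<partial>N) = 0"
  proof (rule expectation_odd)
    show "real_polynomial_function ?odd" by (intro polynomial_intros)
    have "quad_form X (- y) = quad_form X y" for X and y :: "real^'k"
      by (simp add: quad_form_def linear_neg[OF matrix_vector_mul_linear])
    then show "?odd (- y) = - ?odd y" for y by (simp add: algebra_simps)
  qed
  moreover have "integrable N ?odd" by (intro integrable_polynomial polynomial_intros)
  moreover have
    "integrable N (\<lambda>y. g * a\<^sup>2 * quad_form W y)"
    "integrable N (\<lambda>y. a\<^sup>2 * (quad_form W y * quad_form U y))"
    "integrable N (\<lambda>y. g * (quad_form W y * (quad_form C y * quad_form C y)))"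
    "integrable N (\<lambda>y. quad_form W y * (quad_form U y * (quad_form C y * quad_form C y)))"
    "integrable N (\<lambda>y. 2 * a * g * (quad_form W y * quad_form C y))"
    "integrable N (\<lambda>y. 2 * a * (quad_form W y * (quad_form U y * quad_form C y)))"
    "integrable N (\<lambda>y. 4 * g * ((v \<bullet> y) * ((v \<bullet> y) * quad_form W y)))"
    "integrable N (\<lambda>y. 4 * ((v \<bullet> y) * ((v \<bullet> y) * (quad_form W y * quad_form U y))))"
    "integrable N (\<lambda>y. 4 * a * ((v \<bullet> y) * ((z \<bullet> y) * quad_form W y)))"
    "integrable N (\<lambda>y. 4 * ((v \<bullet> y) * ((z \<bullet> y) * (quad_form W y * quad_form C y))))"
    by (intro integrable_polynomial polynomial_intros)+
  ultimately show ?thesis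
    by (simp only: Bochner_Integration.integral_add Bochner_Integration.integrable_add
        integral_mult_right_zero expectation_inner2_quad[OF sym(1)]
        expectation_inner2_quad2[OF sym(1,2)] expectation_inner2_quad2[OF sym(1,3)] add_0_right)
qed

text \<open>The traces are collected into factors d tr(\<Omega> A) - 1, the means of the weights,
  because these vanish for the matrices to which the formula is applied.\<close>

lemma expectation_l_term:
  assumes sym: "transpose A = A" "transpose B = B" "transpose C = C"
  shows "(\<integral>y. (d * quad_form A y - 1) * (d * quad_form B y - 1) * (a + 2 * (v \<bullet> y) + quad_form C y)\<^sup>2 \<partial>N) =
      a\<^sup>2 * ((d * trace (\<Omega> ** A) - 1) * (d * trace (\<Omega> ** B) - 1) + 2 * d\<^sup>2 * trace (\<Omega> ** A ** \<Omega> ** B))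
    + (d\<^sup>2 * (\<integral>y. quad_form A y * (quad_form B y * (quad_form C y * quad_form C y)) \<partial>N)
      - d * (\<integral>y. quad_form A y * (quad_form C y * quad_form C y) \<partial>N)
      - d * (\<integral>y. quad_form B y * (quad_form C y * quad_form C y) \<partial>N)
      + (\<integral>y. quad_form C y * quad_form C y \<partial>N))
    + 2 * a * (d\<^sup>2 * (\<integral>y. quad_form A y * (quad_form B y * quad_form C y) \<partial>N)
      - d * (\<integral>y. quad_form A y * quad_form C y \<partial>N)
      - d * (\<integral>y. quad_form B y * quad_form C y \<partial>N)
      + (\<integral>y. quad_form C y \<partial>N))
    + 4 * (((d * trace (\<Omega> ** A) - 1) * (d * trace (\<Omega> ** B) - 1) + 2 * d\<^sup>2 * trace (\<Omega> ** A ** \<Omega> ** B)) * (v \<bullet> (\<Omega> *v v))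
      + 2 * d * (d * trace (\<Omega> ** B) - 1) * (v \<bullet> (\<Omega> *v (A *v (\<Omega> *v v))))
      + 2 * d * (d * trace (\<Omega> ** A) - 1) * (v \<bullet> (\<Omega> *v (B *v (\<Omega> *v v))))
      + 4 * d\<^sup>2 * (v \<bullet> (\<Omega> *v (A *v (\<Omega> *v (B *v (\<Omega> *v v))))))
      + 4 * d\<^sup>2 * (v \<bullet> (\<Omega> *v (B *v (\<Omega> *v (A *v (\<Omega> *v v)))))))"
proof -
  let ?odd = "\<lambda>y. (d * quad_form A y - 1) * (d * quad_form B y - 1) * (4 * (v \<bullet> y) * (a + quad_form C y))"
  have "(\<integral>y. (d * quad_form A y - 1) * (d * quad_form B y - 1) * (a + 2 * (v \<bullet> y) + quad_form C y)\<^sup>2 \<partial>N) =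
    (\<integral>y. a\<^sup>2 * d\<^sup>2 * (quad_form A y * quad_form B y)
    + (- (a\<^sup>2 * d)) * quad_form A y + (- (a\<^sup>2 * d)) * quad_form B y + a\<^sup>2
    + d\<^sup>2 * (quad_form A y * (quad_form B y * (quad_form C y * quad_form C y)))
    + (- d) * (quad_form A y * (quad_form C y * quad_form C y))
    + (- d) * (quad_form B y * (quad_form C y * quad_form C y))
    + quad_form C y * quad_form C y
    + 2 * a * d\<^sup>2 * (quad_form A y * (quad_form B y * quad_form C y))
    + (- (2 * a * d)) * (quad_form A y * quad_form C y)
    + (- (2 * a * d)) * (quad_form B y * quad_form C y)
    + 2 * a * quad_form C y
    + 4 * d\<^sup>2 * ((v \<bullet> y) * ((v \<bullet> y) * (quad_form A y * quad_form B y)))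
    + (- (4 * d)) * ((v \<bullet> y) * ((v \<bullet> y) * quad_form A y))
    + (- (4 * d)) * ((v \<bullet> y) * ((v \<bullet> y) * quad_form B y))
    + 4 * ((v \<bullet> y) * (v \<bullet> y))
    + ?odd y \<partial>N)"
    by (intro Bochner_Integration.integral_cong refl) algebra
  moreover have "(\<integral>y. ?odd y \<partial>N) = 0"
  proof (rule expectation_odd)
    show "real_polynomial_function ?odd" by (intro polynomial_intros)
    have "quad_form X (- y) = quad_form X y" for X and y :: "real^'k"
      by (simp add: quad_form_def linear_neg[OF matrix_vector_mul_linear])
    then show "?odd (- y) = - ?odd y" for y by simp
  qed
  moreover have "integrable N ?odd" by (intro integrable_polynomial polynomial_intros)
  moreover have
    "integrable N (\<lambda>y. a\<^sup>2 * d\<^sup>2 * (quad_form A y * quad_form B y))"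
    "integrable N (\<lambda>y. (- (a\<^sup>2 * d)) * quad_form A y)"
    "integrable N (\<lambda>y. (- (a\<^sup>2 * d)) * quad_form B y)"
    "integrable N (\<lambda>y. a\<^sup>2)"
    "integrable N (\<lambda>y. d\<^sup>2 * (quad_form A y * (quad_form B y * (quad_form C y * quad_form C y))))"
    "integrable N (\<lambda>y. (- d) * (quad_form A y * (quad_form C y * quad_form C y)))"
    "integrable N (\<lambda>y. (- d) * (quad_form B y * (quad_form C y * quad_form C y)))"
    "integrable N (\<lambda>y. quad_form C y * quad_form C y)"
    "integrable N (\<lambda>y. 2 * a * d\<^sup>2 * (quad_form A y * (quad_form B y * quad_form C y)))"
    "integrable N (\<lambda>y. (- (2 * a * d)) * (quad_form A y * quad_form C y))"
    "integrable N (\<lambda>y. (- (2 * a * d)) * (quad_form B y * quad_form C y))"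
    "integrable N (\<lambda>y. 2 * a * quad_form C y)"
    "integrable N (\<lambda>y. 4 * d\<^sup>2 * ((v \<bullet> y) * ((v \<bullet> y) * (quad_form A y * quad_form B y))))"
    "integrable N (\<lambda>y. (- (4 * d)) * ((v \<bullet> y) * ((v \<bullet> y) * quad_form A y)))"
    "integrable N (\<lambda>y. (- (4 * d)) * ((v \<bullet> y) * ((v \<bullet> y) * quad_form B y)))"
    "integrable N (\<lambda>y. 4 * ((v \<bullet> y) * (v \<bullet> y)))"
    by (intro integrable_polynomial polynomial_intros)+
  moreover have "(\<integral>y. a\<^sup>2 \<partial>N) = a\<^sup>2" by (simp add: prob_space[simplified])
  ultimately show ?thesis
    by (simp only: Bochner_Integration.integral_add Bochner_Integration.integrable_add
        integral_mult_right_zero expectation_inner2_quad[OF sym(1)] expectation_inner2_quad[OF sym(2)]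
        expectation_inner2_quad2[OF sym(1,2)] expectation_inner2 expectation_quad_form2[OF sym(1,2)]
        expectation_quad_form[OF sym(1)] expectation_quad_form[OF sym(2)] add_0_right)
      (simp add: algebra_simps power2_eq_square)
qed

end


section \<open>Integration over the initial state\<close>

lemma IS_simps:
  "IS \<Omega> [A] = (\<integral>x. quad_form A x \<partial>gaussian_law \<Omega>)"
  "IS \<Omega> [A, B] = (\<integral>x. quad_form A x * quad_form B x \<partial>gaussian_law \<Omega>)"
  "IS \<Omega> [A, B, C] = (\<integral>x. quad_form A x * (quad_form B x * quad_form C x) \<partial>gaussian_law \<Omega>)"
  "IS \<Omega> [A, B, C, D] = (\<integral>x. quad_form A x * (quad_form B x * (quad_form C x * quad_form D x)) \<partial>gaussian_law \<Omega>)"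
  by (simp_all add: IS_def)

text \<open>The vectors v and z of \<open>expectation_K_term\<close> are linear in x, so its result
  is again a polynomial in quadratic forms of x, and the outer integral turns these into
  \<open>IS\<close> terms.\<close>

lemma second_moment_K_term:
  fixes P :: "('t::{finite,linorder}, 'n::finite, 'm::finite) lq"
  assumes N0: "gaussian_vector (init_cov P) (gaussian_law (init_cov P))"
    and N1: "gaussian_vector (Sbar P l) (gaussian_law (Sbar P l))"
    and costs: "transpose (costS P) = costS P" "transpose (costA P) = costA P"
  shows "(\<integral>x. \<integral>y. quad_form (WK P l t p) y
      * (quad_form (Gtp P K t p) x + x \<bullet> (Jtp P K t p *v y) + quad_form (Utp P K t p) y)
      * (quad_form (Mss P K) x + 2 * (x \<bullet> (Mse P K *v y)) + quad_form (Mee P K) y)\<^sup>2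
      \<partial>gaussian_law (Sbar P l) \<partial>gaussian_law (init_cov P)) =
    EK1 P K l t p + EK2 P K l t p + EK3 P K l t p + EK4 P K l t p + EK5 P K l t p + EK6 P K l t p"
    (is "(\<integral>x. ?inner x \<partial>?N0) = _")
proof -
  interpret N0: gaussian_vector "init_cov P" ?N0 by (rule N0)
  interpret N1: gaussian_vector "Sbar P l" "gaussian_law (Sbar P l)" by (rule N1)
  let ?S = "Sbar P l" and ?W = "symp (WK P l t p)" and ?U = "symp (Utp P K t p)" and ?G = "symp (Gtp P K t p)"
  let ?C = "Mee P K" and ?a = "quad_form (Mss P K)"
  let ?v = "\<lambda>x. transpose (Mse P K) *v x" and ?z = "\<lambda>x. transpose (Jtp P K t p) *v x"
  have sym: "transpose ?W = ?W" "transpose ?U = ?U" "transpose ?C = ?C"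
    by (simp_all add: transpose_symp transpose_Mee[OF costs])
  have v_inner: "?v x \<bullet> u = x \<bullet> (Mse P K *v u)" for x u
    by (simp add: dot_lmul_matrix)
  \<comment> \<open>Moving \<open>Mse\<close> and \<open>Jtp\<close> back from x into the chain
    leaves one matrix between two copies of x. It need not be symmetric, whence \<open>symp\<close>
    in \<open>Vj\<close> and \<open>Vhat\<close>.\<close>
  have V: "?v x \<bullet> (?S *v ?v x) = quad_form (V0 P K l) x"
    "?v x \<bullet> (?S *v (?W *v (?S *v ?v x))) = quad_form (Vtp P K l t p) x"
    "?v x \<bullet> (?S *v (?U *v (?S *v ?v x))) = quad_form (Vtilde P K l t p) x"
    "?v x \<bullet> (?S *v (?W *v (?S *v (?U *v (?S *v ?v x))))) = quad_form (symp (Vhat P K l t p)) x"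
    "?v x \<bullet> (?S *v ?z x) = quad_form (Vj P K (A0 P l) t p) x"
    "?v x \<bullet> (?S *v (?W *v (?S *v ?z x))) = quad_form (Vj P K (A1 P l t p) t p) x"
    "?v x \<bullet> (?S *v (?C *v (?S *v ?z x))) = quad_form (Vj P K (A2 P K l) t p) x" for x
    unfolding v_inner Vj_def V0_def Vtp_def Vtilde_def Vhat_def A0_def A1_def A2_def quad_form_symp
    unfolding quad_form_def
    by (simp_all only: matrix_vector_mul_assoc matrix_mul_assoc)
  \<comment> \<open>With v at both ends the two orders of W and U give the same value, so 4 * (4 +
    4) = 4 * 8.\<close>
  have V_swap: "?v x \<bullet> (?S *v (?U *v (?S *v (?W *v (?S *v ?v x))))) = quad_form (symp (Vhat P K l t p)) x" for x
  proof -
    have "u \<bullet> (?S *v (?U *v (?S *v (?W *v (?S *v u'))))) = u' \<bullet> (?S *v (?W *v (?S *v (?U *v (?S *v u)))))" for u u'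
      by (rule trans[OF _ inner_commute])
        (simp only: N1.cov_swap[symmetric] symmetric_swap[OF sym(1)] symmetric_swap[OF sym(2)])
    then show ?thesis unfolding V(4)[symmetric] .
  qed
  \<comment> \<open>Here the ends v and z differ, so the two orders of W and C must be averaged;
    this is why \<open>A3\<close> is symmetrized already inside.\<close>
  have V3: "?v x \<bullet> (?S *v (?W *v (?S *v (?C *v (?S *v ?z x))))) + ?v x \<bullet> (?S *v (?C *v (?S *v (?W *v (?S *v ?z x)))))
      = 2 * quad_form (Vj P K (A3 P K l t p) t p) x" for x
  proof -
    have "transpose (?S ** ?W ** ?S ** ?C ** ?S) = ?S ** ?C ** ?S ** ?W ** ?S"
      by (simp add: matrix_transpose_mul transpose_Sbar sym matrix_mul_assoc)
    then have "A3 P K l t p = (1/2) *\<^sub>R (?S ** ?W ** ?S ** ?C ** ?S + ?S ** ?C ** ?S ** ?W ** ?S)"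
      unfolding A3_def by (simp only: symp_def[of "?S ** ?W ** ?S ** ?C ** ?S"])
    then have "A3 P K l t p *v u = (1/2) *\<^sub>R (?S *v (?W *v (?S *v (?C *v (?S *v u)))) + ?S *v (?C *v (?S *v (?W *v (?S *v u)))))" for u
      by (simp add: scaleR_matrix_vector_assoc[symmetric] matrix_vector_mult_add_rdistrib matrix_vector_mul_assoc matrix_mul_assoc)
    moreover have "quad_form (Vj P K (A3 P K l t p) t p) x = ?v x \<bullet> (A3 P K l t p *v ?z x)"
      unfolding v_inner Vj_def quad_form_symp unfolding quad_form_def
      by (simp only: matrix_vector_mul_assoc matrix_mul_assoc)
    ultimately show ?thesis by (simp add: inner_add_right)
  qed
  have inner: "?inner x =
      IS ?S [?W] * (quad_form ?G x * (?a x * ?a x)) + IS ?S [?W, ?U] * (?a x * ?a x)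
    + IS ?S [?W, ?C, ?C] * quad_form ?G x + IS ?S [?W, ?U, ?C, ?C]
    + 2 * IS ?S [?W, ?C] * (quad_form ?G x * ?a x) + 2 * IS ?S [?W, ?U, ?C] * ?a x
    + 4 * alpha P l t p * (quad_form ?G x * quad_form (V0 P K l) x)
    + 8 * (quad_form ?G x * quad_form (Vtp P K l t p) x)
    + 4 * (alpha P l t p * beta P K l t p + 2 * delta P K l t p) * quad_form (V0 P K l) x
    + 8 * beta P K l t p * quad_form (Vtp P K l t p) x
    + 8 * alpha P l t p * quad_form (Vtilde P K l t p) x
    + 32 * quad_form (symp (Vhat P K l t p)) x
    + 4 * alpha P l t p * (?a x * quad_form (Vj P K (A0 P l) t p) x)
    + 8 * (?a x * quad_form (Vj P K (A1 P l t p) t p) x)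
    + 4 * (alpha P l t p * mu P K l + 2 * kappa P K l t p) * quad_form (Vj P K (A0 P l) t p) x
    + 8 * mu P K l * quad_form (Vj P K (A1 P l t p) t p) x
    + 8 * alpha P l t p * quad_form (Vj P K (A2 P K l) t p) x
    + 32 * quad_form (Vj P K (A3 P K l t p) t p) x" (is "_ = ?rhs x") for x
  proof -
    have "?inner x = (\<integral>y. quad_form ?W y * (quad_form ?G x + ?z x \<bullet> y + quad_form ?U y)
        * (?a x + 2 * (?v x \<bullet> y) + quad_form ?C y)\<^sup>2 \<partial>gaussian_law ?S)"
      by (simp add: quad_form_symp dot_lmul_matrix)
    also have "\<dots> = ?rhs x"
      unfolding N1.expectation_K_term[OF sym] V V_swap IS_simps[symmetric]
        alpha_def[symmetric] beta_def[symmetric] delta_def[symmetric] mu_def[symmetric] kappa_def[symmetric]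
      using V3[of x] by algebra
    finally show ?thesis .
  qed
  have poly:
    "integrable ?N0 (\<lambda>x. c * (quad_form A x * (quad_form B x * quad_form D x)))"
    "integrable ?N0 (\<lambda>x. c * (quad_form A x * quad_form B x))"
    "integrable ?N0 (\<lambda>x. c * quad_form A x)"
    "integrable ?N0 (\<lambda>x. c)" for c A B D
    by (intro N0.integrable_polynomial polynomial_intros)+
  have const: "(\<integral>x. c \<partial>?N0) = c" for c :: real by (simp add: N0.prob_space[simplified])
  show ?thesis
    unfolding inner
    by (simp only: Bochner_Integration.integral_add Bochner_Integration.integrable_add poly
        integral_mult_right_zero const IS_simps[symmetric])
      (simp add: EK1_def EK2_def EK3_def EK4_def EK5_def EK6_def algebra_simps)
qed

lemma Sbar_mult_nth:
  fixes P :: "('t::{finite,linorder}, 'n::finite, 'm::finite) lq"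
  shows "(Sbar P l *v y) $ (k, i) = (exp (l $ i))\<^sup>2 * y $ (k, i)"
  using arg_cong[OF Pi_sel_Sbar_mult[of "step k" P l y], of "\<lambda>v. v $ i"]
  by (simp add: noise_cov_mult_nth)

lemma dinv_mult: "dinv l i * (exp (l $ i))\<^sup>2 = 1"
  by (simp add: dinv_def)

text \<open>Both traces are read off by computing \<open>E[quad_form A]\<close> and
  \<open>E[quad_form A * quad_form B]\<close> in two ways.\<close>

lemma (in gaussian_vector) trace_square_inner:
  assumes "transpose A = A" "\<And>y. quad_form A y = (u \<bullet> y)\<^sup>2"
    and "transpose B = B"
  shows "trace (\<Omega> ** A) = quad_form \<Omega> u"
    and "trace (\<Omega> ** A ** \<Omega> ** B) = quad_form B (\<Omega> *v u)"
proof -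
  have "trace (\<Omega> ** A) = (\<integral>y. (u \<bullet> y) * (u \<bullet> y) \<partial>N)"
    by (simp add: expectation_quad_form[OF assms(1), symmetric] assms(2) power2_eq_square)
  then have tr: "trace (\<Omega> ** A) = u \<bullet> (\<Omega> *v u)"
    by (simp add: expectation_inner2)
  then show "trace (\<Omega> ** A) = quad_form \<Omega> u" by (simp add: quad_form_def)
  have "(\<integral>y. quad_form A y * quad_form B y \<partial>N) = (\<integral>y. (u \<bullet> y) * ((u \<bullet> y) * quad_form B y) \<partial>N)"
    by (simp add: assms(2) power2_eq_square mult.assoc)
  moreover have "u \<bullet> (\<Omega> *v (B *v (\<Omega> *v u))) = quad_form B (\<Omega> *v u)"
    by (simp add: quad_form_def cov_swap)
  ultimately show "trace (\<Omega> ** A ** \<Omega> ** B) = quad_form B (\<Omega> *v u)"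
    using tr by (simp add: expectation_quad_form2[OF assms(1,3)] expectation_inner2_quad[OF assms(3)])
qed

text \<open>\<open>Qti t i\<close> squares a single coordinate, of variance exp(2 l_i), and
  coordinates at distinct times are uncorrelated. So the weights d_i \<epsilon>_{t,i}^2 - 1 have
  mean 0, and their covariance is 2 for t = p and 0 otherwise.\<close>

lemma trace_Sbar_Qti:
  fixes P :: "('t::{finite,linorder}, 'n::finite, 'm::finite) lq"
  assumes N1: "gaussian_vector (Sbar P l) N" and t: "t < CARD('t)" and p: "p < CARD('t)"
  shows "dinv l i * trace (Sbar P l ** Qti t i) = 1"
    and "(dinv l i)\<^sup>2 * trace (Sbar P l ** Qti t i ** Sbar P l ** Qti p i) = of_bool (t = p)"
proof -
  interpret gaussian_vector "Sbar P l" N by fact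
  obtain k :: 't where k: "t = step k" using t by (rule step_cases)
  obtain j :: 't where j: "p = step j" using p by (rule step_cases)
  let ?u = "axis (k, i) 1 :: real^('t \<times> 'm)"
  have q: "quad_form (Qti (step k') i) y = (y $ (k', i))\<^sup>2" for k' :: 't and y :: "real^('t \<times> 'm)"
    by (simp add: quad_form_Qti)
  then have "quad_form (Qti t i) y = (?u \<bullet> y)\<^sup>2" for y :: "real^('t \<times> 'm)"
    by (simp add: k inner_axis')
  note tr = trace_square_inner[OF transpose_Qti this transpose_Qti[of p i]]
  show "dinv l i * trace (Sbar P l ** Qti t i) = 1"
    using dinv_mult[of l i] by (simp add: tr(1) quad_form_def inner_axis' Sbar_mult_nth)
  have "trace (Sbar P l ** Qti t i ** Sbar P l ** Qti p i) = of_bool (t = p) * ((exp (l $ i))\<^sup>2)\<^sup>2"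
    unfolding tr(2) by (simp add: j k q Sbar_mult_nth axis_def)
  moreover have "(dinv l i)\<^sup>2 * ((exp (l $ i))\<^sup>2)\<^sup>2 = 1"
    unfolding power_mult_distrib[symmetric] dinv_mult by simp
  ultimately show "(dinv l i)\<^sup>2 * trace (Sbar P l ** Qti t i ** Sbar P l ** Qti p i) = of_bool (t = p)"
    by simp
qed

text \<open>As the weights have mean 0, the terms with a factor d tr - 1 drop out of
  \<open>expectation_l_term\<close>. The surviving covariance 2 [t = p] is the same for all i, so
  summation over i contributes the factor m in \<open>El1\<close> and \<open>El4\<close>.\<close>

lemma second_moment_l_term:
  fixes P :: "('t::{finite,linorder}, 'n::finite, 'm::finite) lq"
  assumes N0: "gaussian_vector (init_cov P) (gaussian_law (init_cov P))"
    and N1: "gaussian_vector (Sbar P l) (gaussian_law (Sbar P l))"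
    and costs: "transpose (costS P) = costS P" "transpose (costA P) = costA P"
    and t: "t < CARD('t)" and p: "p < CARD('t)"
  shows "(\<Sum>i\<in>UNIV. \<integral>x. \<integral>y. (dinv l i * quad_form (Qti t i) y - 1) * (dinv l i * quad_form (Qti p i) y - 1)
      * (quad_form (Mss P K) x + 2 * (x \<bullet> (Mse P K *v y)) + quad_form (Mee P K) y)\<^sup>2
      \<partial>gaussian_law (Sbar P l) \<partial>gaussian_law (init_cov P)) =
    El1 P K t p + El2 P K l t p + El3 P K l t p + El4 P K l t p"
    (is "(\<Sum>i\<in>UNIV. \<integral>x. ?inner i x \<partial>?N0) = _")
proof -
  interpret N0: gaussian_vector "init_cov P" ?N0 by (rule N0)
  interpret N1: gaussian_vector "Sbar P l" "gaussian_law (Sbar P l)" by (rule N1)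
  let ?S = "Sbar P l" and ?C = "Mee P K" and ?a = "quad_form (Mss P K)"
  let ?v = "\<lambda>x. transpose (Mse P K) *v x"
  let ?A = "\<lambda>i. Qti t i :: real^('t \<times> 'm)^('t \<times> 'm)" and ?B = "\<lambda>i. Qti p i :: real^('t \<times> 'm)^('t \<times> 'm)"
  define k2 where "k2 i = (dinv l i)\<^sup>2 * IS ?S [?A i, ?B i, ?C, ?C] - dinv l i * IS ?S [?A i, ?C, ?C]
    - dinv l i * IS ?S [?B i, ?C, ?C] + IS ?S [?C, ?C]" for i
  define k3 where "k3 i = (dinv l i)\<^sup>2 * IS ?S [?A i, ?B i, ?C] - dinv l i * IS ?S [?A i, ?C]
    - dinv l i * IS ?S [?B i, ?C] + IS ?S [?C]" for i
  have symC: "transpose ?C = ?C" by (rule transpose_Mee[OF costs])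
  have v_inner: "?v x \<bullet> u = x \<bullet> (Mse P K *v u)" for x u
    by (simp add: dot_lmul_matrix)
  have V: "?v x \<bullet> (?S *v ?v x) = quad_form (V0 P K l) x"
    "?v x \<bullet> (?S *v (?A i *v (?S *v (?B i *v (?S *v ?v x))))) = quad_form (Vtpi P K l t p i) x" for x i
    unfolding v_inner Vtpi_def quad_form_symp V0_def unfolding quad_form_def
    by (simp_all only: matrix_vector_mul_assoc matrix_mul_assoc)
  have V_swap: "?v x \<bullet> (?S *v (?B i *v (?S *v (?A i *v (?S *v ?v x))))) = quad_form (Vtpi P K l t p i) x" for x i
  proof -
    have "u \<bullet> (?S *v (?B i *v (?S *v (?A i *v (?S *v u'))))) = u' \<bullet> (?S *v (?A i *v (?S *v (?B i *v (?S *v u)))))" for u u'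
      by (rule trans[OF _ inner_commute])
        (simp only: N1.cov_swap[symmetric] symmetric_swap[OF transpose_Qti])
    then show ?thesis unfolding V(2)[symmetric] .
  qed
  have inner: "?inner i x = 2 * of_bool (t = p) * (?a x * ?a x) + k2 i + 2 * k3 i * ?a x
      + 8 * of_bool (t = p) * quad_form (V0 P K l) x + 32 * (dinv l i)\<^sup>2 * quad_form (Vtpi P K l t p i) x" for i x
  proof -
    have tr: "dinv l i * trace (?S ** ?A i) - 1 = 0" "dinv l i * trace (?S ** ?B i) - 1 = 0"
      "2 * (dinv l i)\<^sup>2 * trace (?S ** ?A i ** ?S ** ?B i) = 2 * of_bool (t = p)"
      using trace_Sbar_Qti[OF N1 t p, of i] trace_Sbar_Qti[OF N1 p t, of i] by simp_all
    have "?inner i x = (\<integral>y. (dinv l i * quad_form (?A i) y - 1) * (dinv l i * quad_form (?B i) y - 1)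
        * (?a x + 2 * (?v x \<bullet> y) + quad_form ?C y)\<^sup>2 \<partial>gaussian_law ?S)"
      by (simp add: dot_lmul_matrix)
    also have "\<dots> = (?a x)\<^sup>2 * (2 * of_bool (t = p)) + k2 i + 2 * ?a x * k3 i
        + 4 * (2 * of_bool (t = p) * quad_form (V0 P K l) x
          + 4 * (dinv l i)\<^sup>2 * quad_form (Vtpi P K l t p i) x + 4 * (dinv l i)\<^sup>2 * quad_form (Vtpi P K l t p i) x)"
      unfolding N1.expectation_l_term[OF transpose_Qti transpose_Qti symC] V V_swap IS_simps[symmetric] tr k2_def k3_def
      by simp
    also have "\<dots> = 2 * of_bool (t = p) * (?a x * ?a x) + k2 i + 2 * k3 i * ?a x
      + 8 * of_bool (t = p) * quad_form (V0 P K l) x + 32 * (dinv l i)\<^sup>2 * quad_form (Vtpi P K l t p i) x"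
      by (simp add: power2_eq_square)
    finally show ?thesis .
  qed
  have poly:
    "integrable ?N0 (\<lambda>x. c * (quad_form A x * quad_form B x))"
    "integrable ?N0 (\<lambda>x. c * quad_form A x)"
    "integrable ?N0 (\<lambda>x. c)" for c A B
    by (intro N0.integrable_polynomial polynomial_intros)+
  have const: "(\<integral>x. c \<partial>?N0) = c" for c :: real by (simp add: N0.prob_space[simplified])
  have outer: "(\<integral>x. ?inner i x \<partial>?N0) = 2 * of_bool (t = p) * IS (init_cov P) [Mss P K, Mss P K] + k2 i
      + 2 * k3 i * IS (init_cov P) [Mss P K] + 8 * of_bool (t = p) * IS (init_cov P) [V0 P K l]
      + 32 * (dinv l i)\<^sup>2 * IS (init_cov P) [Vtpi P K l t p i]" for i
    unfolding inner
    by (simp only: Bochner_Integration.integral_add Bochner_Integration.integrable_add poly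
        integral_mult_right_zero const IS_simps[symmetric])
  \<comment> \<open>\<open>Wl\<close> is the combination of the \<open>Qti\<close> with coefficients
    d_i, so the terms of first order in d_i sum to \<open>IS\<close> terms of
    \<open>Wl\<close>.\<close>
  have W2: "IS ?S [Wl l q, ?C] = (\<Sum>i\<in>UNIV. dinv l i * IS ?S [Qti q i, ?C])" for q
    unfolding IS_simps quad_form_Wl sum_distrib_right mult.assoc
    by (subst Bochner_Integration.integral_sum)
      (auto intro!: N1.integrable_polynomial polynomial_intros)
  have W3: "IS ?S [Wl l q, ?C, ?C] = (\<Sum>i\<in>UNIV. dinv l i * IS ?S [Qti q i, ?C, ?C])" for q
    unfolding IS_simps quad_form_Wl sum_distrib_right mult.assoc
    by (subst Bochner_Integration.integral_sum)
      (auto intro!: N1.integrable_polynomial polynomial_intros)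
  have k2: "(\<Sum>i\<in>UNIV. k2 i) = El2 P K l t p"
    by (simp add: k2_def El2_def W3 sum.distrib sum_subtractf)
  have k3: "2 * IS (init_cov P) [Mss P K] * (\<Sum>i\<in>UNIV. k3 i) = El3 P K l t p"
    by (simp add: k3_def El3_def W2 sum.distrib sum_subtractf)
  have "(\<Sum>i\<in>UNIV. \<integral>x. ?inner i x \<partial>?N0) =
      real CARD('m) * (2 * of_bool (t = p) * IS (init_cov P) [Mss P K, Mss P K]) + (\<Sum>i\<in>UNIV. k2 i)
      + 2 * IS (init_cov P) [Mss P K] * (\<Sum>i\<in>UNIV. k3 i)
      + real CARD('m) * (8 * of_bool (t = p) * IS (init_cov P) [V0 P K l])
      + 32 * (\<Sum>i\<in>UNIV. (dinv l i)\<^sup>2 * IS (init_cov P) [Vtpi P K l t p i])"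
    unfolding outer sum.distrib sum_distrib_left by (simp add: mult_ac)
  then show ?thesis
    unfolding k2 k3 by (simp add: El1_def El4_def)
qed

lemma bounded_linear_compose_mult:
  "bounded_linear f \<Longrightarrow> bounded_linear (\<lambda>x. A *v f x)" for A :: "real^'a^'b"
  by (rule bounded_linear_compose[OF matrix_vector_mul_bounded_linear])

lemma second_moments:
  fixes P :: "('t::{finite,linorder}, 'n::finite, 'm::finite) lq"
  assumes costs: "transpose (costS P) = costS P" "transpose (costA P) = costA P"
    and psd: "pos_semidef (init_cov P)" and model: "noise_model P l M s0 e"
  shows "has_bochner_integral M (\<lambda>w. (norm (grad_est_K P K l (s0 w) (\<lambda>k. e k w)))\<^sup>2)
      (\<Sum>t<CARD('t). \<Sum>p<CARD('t).
        EK1 P K l t p + EK2 P K l t p + EK3 P K l t p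
        + EK4 P K l t p + EK5 P K l t p + EK6 P K l t p)"
    and "has_bochner_integral M (\<lambda>w. (norm (grad_est_l P K l (s0 w) (\<lambda>k. e k w)))\<^sup>2)
      (\<Sum>t<CARD('t). \<Sum>p<CARD('t).
        El1 P K t p + El2 P K l t p + El3 P K l t p + El4 P K l t p)"
proof -
  note N = noise_model_gaussian_vector[OF model psd]
  let ?R = "\<lambda>x y. quad_form (Mss P K) x + 2 * (x \<bullet> (Mse P K *v y)) + quad_form (Mee P K) y"
  have has_integral: "has_bochner_integral M (\<lambda>w. h (s0 w) (lifted_noise (\<lambda>k. e k w)))
      (\<integral>x. \<integral>y. h x y \<partial>gaussian_law (Sbar P l) \<partial>gaussian_law (init_cov P))"
    if "real_polynomial_function (\<lambda>z. h (fst z) (snd z))" for h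
    using noise_model_expectation[OF model psd that] by (simp add: has_bochner_integral_iff)
  show "has_bochner_integral M (\<lambda>w. (norm (grad_est_K P K l (s0 w) (\<lambda>k. e k w)))\<^sup>2)
      (\<Sum>t<CARD('t). \<Sum>p<CARD('t).
        EK1 P K l t p + EK2 P K l t p + EK3 P K l t p
        + EK4 P K l t p + EK5 P K l t p + EK6 P K l t p)"
    unfolding norm_grad_est_K[OF costs] second_moment_K_term[OF N costs, symmetric]
    by (intro has_bochner_integral_sum has_integral[where h = "\<lambda>x y. quad_form (WK P l _ _) y
      * (quad_form (Gtp P K _ _) x + x \<bullet> (Jtp P K _ _ *v y) + quad_form (Utp P K _ _) y) * (?R x y)\<^sup>2"]
      polynomial_intros bounded_linear_compose_mult bounded_linear_fst bounded_linear_snd)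
  have "has_bochner_integral M (\<lambda>w. (norm (grad_est_l P K l (s0 w) (\<lambda>k. e k w)))\<^sup>2)
      (\<Sum>t<CARD('t). \<Sum>p<CARD('t). \<Sum>i\<in>UNIV.
        \<integral>x. \<integral>y. (dinv l i * quad_form (Qti t i) y - 1) * (dinv l i * quad_form (Qti p i) y - 1)
        * (?R x y)\<^sup>2 \<partial>gaussian_law (Sbar P l) \<partial>gaussian_law (init_cov P))"
    unfolding norm_grad_est_l[OF costs]
    by (intro has_bochner_integral_sum has_integral[where h = "\<lambda>x y.
      (dinv l _ * quad_form (Qti _ _) y - 1) * (dinv l _ * quad_form (Qti _ _) y - 1) * (?R x y)\<^sup>2"]
      polynomial_intros bounded_linear_compose_mult bounded_linear_fst bounded_linear_snd)
  then show "has_bochner_integral M (\<lambda>w. (norm (grad_est_l P K l (s0 w) (\<lambda>k. e k w)))\<^sup>2)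
      (\<Sum>t<CARD('t). \<Sum>p<CARD('t).
        El1 P K t p + El2 P K l t p + El3 P K l t p + El4 P K l t p)"
    by (simp add: second_moment_l_term[OF N costs])
qed


section \<open>State covariances\<close>

lemma (in gaussian_vector) expectation_affine:
  shows "(\<integral>y. c + q \<bullet> y \<partial>N) = c"
    and "(\<integral>y. (c + q \<bullet> y) * (c' + q' \<bullet> y) \<partial>N) = c * c' + q \<bullet> (\<Omega> *v q')"
proof -
  have odd: "(\<integral>y. r * (u \<bullet> y) \<partial>N) = 0" for r u
    by (rule expectation_odd) (auto intro!: polynomial_intros)
  have int: "integrable N (\<lambda>y. r)" "integrable N (\<lambda>y. r * (u \<bullet> y))" "integrable N (\<lambda>y. (u \<bullet> y) * (v \<bullet> y))"
    for r :: real and u v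
    by (intro integrable_polynomial polynomial_intros)+
  have const: "(\<integral>y. r \<partial>N) = r" for r :: real by (simp add: prob_space[simplified])
  show "(\<integral>y. c + q \<bullet> y \<partial>N) = c"
    using Bochner_Integration.integral_add[OF int(1)[of c] int(2)[of 1 q]] odd[of 1 q] const[of c] by simp
  have "(\<integral>y. (c + q \<bullet> y) * (c' + q' \<bullet> y) \<partial>N) =
      (\<integral>y. c * c' + c * (q' \<bullet> y) + c' * (q \<bullet> y) + (q \<bullet> y) * (q' \<bullet> y) \<partial>N)"
    by (simp add: algebra_simps)
  also have "\<dots> = c * c' + q \<bullet> (\<Omega> *v q')"
    by (simp only: Bochner_Integration.integral_add Bochner_Integration.integrable_add int odd const
        expectation_inner2 add_0_right)
  finally show "(\<integral>y. (c + q \<bullet> y) * (c' + q' \<bullet> y) \<partial>N) = c * c' + q \<bullet> (\<Omega> *v q')" .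
qed

lemma matrix_vector_mult_nth: "(A *v x) $ i = A $ i \<bullet> x"
  for A :: "real^'a^'b"
  by (simp add: matrix_vector_mult_def inner_vec_def)

lemma matrix_congruence_nth: "(X ** Q ** transpose X) $ i $ j = X $ i \<bullet> (Q *v X $ j)"
  for X :: "real^'a^'b"
proof -
  have "(X ** Q ** transpose X) $ i $ j = ((X ** Q ** transpose X) *v axis j 1) $ i"
    by (simp add: matrix_vector_mult_basis column_def)
  also have "transpose X *v axis j 1 = X $ j"
    by (simp only: matrix_vector_mult_basis) (simp add: column_def transpose_def vec_eq_iff)
  then have "((X ** Q ** transpose X) *v axis j 1) $ i = X $ i \<bullet> (Q *v X $ j)"
    by (simp only: matrix_vector_mul_assoc[symmetric] matrix_vector_mult_nth)
  finally show ?thesis .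
qed

text \<open>States and actions are both of the form z, so their means and covariances are obtained
  at once.\<close>

lemma noise_model_affine_moments:
  fixes P :: "('t::{finite,linorder}, 'n::finite, 'm::finite) lq"
    and X :: "real^'n^'k" and Y :: "real^('t \<times> 'm)^'k"
  assumes model: "noise_model P l M s0 e" and psd: "pos_semidef (init_cov P)"
  defines "z \<equiv> \<lambda>w. X *v s0 w + Y *v lifted_noise (\<lambda>k. e k w)"
  shows "has_bochner_integral M (\<lambda>w. z w $ i) 0"
    and "has_bochner_integral M (\<lambda>w. z w $ i * z w $ j)
      ((X ** init_cov P ** transpose X + Y ** Sbar P l ** transpose Y) $ i $ j)"
proof -
  interpret N0: gaussian_vector "init_cov P" "gaussian_law (init_cov P)"
    by (rule noise_model_gaussian_vector[OF model psd])
  interpret N1: gaussian_vector "Sbar P l" "gaussian_law (Sbar P l)"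
    by (rule noise_model_gaussian_vector[OF model psd])
  let ?h = "\<lambda>i z. X $ i \<bullet> fst z + Y $ i \<bullet> snd z"
  have nth: "z w $ i = ?h i (s0 w, lifted_noise (\<lambda>k. e k w))" for w i
    by (simp add: z_def matrix_vector_mult_nth)
  have poly: "real_polynomial_function (?h i)" for i
    by (intro polynomial_intros bounded_linear_fst bounded_linear_snd real_polynomial_function.intros(1)
        bounded_linear_inner_right_comp)
  have "(\<integral>x. \<integral>y. ?h i (x, y) \<partial>gaussian_law (Sbar P l) \<partial>gaussian_law (init_cov P)) = 0"
    using N0.expectation_affine(1)[of 0 "X $ i"] by (simp add: N1.expectation_affine)
  then show "has_bochner_integral M (\<lambda>w. z w $ i) 0"
    unfolding nth using noise_model_expectation[OF model psd poly[of i]] by (simp add: has_bochner_integral_iff)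
  have "(\<integral>x. \<integral>y. ?h i (x, y) * ?h j (x, y) \<partial>gaussian_law (Sbar P l) \<partial>gaussian_law (init_cov P)) =
      (X ** init_cov P ** transpose X + Y ** Sbar P l ** transpose Y) $ i $ j"
  proof -
    have "integrable (gaussian_law (init_cov P)) (\<lambda>x. (X $ i \<bullet> x) * (X $ j \<bullet> x))"
      by (intro N0.integrable_polynomial polynomial_intros)
    then show ?thesis
      by (simp add: N1.expectation_affine N0.expectation_inner2 matrix_congruence_nth N0.prob_space[simplified])
  qed
  then show "has_bochner_integral M (\<lambda>w. z w $ i * z w $ j)
      ((X ** init_cov P ** transpose X + Y ** Sbar P l ** transpose Y) $ i $ j)"
    unfolding nth
    using noise_model_expectation[OF model psd real_polynomial_function.intros(4)[OF poly[of i] poly[of j]]]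
    by (simp add: has_bochner_integral_iff)
qed

lemma noise_model_expectation_quad_form:
  fixes P :: "('t::{finite,linorder}, 'n::finite, 'm::finite) lq"
    and X :: "real^'n^'k" and Y :: "real^('t \<times> 'm)^'k"
  assumes model: "noise_model P l M s0 e" and psd: "pos_semidef (init_cov P)"
  shows "has_bochner_integral M (\<lambda>w. quad_form Q (X *v s0 w + Y *v lifted_noise (\<lambda>k. e k w)))
      (Q \<bullet> (X ** init_cov P ** transpose X + Y ** Sbar P l ** transpose Y))"
    (is "has_bochner_integral M (\<lambda>w. quad_form Q (?z w)) (Q \<bullet> ?V)")
proof -
  have "has_bochner_integral M (\<lambda>w. \<Sum>i\<in>UNIV. \<Sum>j\<in>UNIV. Q $ i $ j * (?z w $ i * ?z w $ j))
      (\<Sum>i\<in>UNIV. \<Sum>j\<in>UNIV. Q $ i $ j * ?V $ i $ j)"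
    by (intro has_bochner_integral_sum has_bochner_integral_mult_right noise_model_affine_moments[OF assms])
  moreover have "quad_form Q z = (\<Sum>i\<in>UNIV. \<Sum>j\<in>UNIV. Q $ i $ j * (z $ i * z $ j))" for z
    by (simp add: quad_form_def inner_vec_def matrix_vector_mult_def sum_distrib_left mult_ac)
  ultimately show ?thesis by (simp add: inner_vec_def)
qed

section \<open>The covariance recursion and the objective\<close>

lemma bounded_bilinear_matrix_mult: "bounded_bilinear ((**) :: real^'a^'b \<Rightarrow> real^'c^'a \<Rightarrow> real^'c^'b)"
  unfolding bilinear_conv_bounded_bilinear[symmetric] bilinear_def
  by (auto intro!: linearI simp: vec_eq_iff matrix_matrix_mult_def algebra_simps sum.distrib sum_distrib_left)

lemmas matrix_mult_simps =
  bounded_bilinear.add_left[OF bounded_bilinear_matrix_mult]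
  bounded_bilinear.add_right[OF bounded_bilinear_matrix_mult]
  bounded_bilinear.diff_left[OF bounded_bilinear_matrix_mult]
  bounded_bilinear.diff_right[OF bounded_bilinear_matrix_mult]
  bounded_bilinear.scaleR_left[OF bounded_bilinear_matrix_mult]
  bounded_bilinear.scaleR_right[OF bounded_bilinear_matrix_mult]
  bounded_bilinear.zero_left[OF bounded_bilinear_matrix_mult]
  bounded_bilinear.zero_right[OF bounded_bilinear_matrix_mult]

lemma bounded_linear_transpose: "bounded_linear (transpose :: real^'a^'b \<Rightarrow> real^'b^'a)"
  unfolding linear_conv_bounded_linear[symmetric]
  by (auto intro!: linearI simp: transpose_add transpose_scalar)

text \<open>The recursion for P_t serves as a definition for all K and l, so that the objective can
  be differentiated without reference to a probability space.\<close>

primrec state_cov ::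
  "('t::{finite,linorder}, 'n::finite, 'm::finite) lq \<Rightarrow> real^'n^'m \<Rightarrow> real^'m \<Rightarrow> nat \<Rightarrow> real^'n^'n" where
  "state_cov P K l 0 = init_cov P"
| "state_cov P K l (Suc t) = Fcl P K ** state_cov P K l t ** transpose (Fcl P K)
    + dynB P ** noise_cov l ** transpose (dynB P)"

lemma Pi_sel_mult_transpose:
  assumes "t < CARD('t)" "p < CARD('t)"
  shows "Pi_sel t *v (transpose (Pi_sel p :: real^('t::{finite,linorder} \<times> 'm::finite)^'m) *v v) = (if t = p then v else 0)"
proof -
  obtain k :: 't where k: "t = step k" using assms(1) by (rule step_cases)
  obtain j :: 't where j: "p = step j" using assms(2) by (rule step_cases)
  have "(transpose (Pi_sel p :: real^('t \<times> 'm)^'m) *v v) $ (k, r) = (if k = j then v $ r else 0)" for r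
    by (simp add: j matrix_vector_mult_nth inner_vec_def transpose_def Pi_sel_def if_distrib[of "\<lambda>c. c * _"]
        del: transpose_matrix_vector cong: if_cong)
  then show ?thesis
    by (simp add: vec_eq_iff k j del: transpose_matrix_vector)
qed

lemma Pi_sel_Sbar_Pi_sel:
  fixes P :: "('t::{finite,linorder}, 'n::finite, 'm::finite) lq"
  assumes "t < CARD('t)" "p < CARD('t)"
  shows "Pi_sel t ** Sbar P l ** transpose (Pi_sel p) = (if t = p then noise_cov l else 0)"
  unfolding matrix_eq
  using assms by (simp add: matrix_vector_mul_assoc[symmetric] Pi_sel_Sbar_mult Pi_sel_mult_transpose
      del: transpose_matrix_vector)

text \<open>The state at time t depends only on earlier noise, hence is uncorrelated with the noise
  at any time p \<ge> t.\<close>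

lemma Et_Sbar_Pi_sel:
  fixes P :: "('t::{finite,linorder}, 'n::finite, 'm::finite) lq"
  assumes "t \<le> p" "p < CARD('t)"
  shows "Et P K t ** Sbar P l ** transpose (Pi_sel p) = 0"
  using assms(1)
proof (induction t)
  case 0
  have "Et P K 0 = 0" by (simp add: Et_def vec_eq_iff)
  then show ?case by (simp add: matrix_mult_simps)
next
  case (Suc t)
  have "Et P K (Suc t) ** Sbar P l ** transpose (Pi_sel p) =
      Fcl P K ** (Et P K t ** Sbar P l ** transpose (Pi_sel p)) + dynB P ** (Pi_sel t ** Sbar P l ** transpose (Pi_sel p))"
    by (simp add: Et_Suc matrix_mult_simps matrix_mul_assoc)
  also have "\<dots> = 0"
    using Suc assms(2) by (simp add: Pi_sel_Sbar_Pi_sel matrix_mult_simps)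
  finally show ?case .
qed

lemma Pi_sel_Sbar_Et:
  fixes P :: "('t::{finite,linorder}, 'n::finite, 'm::finite) lq"
  assumes "t \<le> p" "p < CARD('t)"
  shows "Pi_sel p ** Sbar P l ** transpose (Et P K t) = 0"
proof -
  have "transpose (Et P K t ** Sbar P l ** transpose (Pi_sel p)) = transpose 0"
    by (simp add: Et_Sbar_Pi_sel[OF assms])
  moreover have "transpose (0 :: real^'m^'n) = 0" by (simp add: vec_eq_iff transpose_def)
  ultimately show ?thesis
    by (simp add: matrix_transpose_mul transpose_Sbar matrix_mul_assoc)
qed

text \<open>In the expansion by \<open>Et_Suc\<close> the mixed terms are the correlations of s_t
  with the noise at time t, which vanish.\<close>

lemma state_cov_eq:
  fixes P :: "('t::{finite,linorder}, 'n::finite, 'm::finite) lq"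
  assumes "t \<le> CARD('t)"
  shows "state_cov P K l t =
    Ft P K t ** init_cov P ** transpose (Ft P K t) + Et P K t ** Sbar P l ** transpose (Et P K t)"
  using assms
proof (induction t)
  case 0
  have "Et P K 0 = 0" by (simp add: Et_def vec_eq_iff)
  then show ?case by (simp add: Ft_def matrix_mult_simps)
next
  case (Suc t)
  let ?F = "Fcl P K" and ?B = "dynB P" and ?S = "Sbar P l" and ?Pi = "Pi_sel t :: real^('t \<times> 'm)^'m"
  have "Et P K (Suc t) ** ?S ** transpose (Et P K (Suc t)) =
      ?F ** (Et P K t ** ?S ** transpose (Et P K t)) ** transpose ?F
      + ?F ** (Et P K t ** ?S ** transpose ?Pi) ** transpose ?B
      + ?B ** (?Pi ** ?S ** transpose (Et P K t)) ** transpose ?F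
      + ?B ** (?Pi ** ?S ** transpose ?Pi) ** transpose ?B"
    by (simp add: Et_Suc matrix_mult_simps transpose_add matrix_transpose_mul matrix_mul_assoc algebra_simps)
  also have "\<dots> = ?F ** (Et P K t ** ?S ** transpose (Et P K t)) ** transpose ?F
      + ?B ** noise_cov l ** transpose ?B"
    using Suc.prems
    by (simp add: Et_Sbar_Pi_sel Pi_sel_Sbar_Et Pi_sel_Sbar_Pi_sel matrix_mult_simps)
  finally show ?case
    using Suc by (simp add: Ft_def matrix_mult_simps matrix_transpose_mul matrix_mul_assoc)
qed

text \<open>The covariance of a_t = K s_t + \<epsilon>_t; again the mixed terms vanish.\<close>

lemma action_cov_eq:
  fixes P :: "('t::{finite,linorder}, 'n::finite, 'm::finite) lq"
  assumes "t < CARD('t)"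
  shows "(K ** Ft P K t) ** init_cov P ** transpose (K ** Ft P K t)
      + (K ** Et P K t + Pi_sel t) ** Sbar P l ** transpose (K ** Et P K t + Pi_sel t)
    = K ** state_cov P K l t ** transpose K + noise_cov l"
proof -
  let ?S = "Sbar P l" and ?Pi = "Pi_sel t :: real^('t \<times> 'm)^'m"
  have "(K ** Et P K t + ?Pi) ** ?S ** transpose (K ** Et P K t + ?Pi) =
      K ** (Et P K t ** ?S ** transpose (Et P K t)) ** transpose K
      + K ** (Et P K t ** ?S ** transpose ?Pi)
      + (?Pi ** ?S ** transpose (Et P K t)) ** transpose K
      + ?Pi ** ?S ** transpose ?Pi"
    by (simp add: matrix_mult_simps transpose_add matrix_transpose_mul matrix_mul_assoc algebra_simps)
  also have "\<dots> = K ** (Et P K t ** ?S ** transpose (Et P K t)) ** transpose K + noise_cov l"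
    using assms by (simp add: Et_Sbar_Pi_sel Pi_sel_Sbar_Et Pi_sel_Sbar_Pi_sel matrix_mult_simps)
  finally show ?thesis
    using assms by (simp add: state_cov_eq matrix_mult_simps matrix_transpose_mul matrix_mul_assoc)
qed

lemma covariance_state:
  fixes P :: "('t::{finite,linorder}, 'n::finite, 'm::finite) lq"
  assumes model: "noise_model P l M s0 e" and psd: "pos_semidef (init_cov P)" and t: "t \<le> CARD('t)"
  shows "covariance M (\<lambda>w. state P K (s0 w) (\<lambda>k. e k w) t) = state_cov P K l t"
proof -
  have "(\<integral>w. state P K (s0 w) (\<lambda>k. e k w) t $ i \<partial>M) = 0"
    "(\<integral>w. state P K (s0 w) (\<lambda>k. e k w) t $ i * state P K (s0 w) (\<lambda>k. e k w) t $ j \<partial>M) = state_cov P K l t $ i $ j" for i j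
    unfolding state_eq[OF t] state_cov_eq[OF t]
    by (intro has_bochner_integral_integral_eq noise_model_affine_moments[OF model psd])+
  then show ?thesis
    by (simp add: covariance_def vec_eq_iff)
qed

text \<open>The mean of a quadratic form in a centred vector is the Frobenius product of its matrix
  with the covariance, so J depends on K and l only through explicit matrices.\<close>

lemma objective_eq:
  fixes P :: "('t::{finite,linorder}, 'n::finite, 'm::finite) lq"
  assumes model: "\<And>l. noise_model P l (M l) (s0 l) (e l)" and psd: "pos_semidef (init_cov P)"
  shows "objective P M s0 e K l = - (\<Sum>t<CARD('t). disc P ^ t *
    (costS P \<bullet> state_cov P K l (Suc t) + costA P \<bullet> (K ** state_cov P K l t ** transpose K + noise_cov l)))"
proof -
  have S: "has_bochner_integral (M l) (\<lambda>w. quad_form (costS P) (state P K (s0 l w) (\<lambda>k. e l k w) (Suc t)))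
      (costS P \<bullet> state_cov P K l (Suc t))" if "t < CARD('t)" for t
    unfolding state_eq[OF Suc_leI[OF that]] state_cov_eq[OF Suc_leI[OF that]]
    by (rule noise_model_expectation_quad_form[OF model psd])
  have A: "has_bochner_integral (M l) (\<lambda>w. quad_form (costA P) (action P K (s0 l w) (\<lambda>k. e l k w) t))
      (costA P \<bullet> (K ** state_cov P K l t ** transpose K + noise_cov l))" if "t < CARD('t)" for t
    unfolding action_eq[OF that] action_cov_eq[OF that, symmetric]
    by (rule noise_model_expectation_quad_form[OF model psd])
  have "has_bochner_integral (M l) (\<lambda>w. total_return P K (s0 l w) (\<lambda>k. e l k w))
      (\<Sum>t<CARD('t). disc P ^ t * - (costS P \<bullet> state_cov P K l (Suc t)
        + costA P \<bullet> (K ** state_cov P K l t ** transpose K + noise_cov l)))"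
    unfolding total_return_def reward_def
    by (intro has_bochner_integral_sum has_bochner_integral_mult_right has_bochner_integral_minus
        has_bochner_integral_add S A) auto
  then show ?thesis
    by (simp only: objective_def has_bochner_integral_iff mult_minus_right sum_negf)
qed

section \<open>Gradients of the objective\<close>

lemma inner_transpose_transpose: "transpose X \<bullet> transpose Y = X \<bullet> (Y :: real^'a^'b)"
  by (simp add: inner_vec_def transpose_def) (rule sum.swap)

lemma inner_matrix_mult_left: "(X ** Y) \<bullet> Z = Y \<bullet> (transpose X ** Z)"
  for X :: "real^'a^'b" and Y :: "real^'c^'a"
proof -
  have "(X ** Y) \<bullet> Z = (\<Sum>i\<in>UNIV. \<Sum>j\<in>UNIV. \<Sum>k\<in>UNIV. X $ i $ k * Y $ k $ j * Z $ i $ j)"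
    by (simp add: inner_vec_def matrix_matrix_mult_def sum_distrib_right)
  also have "\<dots> = (\<Sum>i\<in>UNIV. \<Sum>k\<in>UNIV. \<Sum>j\<in>UNIV. X $ i $ k * Y $ k $ j * Z $ i $ j)"
    by (intro sum.cong refl, rule sum.swap)
  also have "\<dots> = (\<Sum>k\<in>UNIV. \<Sum>i\<in>UNIV. \<Sum>j\<in>UNIV. X $ i $ k * Y $ k $ j * Z $ i $ j)"
    by (rule sum.swap)
  also have "\<dots> = (\<Sum>k\<in>UNIV. \<Sum>j\<in>UNIV. \<Sum>i\<in>UNIV. X $ i $ k * Y $ k $ j * Z $ i $ j)"
    by (intro sum.cong refl, rule sum.swap)
  also have "\<dots> = Y \<bullet> (transpose X ** Z)"
    by (simp add: inner_vec_def matrix_matrix_mult_def transpose_def sum_distrib_left mult_ac)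
  finally show ?thesis .
qed

lemma inner_matrix_mult_right: "(X ** Y) \<bullet> Z = X \<bullet> (Z ** transpose Y)"
  for X :: "real^'a^'b" and Y :: "real^'c^'a"
proof -
  have "(X ** Y) \<bullet> Z = (transpose Y ** transpose X) \<bullet> transpose Z"
    by (simp add: matrix_transpose_mul[symmetric] inner_transpose_transpose)
  also have "\<dots> = transpose X \<bullet> transpose (Z ** transpose Y)"
    by (simp add: inner_matrix_mult_left matrix_transpose_mul)
  finally show ?thesis by (simp add: inner_transpose_transpose)
qed

text \<open>The forward map V \<mapsto> X V X^T and the backward map Q \<mapsto> X^T Q X are
  adjoint: this is the duality between the recursions for P_t and \<Lambda>_t.\<close>

lemma inner_congruence: "Q \<bullet> (X ** V ** transpose X) = (transpose X ** Q ** X) \<bullet> V"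
  for X :: "real^'a^'b"
proof -
  have "Q \<bullet> (X ** V ** transpose X) = (X ** V) \<bullet> (Q ** X)"
    by (subst inner_commute) (simp add: inner_matrix_mult_right[of "X ** V"])
  also have "\<dots> = (transpose X ** Q ** X) \<bullet> V"
    by (simp add: inner_matrix_mult_left[of X V] inner_commute matrix_mul_assoc)
  finally show ?thesis .
qed

lemma has_derivative_congruence:
  fixes X :: "'a::real_normed_vector \<Rightarrow> real^'b^'c"
  assumes "(X has_derivative X') (at x)"
  shows "((\<lambda>k. transpose (X k) ** Q ** X k) has_derivative
    (\<lambda>h. transpose (X x) ** Q ** X' h + transpose (X' h) ** Q ** X x)) (at x)"
  by (intro bounded_bilinear.FDERIV[OF bounded_bilinear_matrix_mult] assms
      bounded_linear.has_derivative[OF bounded_bilinear.bounded_linear_left[OF bounded_bilinear_matrix_mult]]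
      bounded_linear.has_derivative[OF bounded_linear_transpose])

text \<open>The two halves are transposes of each other and pair equally with a symmetric V, whence
  the factor 2 in the gradient.\<close>

lemma inner_congruence_derivative:
  fixes X D :: "real^'a^'b"
  assumes "transpose Q = Q" "transpose V = V"
  shows "(transpose X ** Q ** D + transpose D ** Q ** X) \<bullet> V = 2 * (D \<bullet> (Q ** X ** V))"
proof -
  have 1: "(transpose X ** Q ** D) \<bullet> V = D \<bullet> (Q ** X ** V)"
    by (simp add: inner_matrix_mult_left[of "transpose X ** Q"] matrix_transpose_mul assms)
  have "(transpose D ** Q ** X) \<bullet> V = transpose (transpose X ** Q ** D) \<bullet> transpose V"
    by (simp add: matrix_transpose_mul assms matrix_mul_assoc)
  then show ?thesis by (simp add: inner_add_left 1 inner_transpose_transpose)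
qed

lemma has_derivative_Fcl: "(Fcl P has_derivative (\<lambda>h. dynB P ** h)) (at K)"
proof -
  have "((\<lambda>K. dynA P + dynB P ** K) has_derivative (\<lambda>h. 0 + dynB P ** h)) (at K)"
    by (intro has_derivative_add has_derivative_const has_derivative_ident
        bounded_linear.has_derivative[OF bounded_bilinear.bounded_linear_right[OF bounded_bilinear_matrix_mult]])
  then show ?thesis by (simp add: Fcl_def[abs_def])
qed

text \<open>The product rule in the gradient proof asks for some derivative; its value is left open
  because its coefficient there is 0.\<close>

lemma has_derivative_state_cov:
  "\<exists>D. ((\<lambda>K. state_cov P K l t) has_derivative D) (at K)"
proof (induction t)
  case 0
  show ?case by (auto intro!: exI has_derivative_const)
next
  case (Suc t)
  then obtain D where "((\<lambda>K. state_cov P K l t) has_derivative D) (at K)" by blast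
  note bounded_bilinear.FDERIV[OF bounded_bilinear_matrix_mult
      bounded_bilinear.FDERIV[OF bounded_bilinear_matrix_mult has_derivative_Fcl this]
      bounded_linear.has_derivative[OF bounded_linear_transpose has_derivative_Fcl]]
  from has_derivative_add[OF this has_derivative_const] show ?case by auto
qed

lemma transpose_state_cov:
  assumes "transpose (init_cov P) = init_cov P"
  shows "transpose (state_cov P K l t) = state_cov P K l t"
  using assms by (induction t)
    (simp_all add: transpose_add matrix_transpose_mul transpose_noise_cov matrix_mul_assoc)

text \<open>\<open>H t\<close> is \<Lambda>_t - Q_s/\<gamma> where the backward recursion holds, and
  it extends this matrix to t = 0, where \<open>\<Lambda>\<close> is unconstrained. The term with
  \<open>noise_cov\<close> contains B but not K', so the dependence on K' is confined to the middle
  sum.\<close>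

lemma cost_difference:
  fixes P :: "('t::{finite,linorder}, 'n::finite, 'm::finite) lq"
    and K :: "real^'n^'m" and \<Lambda> :: "nat \<Rightarrow> real^'n^'n"
  defines "H \<equiv> \<lambda>t. transpose K ** costA P ** K + disc P *\<^sub>R (transpose (Fcl P K) ** \<Lambda> (t + 1) ** Fcl P K)"
  assumes disc: "0 < disc P"
    and Lambda_T: "\<Lambda> CARD('t) = (1 / disc P) *\<^sub>R costS P"
    and Lambda_step: "\<And>t. 1 \<le> t \<Longrightarrow> t \<le> CARD('t) - 1 \<Longrightarrow> \<Lambda> t = (1 / disc P) *\<^sub>R costS P + H t"
  shows "(\<Sum>t<CARD('t). disc P ^ t *
      (costS P \<bullet> state_cov P K' l (Suc t) + costA P \<bullet> (K' ** state_cov P K' l t ** transpose K' + noise_cov l))) =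
    H 0 \<bullet> init_cov P
    + (\<Sum>t<CARD('t). disc P ^ t * ((transpose K' ** costA P ** K'
        + disc P *\<^sub>R (transpose (Fcl P K') ** \<Lambda> (t + 1) ** Fcl P K') - H t) \<bullet> state_cov P K' l t))
    + (\<Sum>t<CARD('t). disc P ^ t *\<^sub>R (costA P + disc P *\<^sub>R (transpose (dynB P) ** \<Lambda> (t + 1) ** dynB P))) \<bullet> noise_cov l"
proof -
  let ?\<gamma> = "disc P" and ?V = "state_cov P K' l" and ?F = "Fcl P K'" and ?B = "dynB P"
  \<comment> \<open>At t = T the matrix \<open>H T\<close> would involve
    \<open>\<Lambda> (T + 1)\<close>, which is arbitrary. The value 0 is \<Lambda>_T - Q_s/\<gamma>
    by the terminal condition, and it ends the telescoping sum in 0.\<close>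
  define h where "h t = ?\<gamma> ^ t * ((if t < CARD('t) then H t else 0) \<bullet> ?V t)" for t
  have summand: "?\<gamma> ^ t * (costS P \<bullet> ?V (Suc t) + costA P \<bullet> (K' ** ?V t ** transpose K' + noise_cov l)) =
      ?\<gamma> ^ t * ((transpose K' ** costA P ** K' + ?\<gamma> *\<^sub>R (transpose ?F ** \<Lambda> (t + 1) ** ?F) - H t) \<bullet> ?V t)
      + (?\<gamma> ^ t *\<^sub>R (costA P + ?\<gamma> *\<^sub>R (transpose ?B ** \<Lambda> (t + 1) ** ?B))) \<bullet> noise_cov l
      - (h (Suc t) - h t)" if t: "t < CARD('t)" for t
  proof -
    have V: "\<Lambda> (Suc t) \<bullet> ?V (Suc t) = (transpose ?F ** \<Lambda> (Suc t) ** ?F) \<bullet> ?V t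
        + (transpose ?B ** \<Lambda> (Suc t) ** ?B) \<bullet> noise_cov l"
      by (simp add: inner_add_right inner_congruence)
    \<comment> \<open>The recursion and the terminal condition in one formula; only indices from 1
      to T occur.\<close>
    have "\<Lambda> (Suc t) = (1 / ?\<gamma>) *\<^sub>R costS P + (if Suc t < CARD('t) then H (Suc t) else 0)"
      using Lambda_step[of "Suc t"] Lambda_T t by (cases "Suc t = CARD('t)") auto
    \<comment> \<open>The cost of s_{t+1} carries the weight \<gamma>^t, one power less than
      \<Lambda>_{t+1} does in h; this is the reason for 1/\<gamma> in the recursion.\<close>
    then have "?\<gamma> *\<^sub>R \<Lambda> (Suc t) = costS P + ?\<gamma> *\<^sub>R (if Suc t < CARD('t) then H (Suc t) else 0)"
      using disc by (simp add: scaleR_add_right)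
    then have "?\<gamma> * (\<Lambda> (Suc t) \<bullet> ?V (Suc t)) =
        (costS P + ?\<gamma> *\<^sub>R (if Suc t < CARD('t) then H (Suc t) else 0)) \<bullet> ?V (Suc t)"
      by (metis inner_scaleR_left)
    then have "h (Suc t) = ?\<gamma> ^ t * (?\<gamma> * (\<Lambda> (Suc t) \<bullet> ?V (Suc t)) - costS P \<bullet> ?V (Suc t))"
      by (simp add: h_def inner_add_left algebra_simps del: state_cov.simps)
    then show ?thesis
      using t unfolding V
      by (simp add: h_def inner_add_left inner_add_right inner_diff_left inner_congruence algebra_simps
          del: state_cov.simps)
  qed
  have "(\<Sum>t<CARD('t). h (Suc t) - h t) = - (H 0 \<bullet> init_cov P)"
    by (subst sum_lessThan_telescope) (simp add: h_def)
  then show ?thesis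
    by (simp add: summand sum.distrib sum_subtractf inner_sum_left del: state_cov.simps)
qed

text \<open>Only the diagonal of G meets the diagonal \<Sigma>, and exp(2 l_i) reproduces itself
  with the factor 2.\<close>

lemma GDERIV_noise_cov: "GDERIV (\<lambda>l. G \<bullet> noise_cov l) l :> 2 *\<^sub>R diag_vec (noise_cov l ** G)"
proof -
  have eq: "G \<bullet> noise_cov l = (\<Sum>i\<in>UNIV. G $ i $ i * (exp (l $ i))\<^sup>2)" for l
    by (simp add: inner_vec_def noise_cov_def diag_mat_def if_distrib[of "\<lambda>c. _ * c"] cong: if_cong)
  have diag: "(noise_cov l ** G) $ i $ i = (exp (l $ i))\<^sup>2 * G $ i $ i" for i
    by (simp add: matrix_matrix_mult_def noise_cov_def diag_mat_def if_distrib[of "\<lambda>c. c * _"] cong: if_cong)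
  have "((\<lambda>l. \<Sum>i\<in>UNIV. G $ i $ i * (exp (l $ i))\<^sup>2) has_derivative
      (\<lambda>h. \<Sum>i\<in>UNIV. h $ i * (2 * ((exp (l $ i))\<^sup>2 * G $ i $ i)))) (at l)"
    by (auto intro!: derivative_eq_intros bounded_linear.has_derivative[OF bounded_linear_vec_nth]
        simp: power2_eq_square mult_ac)
  then show ?thesis
    unfolding gderiv_def eq by (simp add: inner_vec_def diag_vec_def diag)
qed
theorem theorem6:
  fixes P :: "('t::{finite,linorder}, 'n::finite, 'm::finite) lq"
    and K :: "real^'n^'m" and l :: "real^'m"
    and M :: "real^'m \<Rightarrow> 'w measure"
    and s0 :: "real^'m \<Rightarrow> 'w \<Rightarrow> real^'n"
    and e :: "real^'m \<Rightarrow> nat \<Rightarrow> 'w \<Rightarrow> real^'m"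
    and \<Lambda> :: "nat \<Rightarrow> real^'n^'n"
    and Pcov :: "nat \<Rightarrow> real^'n^'n"
  assumes "pos_semidef (costS P)" and "pos_semidef (costA P)" and "pos_semidef (init_cov P)"
    and "0 < disc P" and "disc P \<le> 1"
    and model: "\<And>l'. noise_model P l' (M l') (s0 l') (e l')"
    and Pcov: "\<And>t. t \<le> CARD('t) \<Longrightarrow>
      Pcov t = covariance (M l) (\<lambda>w. state P K (s0 l w) (\<lambda>k. e l k w) t)"
    and Lambda_T: "\<Lambda> CARD('t) = (1 / disc P) *\<^sub>R costS P"
    and Lambda_step: "\<And>t. 1 \<le> t \<Longrightarrow> t \<le> CARD('t) - 1 \<Longrightarrow>
      \<Lambda> t = (1 / disc P) *\<^sub>R costS P + transpose K ** costA P ** K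
        + disc P *\<^sub>R (transpose (Fcl P K) ** \<Lambda> (t + 1) ** Fcl P K)"
  shows "has_bochner_integral (M l)
      (\<lambda>w. (norm (grad_est_K P K l (s0 l w) (\<lambda>k. e l k w)))\<^sup>2)
      (\<Sum>t<CARD('t). \<Sum>p<CARD('t).
        EK1 P K l t p + EK2 P K l t p + EK3 P K l t p
        + EK4 P K l t p + EK5 P K l t p + EK6 P K l t p)
    \<and> has_bochner_integral (M l)
      (\<lambda>w. (norm (grad_est_l P K l (s0 l w) (\<lambda>k. e l k w)))\<^sup>2)
      (\<Sum>t<CARD('t). \<Sum>p<CARD('t).
        El1 P K t p + El2 P K l t p + El3 P K l t p + El4 P K l t p)
    \<and> Pcov 0 = init_cov P
    \<and> (\<forall>t<CARD('t). Pcov (t + 1) =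
        Fcl P K ** Pcov t ** transpose (Fcl P K) + dynB P ** noise_cov l ** transpose (dynB P))
    \<and> GDERIV (\<lambda>K'. objective P M s0 e K' l) K :>
        ((-2) *\<^sub>R (\<Sum>t<CARD('t). disc P ^ t *\<^sub>R
          (costA P ** K ** Pcov t
           + disc P *\<^sub>R (transpose (dynB P) ** \<Lambda> (t + 1) ** Fcl P K ** Pcov t))))
    \<and> GDERIV (\<lambda>l'. objective P M s0 e K l') l :>
        ((-2) *\<^sub>R diag_vec (noise_cov l ** (\<Sum>t<CARD('t). disc P ^ t *\<^sub>R
          (costA P + disc P *\<^sub>R (transpose (dynB P) ** \<Lambda> (t + 1) ** dynB P)))))"
proof -
  define G where "G = (\<Sum>t<CARD('t). disc P ^ t *\<^sub>R (costA P + disc P *\<^sub>R (transpose (dynB P) ** \<Lambda> (t + 1) ** dynB P)))"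
  define H where "H t = transpose K ** costA P ** K + disc P *\<^sub>R (transpose (Fcl P K) ** \<Lambda> (t + 1) ** Fcl P K)" for t
  have costs: "transpose (costS P) = costS P" "transpose (costA P) = costA P"
    and init: "transpose (init_cov P) = init_cov P"
    using assms(1-3) by (simp_all add: pos_semidef_def)
  have objective: "objective P M s0 e K' l' = - (H 0 \<bullet> init_cov P
    + (\<Sum>t<CARD('t). disc P ^ t * ((transpose K' ** costA P ** K'
        + disc P *\<^sub>R (transpose (Fcl P K') ** \<Lambda> (t + 1) ** Fcl P K') - H t) \<bullet> state_cov P K' l' t))
    + G \<bullet> noise_cov l')" for K' l'
    unfolding objective_eq[OF model assms(3)] H_def G_def
    by (subst cost_difference[where K = K and \<Lambda> = \<Lambda>]) (use assms(4) Lambda_T Lambda_step in \<open>auto simp: add.assoc\<close>)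
  have cov: "Pcov t = state_cov P K l t" if "t \<le> CARD('t)" for t
    using Pcov[OF that] covariance_state[OF model assms(3) that] by simp
  \<comment> \<open>Backward induction in the distance k to the horizon; k < T keeps the index in
    1..T. Symmetry of \<Lambda> is required by \<open>inner_congruence_derivative\<close>.\<close>
  have Lambda_sym: "transpose (\<Lambda> (CARD('t) - k)) = \<Lambda> (CARD('t) - k)" if "k < CARD('t)" for k
    using that
  proof (induction k)
    case 0
    show ?case by (simp add: Lambda_T transpose_scalar costs)
  next
    case (Suc k)
    then have "CARD('t) - Suc k + 1 = CARD('t) - k" by simp
    then have "\<Lambda> (CARD('t) - Suc k) = (1 / disc P) *\<^sub>R costS P + transpose K ** costA P ** K
        + disc P *\<^sub>R (transpose (Fcl P K) ** \<Lambda> (CARD('t) - k) ** Fcl P K)"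
      using Lambda_step[of "CARD('t) - Suc k"] Suc.prems by simp
    with Suc show ?case
      by (simp add: transpose_add transpose_scalar matrix_transpose_mul matrix_mul_assoc costs)
  qed
  have GK: "GDERIV (\<lambda>K'. objective P M s0 e K' l) K :>
        ((-2) *\<^sub>R (\<Sum>t<CARD('t). disc P ^ t *\<^sub>R
          (costA P ** K ** Pcov t
           + disc P *\<^sub>R (transpose (dynB P) ** \<Lambda> (t + 1) ** Fcl P K ** Pcov t))))"
  proof -
    let ?D = "\<lambda>t K'. transpose K' ** costA P ** K'
      + disc P *\<^sub>R (transpose (Fcl P K') ** \<Lambda> (t + 1) ** Fcl P K') - H t"
    let ?g = "\<lambda>t. costA P ** K ** Pcov t + disc P *\<^sub>R (transpose (dynB P) ** \<Lambda> (t + 1) ** Fcl P K ** Pcov t)"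
    have "((\<lambda>K'. ?D t K' \<bullet> state_cov P K' l t) has_derivative (\<lambda>h. 2 * (h \<bullet> ?g t))) (at K)"
      if t: "t < CARD('t)" for t
    proof -
      obtain V' where V': "((\<lambda>K'. state_cov P K' l t) has_derivative V') (at K)"
        using has_derivative_state_cov by blast
      let ?F = "Fcl P K" and ?B = "dynB P" and ?L = "\<Lambda> (t + 1)"
      have L: "transpose ?L = ?L" using Lambda_sym[of "CARD('t) - (t + 1)"] t by simp
      have V: "transpose (Pcov t) = Pcov t" using t by (simp add: cov transpose_state_cov[OF init])
      let ?D' = "\<lambda>h. (transpose K ** costA P ** h + transpose h ** costA P ** K)
          + disc P *\<^sub>R (transpose ?F ** ?L ** (?B ** h) + transpose (?B ** h) ** ?L ** ?F) - 0"
      have "(?D t has_derivative ?D') (at K)"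
        by (intro has_derivative_diff has_derivative_add has_derivative_const has_derivative_congruence
            has_derivative_scaleR_right has_derivative_ident has_derivative_Fcl)
      from has_derivative_inner[OF this V']
      have "((\<lambda>K'. ?D t K' \<bullet> state_cov P K' l t) has_derivative
          (\<lambda>h. ?D t K \<bullet> V' h + ?D' h \<bullet> state_cov P K l t)) (at K)" .
      \<comment> \<open>This removes the unknown \<open>V'\<close> from the product rule.\<close>
      moreover have "?D t K = 0" by (simp add: H_def)
      moreover have "?D' h \<bullet> state_cov P K l t = 2 * (h \<bullet> ?g t)" for h
      proof -
        have "?D' h \<bullet> Pcov t = 2 * (h \<bullet> (costA P ** K ** Pcov t)) + disc P * (2 * ((?B ** h) \<bullet> (?L ** ?F ** Pcov t)))"
          by (simp only: diff_0_right inner_add_left[of "_ + _" "_ *\<^sub>R _"] inner_scaleR_left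
              inner_congruence_derivative[OF costs(2) V] inner_congruence_derivative[OF L V])
        then show ?thesis
          using t by (simp add: cov inner_matrix_mult_left inner_add_right matrix_mul_assoc)
      qed
      ultimately show ?thesis by simp
    qed
    then have "((\<lambda>K'. - (H 0 \<bullet> init_cov P + (\<Sum>t<CARD('t). disc P ^ t * (?D t K' \<bullet> state_cov P K' l t)) + G \<bullet> noise_cov l))
        has_derivative (\<lambda>h. - (0 + (\<Sum>t<CARD('t). disc P ^ t * (2 * (h \<bullet> ?g t))) + 0))) (at K)"
      by (intro has_derivative_minus has_derivative_add has_derivative_const has_derivative_sum
          has_derivative_mult_right) auto
    moreover have "- (0 + (\<Sum>t<CARD('t). disc P ^ t * (2 * (h \<bullet> ?g t))) + 0) =
        h \<bullet> ((-2) *\<^sub>R (\<Sum>t<CARD('t). disc P ^ t *\<^sub>R ?g t))" for h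
      unfolding inner_scaleR_right inner_sum_right by (simp add: sum_distrib_left sum_negf mult_ac)
    ultimately show ?thesis
      unfolding gderiv_def objective by (simp only:)
  qed
  have Gl: "GDERIV (\<lambda>l'. objective P M s0 e K l') l :> ((-2) *\<^sub>R diag_vec (noise_cov l ** G))"
  proof -
    \<comment> \<open>For K' = K every summand vanishes whatever l' is, although
      \<open>state_cov\<close> depends on l'.\<close>
    have "objective P M s0 e K l' = - (H 0 \<bullet> init_cov P + G \<bullet> noise_cov l')" for l'
      unfolding objective by (simp add: H_def)
    moreover have "GDERIV (\<lambda>l'. - (H 0 \<bullet> init_cov P + G \<bullet> noise_cov l')) l :>
        - (0 + 2 *\<^sub>R diag_vec (noise_cov l ** G))"
      by (intro GDERIV_minus GDERIV_add GDERIV_const GDERIV_noise_cov)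
    ultimately show ?thesis by simp
  qed
  have Pcov_rec: "Pcov 0 = init_cov P" "\<forall>t<CARD('t). Pcov (t + 1) =
        Fcl P K ** Pcov t ** transpose (Fcl P K) + dynB P ** noise_cov l ** transpose (dynB P)"
    by (auto simp: cov)
  show ?thesis
    using second_moments[OF costs assms(3) model] Pcov_rec GK Gl[unfolded G_def] by blast
qed

end
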